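(* Let $w$ be a weight structure on a triangulated category $\mathcal C$ with heart $Hw$. 1. Let $\mathcal D\subset\mathcal C$ be a (full) triangulated subcategory of $\mathcal C$; suppose that $w$ induces a weight structure on $\mathcal D$ (i.e. $\mathrm{Obj}\,\mathcal D\cap\mathcal C^{w\le0}$ and $\mathrm{Obj}\,\mathcal D\cap\mathcal C^{w\ge0}$ give a weight structure for $\mathcal D$). Denote the heart of the latter weight structure by $HD$. Then $w$ induces a weight structure on the localization (Verdier quotient) $\mathcal C/\mathcal D$, i.e. the Karoubi-closures of $\mathcal C^{w\le0}$ and $\mathcal C^{w\ge0}$ in $\mathcal C/\mathcal D$ give a weight structure for $\mathcal C/\mathcal D$ (note that $\mathrm{Obj}\,\mathcal C=\mathrm{Obj}\,\mathcal C/\mathcal D$). 2. The heart $H(\mathcal C/\mathcal D)$ of this weight structure is the Karoubi-closure of $\frac{Hw}{HD}$ in $\mathcal C/\mathcal D$. 3. If $(\mathcal C,w)$ is bounded (above, below, or both), then $\mathcal C/\mathcal D$ also is.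
   Context: $D\perp E$ means $\mathcal C(X,Y)=0$ for all $X\in D$, $Y\in E$. A weight structure $w$ on a triangulated category $\mathcal C$ is a pair of subclasses $\mathcal C^{w\le 0},\mathcal C^{w\ge 0}\subset\mathrm{Obj}\,\mathcal C$ such that: (i) both are additive and Karoubi-closed in $\mathcal C$ (contain all retracts of their objects); (ii) $\mathcal C^{w\ge 0}\subset \mathcal C^{w\ge 0}[1]$ and $\mathcal C^{w\le 0}[1]\subset \mathcal C^{w\le 0}$; (iii) $\mathcal C^{w\ge 0}\perp\mathcal C^{w\le 0}[1]$; (iv) for every $X$ there is a distinguished triangle $B[-1]\to X\to A\to B$ with $A\in\mathcal C^{w\le 0}$, $B\in\mathcal C^{w\ge 0}$. The heart $Hw$ is the full subcategory on $\mathcal C^{w\ge0}\cap\mathcal C^{w\le0}$. $w$ is bounded above (resp. below) if $\bigcup_l\mathcal C^{w\le0}[-l]=\mathrm{Obj}\,\mathcal C$ (resp. $\bigcup_l\mathcal C^{w\ge0}[-l]=\mathrm{Obj}\,\mathcal C$). The Karoubi-closure of a class (or subcategory) consists of all retracts of its objects in the ambient category. The factor $\frac AB$ of an additive category $A$ by a full additive subcategory $B$ has $\mathrm{Obj}\,\frac AB=\mathrm{Obj}\,A$ and $\frac AB(X,Y)=A(X,Y)/\bigl(\sum_{Z\in\mathrm{Obj}\,B}A(Z,Y)\circ A(X,Z)\bigr)$. *)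

theory Defs
  imports "HOL-Algebra.Generated_Groups"
begin

section \<open>Preadditive and additive categories\<close>

text \<open>
  Categories are carried by sets of objects and arrows inside two types. Every arrow knows its
  domain and codomain, so different hom-sets are disjoint; composition is written in the usual
  order (\<open>g \<cdot> f\<close> means first \<open>f\<close>, then \<open>g\<close>).
\<close>

record ('o, 'm) preadd_cat =
  Obj :: "'o set"
  Arr :: "'m set"
  Dom :: "'m \<Rightarrow> 'o"
  Cod :: "'m \<Rightarrow> 'o"
  Ident :: "'o \<Rightarrow> 'm"
  Comp :: "'m \<Rightarrow> 'm \<Rightarrow> 'm" (infixl "\<cdot>\<index>" 75)
  ZeroArr :: "'o \<Rightarrow> 'o \<Rightarrow> 'm"
  AddArr :: "'m \<Rightarrow> 'm \<Rightarrow> 'm" (infixl "\<boxplus>\<index>" 65)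

definition Hom :: "('o, 'm, 'x) preadd_cat_scheme \<Rightarrow> 'o \<Rightarrow> 'o \<Rightarrow> 'm set" where
  "Hom C X Y = {f \<in> Arr C. Dom C f = X \<and> Cod C f = Y}"

text \<open>The group \<open>C(X, Y)\<close>, written multiplicatively in order to use the library's groups.\<close>

definition hom_group :: "('o, 'm, 'x) preadd_cat_scheme \<Rightarrow> 'o \<Rightarrow> 'o \<Rightarrow> 'm monoid" where
  "hom_group C X Y = \<lparr>carrier = Hom C X Y, mult = AddArr C, one = ZeroArr C X Y\<rparr>"

definition neg_arr :: "('o, 'm, 'x) preadd_cat_scheme \<Rightarrow> 'm \<Rightarrow> 'm" where
  "neg_arr C f = inv\<^bsub>hom_group C (Dom C f) (Cod C f)\<^esub> f"

locale preadditive_category =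
  fixes C :: "('o, 'm, 'x) preadd_cat_scheme" (structure)
  assumes dom_cod: "f \<in> Arr C \<Longrightarrow> Dom C f \<in> Obj C \<and> Cod C f \<in> Obj C"
    and ident_hom: "X \<in> Obj C \<Longrightarrow> Ident C X \<in> Hom C X X"
    and comp_hom: "\<lbrakk>f \<in> Hom C X Y; g \<in> Hom C Y Z\<rbrakk> \<Longrightarrow> g \<cdot> f \<in> Hom C X Z"
    and ident_right: "f \<in> Hom C X Y \<Longrightarrow> f \<cdot> Ident C X = f"
    and ident_left: "f \<in> Hom C X Y \<Longrightarrow> Ident C Y \<cdot> f = f"
    and comp_assoc: "\<lbrakk>f \<in> Hom C X Y; g \<in> Hom C Y Z; h \<in> Hom C Z W\<rbrakk>
      \<Longrightarrow> h \<cdot> (g \<cdot> f) = (h \<cdot> g) \<cdot> f"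
    and hom_comm_group: "\<lbrakk>X \<in> Obj C; Y \<in> Obj C\<rbrakk> \<Longrightarrow> comm_group (hom_group C X Y)"
    and comp_add_right: "\<lbrakk>f \<in> Hom C X Y; f' \<in> Hom C X Y; g \<in> Hom C Y Z\<rbrakk>
      \<Longrightarrow> g \<cdot> (f \<boxplus> f') = (g \<cdot> f) \<boxplus> (g \<cdot> f')"
    and comp_add_left: "\<lbrakk>f \<in> Hom C X Y; g \<in> Hom C Y Z; g' \<in> Hom C Y Z\<rbrakk>
      \<Longrightarrow> (g \<boxplus> g') \<cdot> f = (g \<cdot> f) \<boxplus> (g' \<cdot> f)"

definition zero_object :: "('o, 'm, 'x) preadd_cat_scheme \<Rightarrow> 'o \<Rightarrow> bool" where
  "zero_object C X \<longleftrightarrow> X \<in> Obj C \<and> Ident C X = ZeroArr C X X"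

definition biproduct :: "('o, 'm, 'x) preadd_cat_scheme \<Rightarrow> 'o \<Rightarrow> 'o \<Rightarrow> 'o \<Rightarrow> bool" where
  "biproduct C X Y Z \<longleftrightarrow> Z \<in> Obj C \<and>
    (\<exists>i \<in> Hom C X Z. \<exists>j \<in> Hom C Y Z. \<exists>p \<in> Hom C Z X. \<exists>q \<in> Hom C Z Y.
      p \<cdot>\<^bsub>C\<^esub> i = Ident C X \<and> q \<cdot>\<^bsub>C\<^esub> j = Ident C Y \<and>
      p \<cdot>\<^bsub>C\<^esub> j = ZeroArr C Y X \<and> q \<cdot>\<^bsub>C\<^esub> i = ZeroArr C X Y \<and>
      (i \<cdot>\<^bsub>C\<^esub> p) \<boxplus>\<^bsub>C\<^esub> (j \<cdot>\<^bsub>C\<^esub> q) = Ident C Z)"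

locale additive_category = preadditive_category +
  assumes ex_zero_object: "\<exists>X. zero_object C X"
    and ex_biproduct: "\<lbrakk>X \<in> Obj C; Y \<in> Obj C\<rbrakk> \<Longrightarrow> \<exists>Z. biproduct C X Y Z"

definition full_sub ::
  "('o, 'm, 'x) preadd_cat_scheme \<Rightarrow> 'o set \<Rightarrow> ('o, 'm, 'x) preadd_cat_scheme" where
  "full_sub C S = C\<lparr>Obj := S, Arr := {f \<in> Arr C. Dom C f \<in> S \<and> Cod C f \<in> S}\<rparr>"

definition iso_arr :: "('o, 'm, 'x) preadd_cat_scheme \<Rightarrow> 'm \<Rightarrow> 'o \<Rightarrow> 'o \<Rightarrow> bool" where
  "iso_arr C f X Y \<longleftrightarrow> f \<in> Hom C X Y \<and>
    (\<exists>g \<in> Hom C Y X. g \<cdot>\<^bsub>C\<^esub> f = Ident C X \<and> f \<cdot>\<^bsub>C\<^esub> g = Ident C Y)"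

definition retract :: "('o, 'm, 'x) preadd_cat_scheme \<Rightarrow> 'o \<Rightarrow> 'o \<Rightarrow> bool" where
  "retract C X Y \<longleftrightarrow> X \<in> Obj C \<and> Y \<in> Obj C \<and>
    (\<exists>i \<in> Hom C X Y. \<exists>p \<in> Hom C Y X. p \<cdot>\<^bsub>C\<^esub> i = Ident C X)"

definition karoubi_closure :: "('o, 'm, 'x) preadd_cat_scheme \<Rightarrow> 'o set \<Rightarrow> 'o set" where
  "karoubi_closure C S = {X. \<exists>Y \<in> S. retract C X Y}"

definition karoubi_closed :: "('o, 'm, 'x) preadd_cat_scheme \<Rightarrow> 'o set \<Rightarrow> bool" where
  "karoubi_closed C S \<longleftrightarrow> karoubi_closure C S \<subseteq> S"

definition orthogonal :: "('o, 'm, 'x) preadd_cat_scheme \<Rightarrow> 'o set \<Rightarrow> 'o set \<Rightarrow> bool" where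
  "orthogonal C S T \<longleftrightarrow> (\<forall>X \<in> S. \<forall>Y \<in> T. Hom C X Y = {ZeroArr C X Y})"

definition additive_functor ::
  "('o, 'm, 'x) preadd_cat_scheme \<Rightarrow> ('p, 'n, 'y) preadd_cat_scheme
    \<Rightarrow> ('o \<Rightarrow> 'p) \<Rightarrow> ('m \<Rightarrow> 'n) \<Rightarrow> bool" where
  "additive_functor A B Fo Fm \<longleftrightarrow>
    (\<forall>X \<in> Obj A. Fo X \<in> Obj B \<and> Fm (Ident A X) = Ident B (Fo X)) \<and>
    (\<forall>X \<in> Obj A. \<forall>Y \<in> Obj A. \<forall>f \<in> Hom A X Y. Fm f \<in> Hom B (Fo X) (Fo Y)) \<and>
    (\<forall>X \<in> Obj A. \<forall>Y \<in> Obj A. \<forall>f \<in> Hom A X Y. \<forall>g \<in> Hom A X Y.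
      Fm (f \<boxplus>\<^bsub>A\<^esub> g) = Fm f \<boxplus>\<^bsub>B\<^esub> Fm g) \<and>
    (\<forall>X \<in> Obj A. \<forall>Y \<in> Obj A. \<forall>Z \<in> Obj A. \<forall>f \<in> Hom A X Y. \<forall>g \<in> Hom A Y Z.
      Fm (g \<cdot>\<^bsub>A\<^esub> f) = Fm g \<cdot>\<^bsub>B\<^esub> Fm f)"

definition fully_faithful ::
  "('o, 'm, 'x) preadd_cat_scheme \<Rightarrow> ('p, 'n, 'y) preadd_cat_scheme
    \<Rightarrow> ('o \<Rightarrow> 'p) \<Rightarrow> ('m \<Rightarrow> 'n) \<Rightarrow> bool" where
  "fully_faithful A B Fo Fm \<longleftrightarrow>
    (\<forall>X \<in> Obj A. \<forall>Y \<in> Obj A. bij_betw Fm (Hom A X Y) (Hom B (Fo X) (Fo Y)))"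


section \<open>The factor of an additive category by a full additive subcategory\<close>

text \<open>
  The full subcategory is given by its set \<open>S\<close> of objects. The subgroup divided out is the sum
  over \<open>Z \<in> S\<close> of \<open>A(Z, Y) \<circ> A(X, Z)\<close>, i.e. the subgroup generated by the
  arrows that factor through some \<open>Z \<in> S\<close>. Arrows of the factor are cosets, tagged with
  their domain and codomain.
\<close>

definition through :: "('o, 'm, 'x) preadd_cat_scheme \<Rightarrow> 'o set \<Rightarrow> 'o \<Rightarrow> 'o \<Rightarrow> 'm set" where
  "through A S X Y = generate (hom_group A X Y)
    {g \<cdot>\<^bsub>A\<^esub> f | f g Z. Z \<in> S \<and> f \<in> Hom A X Z \<and> g \<in> Hom A Z Y}"

definition factor_arr ::
  "('o, 'm, 'x) preadd_cat_scheme \<Rightarrow> 'o set \<Rightarrow> 'm \<Rightarrow> 'o \<times> 'o \<times> 'm set" where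
  "factor_arr A S f = (Dom A f, Cod A f,
    through A S (Dom A f) (Cod A f) #>\<^bsub>hom_group A (Dom A f) (Cod A f)\<^esub> f)"

definition factor_cat ::
  "('o, 'm, 'x) preadd_cat_scheme \<Rightarrow> 'o set \<Rightarrow> ('o, 'o \<times> 'o \<times> 'm set) preadd_cat" where
  "factor_cat A S =
    \<lparr>Obj = Obj A,
     Arr = factor_arr A S ` Arr A,
     Dom = (\<lambda>(X, Y, K). X),
     Cod = (\<lambda>(X, Y, K). Y),
     Ident = (\<lambda>X. factor_arr A S (Ident A X)),
     Comp = (\<lambda>\<psi> \<phi>. THE \<chi>. \<exists>f \<in> Arr A. \<exists>g \<in> Arr A. Cod A f = Dom A g \<and>
       \<phi> = factor_arr A S f \<and> \<psi> = factor_arr A S g \<and> \<chi> = factor_arr A S (g \<cdot>\<^bsub>A\<^esub> f)),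
     ZeroArr = (\<lambda>X Y. factor_arr A S (ZeroArr A X Y)),
     AddArr = (\<lambda>\<phi> \<psi>. THE \<chi>. \<exists>f \<in> Arr A. \<exists>g \<in> Arr A. Dom A f = Dom A g \<and> Cod A f = Cod A g \<and>
       \<phi> = factor_arr A S f \<and> \<psi> = factor_arr A S g \<and> \<chi> = factor_arr A S (f \<boxplus>\<^bsub>A\<^esub> g))\<rparr>"


section \<open>Triangulated categories\<close>

record ('o, 'm) shift_cat = "('o, 'm) preadd_cat" +
  ShO :: "'o \<Rightarrow> 'o"
  ShM :: "'m \<Rightarrow> 'm"

record ('o, 'm) tri_cat = "('o, 'm) shift_cat" +
  DTri :: "'m \<Rightarrow> 'm \<Rightarrow> 'm \<Rightarrow> bool"

definition shift_obj :: "('o, 'm, 'x) shift_cat_scheme \<Rightarrow> int \<Rightarrow> 'o \<Rightarrow> 'o" where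
  "shift_obj C n X = (if n \<ge> 0 then (ShO C ^^ nat n) X
     else (inv_into (Obj C) (ShO C) ^^ nat (- n)) X)"

definition is_triangle :: "('o, 'm, 'x) shift_cat_scheme \<Rightarrow> 'm \<Rightarrow> 'm \<Rightarrow> 'm \<Rightarrow> bool" where
  "is_triangle C f g h \<longleftrightarrow> f \<in> Arr C \<and> g \<in> Arr C \<and> h \<in> Arr C \<and>
    Cod C f = Dom C g \<and> Cod C g = Dom C h \<and> Cod C h = ShO C (Dom C f)"

definition triangle_iso ::
  "('o, 'm, 'x) shift_cat_scheme \<Rightarrow> 'm \<Rightarrow> 'm \<Rightarrow> 'm \<Rightarrow> 'm \<Rightarrow> 'm \<Rightarrow> 'm \<Rightarrow> bool" where
  "triangle_iso C f g h f' g' h' \<longleftrightarrow> is_triangle C f g h \<and> is_triangle C f' g' h' \<and>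
    (\<exists>a b c. iso_arr C a (Dom C f) (Dom C f') \<and> iso_arr C b (Dom C g) (Dom C g') \<and>
      iso_arr C c (Dom C h) (Dom C h') \<and>
      b \<cdot>\<^bsub>C\<^esub> f = f' \<cdot>\<^bsub>C\<^esub> a \<and> c \<cdot>\<^bsub>C\<^esub> g = g' \<cdot>\<^bsub>C\<^esub> b \<and> ShM C a \<cdot>\<^bsub>C\<^esub> h = h' \<cdot>\<^bsub>C\<^esub> c)"

text \<open>
  As in Verdier's definition, the shift is an additive automorphism (not just an
  autoequivalence) of the category, so that \<open>X[n]\<close> is an actual object for every integer \<open>n\<close>.
\<close>

locale triangulated_category = additive_category C
  for C :: "('o, 'm, 'x) tri_cat_scheme" (structure) +
  assumes shift_bij_obj: "bij_betw (ShO C) (Obj C) (Obj C)"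
    and shift_bij_hom: "\<lbrakk>X \<in> Obj C; Y \<in> Obj C\<rbrakk>
      \<Longrightarrow> bij_betw (ShM C) (Hom C X Y) (Hom C (ShO C X) (ShO C Y))"
    and shift_ident: "X \<in> Obj C \<Longrightarrow> ShM C (Ident C X) = Ident C (ShO C X)"
    and shift_comp: "\<lbrakk>f \<in> Hom C X Y; g \<in> Hom C Y Z\<rbrakk>
      \<Longrightarrow> ShM C (g \<cdot> f) = ShM C g \<cdot> ShM C f"
    and shift_add: "\<lbrakk>f \<in> Hom C X Y; g \<in> Hom C X Y\<rbrakk>
      \<Longrightarrow> ShM C (f \<boxplus> g) = ShM C f \<boxplus> ShM C g"
    and dtri_triangle: "DTri C f g h \<Longrightarrow> is_triangle C f g h"
    and TR1_ident: "\<lbrakk>X \<in> Obj C; zero_object C Z\<rbrakk>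
      \<Longrightarrow> DTri C (Ident C X) (ZeroArr C X Z) (ZeroArr C Z (ShO C X))"
    and TR1_cone: "f \<in> Arr C \<Longrightarrow> \<exists>g h. DTri C f g h"
    and TR1_iso: "\<lbrakk>DTri C f g h; triangle_iso C f g h f' g' h'\<rbrakk> \<Longrightarrow> DTri C f' g' h'"
    and TR2: "is_triangle C f g h
      \<Longrightarrow> DTri C f g h \<longleftrightarrow> DTri C g h (neg_arr C (ShM C f))"
    and TR3: "\<lbrakk>DTri C f g h; DTri C f' g' h';
        a \<in> Hom C (Dom C f) (Dom C f'); b \<in> Hom C (Dom C g) (Dom C g'); b \<cdot> f = f' \<cdot> a\<rbrakk>
      \<Longrightarrow> \<exists>c \<in> Hom C (Dom C h) (Dom C h'). c \<cdot> g = g' \<cdot> b \<and> ShM C a \<cdot> h = h' \<cdot> c"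
    and TR4: "\<lbrakk>f \<in> Hom C X Y; g \<in> Hom C Y Z;
        DTri C f a b; DTri C g c d; DTri C (g \<cdot> f) e k\<rbrakk>
      \<Longrightarrow> \<exists>u \<in> Hom C (Cod C a) (Cod C e). \<exists>v \<in> Hom C (Cod C e) (Cod C c).
            DTri C u v (ShM C a \<cdot> d) \<and>
            u \<cdot> a = e \<cdot> g \<and> k \<cdot> u = b \<and> v \<cdot> e = c \<and> d \<cdot> v = ShM C f \<cdot> k"

text \<open>
  Full triangulated subcategories are given by their sets of objects, which need not be closed
  under isomorphism: it is only required that some cone of every arrow lies in the subcategory.
  (Zero objects and biproducts, up to isomorphism, are obtained as such cones.)
\<close>

definition triangulated_subcategory :: "('o, 'm, 'x) tri_cat_scheme \<Rightarrow> 'o set \<Rightarrow> bool" where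
  "triangulated_subcategory C D \<longleftrightarrow> D \<subseteq> Obj C \<and> D \<noteq> {} \<and>
    (\<forall>X \<in> D. shift_obj C 1 X \<in> D \<and> shift_obj C (- 1) X \<in> D) \<and>
    (\<forall>X \<in> D. \<forall>Y \<in> D. \<forall>f \<in> Hom C X Y. \<exists>g h. DTri C f g h \<and> Cod C g \<in> D)"

definition tri_sub ::
  "('o, 'm, 'x) tri_cat_scheme \<Rightarrow> 'o set \<Rightarrow> ('o, 'm, 'x) tri_cat_scheme" where
  "tri_sub C D = (full_sub C D)
    \<lparr>DTri := (\<lambda>f g h. DTri C f g h \<and> Dom C f \<in> D \<and> Dom C g \<in> D \<and> Dom C h \<in> D)\<rparr>"


section \<open>The Verdier quotient\<close>

text \<open>
  Arrows \<open>X \<rightarrow> Y\<close> of the quotient are classes of roofs \<open>X \<leftarrow> Z \<rightarrow> Y\<close> whose left leg \<open>s\<close> has a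
  cone in \<open>D\<close>. The pair \<open>(s, f)\<close> represents the fraction \<open>f \<circ> s\<inverse>\<close>.
\<close>

definition cone_in :: "('o, 'm, 'x) tri_cat_scheme \<Rightarrow> 'o set \<Rightarrow> 'm \<Rightarrow> bool" where
  "cone_in C D s \<longleftrightarrow> (\<exists>g h. DTri C s g h \<and> Cod C g \<in> D)"

definition roof :: "('o, 'm, 'x) tri_cat_scheme \<Rightarrow> 'o set \<Rightarrow> 'm \<Rightarrow> 'm \<Rightarrow> bool" where
  "roof C D s f \<longleftrightarrow> s \<in> Arr C \<and> f \<in> Arr C \<and> Dom C s = Dom C f \<and> cone_in C D s"

definition roof_equiv ::
  "('o, 'm, 'x) tri_cat_scheme \<Rightarrow> 'o set \<Rightarrow> 'm \<Rightarrow> 'm \<Rightarrow> 'm \<Rightarrow> 'm \<Rightarrow> bool" where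
  "roof_equiv C D s f s' f' \<longleftrightarrow> roof C D s f \<and> roof C D s' f' \<and>
    Cod C s = Cod C s' \<and> Cod C f = Cod C f' \<and>
    (\<exists>W. \<exists>t \<in> Hom C W (Dom C s). \<exists>t' \<in> Hom C W (Dom C s').
      s \<cdot>\<^bsub>C\<^esub> t = s' \<cdot>\<^bsub>C\<^esub> t' \<and> f \<cdot>\<^bsub>C\<^esub> t = f' \<cdot>\<^bsub>C\<^esub> t' \<and> cone_in C D (s \<cdot>\<^bsub>C\<^esub> t))"

definition frac ::
  "('o, 'm, 'x) tri_cat_scheme \<Rightarrow> 'o set \<Rightarrow> 'm \<Rightarrow> 'm \<Rightarrow> 'o \<times> 'o \<times> ('m \<times> 'm) set" where
  "frac C D s f = (Cod C s, Cod C f, {(s', f'). roof_equiv C D s f s' f'})"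

text \<open>
  Composition uses an Ore square \<open>f \<circ> u = t \<circ> v\<close>, with \<open>u\<close> having a cone in \<open>D\<close>; addition uses
  a common denominator.
\<close>

definition verdier_shift_cat ::
  "('o, 'm, 'x) tri_cat_scheme \<Rightarrow> 'o set \<Rightarrow> ('o, 'o \<times> 'o \<times> ('m \<times> 'm) set) shift_cat" where
  "verdier_shift_cat C D =
    \<lparr>Obj = Obj C,
     Arr = {frac C D s f | s f. roof C D s f},
     Dom = (\<lambda>(X, Y, K). X),
     Cod = (\<lambda>(X, Y, K). Y),
     Ident = (\<lambda>X. frac C D (Ident C X) (Ident C X)),
     Comp = (\<lambda>\<psi> \<phi>. THE \<chi>. \<exists>s f t g W u v.
       roof C D s f \<and> roof C D t g \<and> \<phi> = frac C D s f \<and> \<psi> = frac C D t g \<and>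
       u \<in> Hom C W (Dom C f) \<and> v \<in> Hom C W (Dom C t) \<and> cone_in C D u \<and>
       Cod C f = Cod C t \<and> f \<cdot>\<^bsub>C\<^esub> u = t \<cdot>\<^bsub>C\<^esub> v \<and>
       \<chi> = frac C D (s \<cdot>\<^bsub>C\<^esub> u) (g \<cdot>\<^bsub>C\<^esub> v)),
     ZeroArr = (\<lambda>X Y. frac C D (Ident C X) (ZeroArr C X Y)),
     AddArr = (\<lambda>\<phi> \<psi>. THE \<chi>. \<exists>s f g.
       roof C D s f \<and> roof C D s g \<and> Cod C f = Cod C g \<and>
       \<phi> = frac C D s f \<and> \<psi> = frac C D s g \<and> \<chi> = frac C D s (f \<boxplus>\<^bsub>C\<^esub> g)),
     ShO = ShO C,
     ShM = (\<lambda>\<phi>. THE \<chi>. \<exists>s f. roof C D s f \<and> \<phi> = frac C D s f \<and>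
       \<chi> = frac C D (ShM C s) (ShM C f))\<rparr>"

text \<open>The localization functor is the identity on objects.\<close>

definition loc_arr ::
  "('o, 'm, 'x) tri_cat_scheme \<Rightarrow> 'o set \<Rightarrow> 'm \<Rightarrow> 'o \<times> 'o \<times> ('m \<times> 'm) set" where
  "loc_arr C D f = frac C D (Ident C (Dom C f)) f"

text \<open>
  The distinguished triangles of the quotient are those isomorphic, in the quotient, to images
  of distinguished triangles.
\<close>

definition verdier_quotient ::
  "('o, 'm, 'x) tri_cat_scheme \<Rightarrow> 'o set \<Rightarrow> ('o, 'o \<times> 'o \<times> ('m \<times> 'm) set) tri_cat" where
  "verdier_quotient C D = shift_cat.extend (verdier_shift_cat C D)
    (tri_cat.fields (\<lambda>\<phi> \<psi> \<chi>. \<exists>f g h. DTri C f g h \<and>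
      triangle_iso (verdier_shift_cat C D)
        (loc_arr C D f) (loc_arr C D g) (loc_arr C D h) \<phi> \<psi> \<chi>))"


section \<open>Weight structures\<close>

text \<open>
  The predicate expresses the axioms only; it is meant for \<open>C\<close> triangulated (which Verdier
  quotients of triangulated categories are). A class of objects is additive if the full
  subcategory on it is. In the last clause the triangle is \<open>B[-1] \<rightarrow> X \<rightarrow> A \<rightarrow> B\<close>.
\<close>

definition weight_structure ::
  "('o, 'm, 'x) tri_cat_scheme \<Rightarrow> 'o set \<Rightarrow> 'o set \<Rightarrow> bool" where
  "weight_structure C wle wge \<longleftrightarrow>
    wle \<subseteq> Obj C \<and> wge \<subseteq> Obj C \<and>
    additive_category (full_sub C wle) \<and> additive_category (full_sub C wge) \<and>
    karoubi_closed C wle \<and> karoubi_closed C wge \<and>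
    wge \<subseteq> shift_obj C 1 ` wge \<and> shift_obj C 1 ` wle \<subseteq> wle \<and>
    orthogonal C wge (shift_obj C 1 ` wle) \<and>
    (\<forall>X \<in> Obj C. \<exists>A \<in> wle. \<exists>B \<in> wge.
      \<exists>f \<in> Hom C (shift_obj C (- 1) B) X. \<exists>g \<in> Hom C X A. \<exists>h \<in> Hom C A B. DTri C f g h)"

definition heart ::
  "('o, 'm, 'x) tri_cat_scheme \<Rightarrow> 'o set \<Rightarrow> 'o set \<Rightarrow> ('o, 'm, 'x) tri_cat_scheme" where
  "heart C wle wge = full_sub C (wge \<inter> wle)"

definition bounded_above :: "('o, 'm, 'x) tri_cat_scheme \<Rightarrow> 'o set \<Rightarrow> bool" where
  "bounded_above C wle \<longleftrightarrow> (\<Union>l. shift_obj C (- l) ` wle) = Obj C"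

definition bounded_below :: "('o, 'm, 'x) tri_cat_scheme \<Rightarrow> 'o set \<Rightarrow> bool" where
  "bounded_below C wge \<longleftrightarrow> (\<Union>l. shift_obj C (- l) ` wge) = Obj C"

end

theory Submission
  imports Defs
begin

text \<open>
  Arrows with a cone in \<open>D\<close> admit a calculus of right fractions. The key point is that a
  denominator \<open>s\<close> whose target lies in \<open>wge\<close> can be refined to one whose cone lies in
  \<open>D \<inter> wge\<close>: decompose the cone in \<open>D\<close> and use orthogonality. A numerator with target in \<open>wle\<close>
  then extends along the refined denominator, so every arrow of the quotient from \<open>wge\<close> to \<open>wle\<close>
  comes from \<open>C\<close>; orthogonality in the quotient follows from orthogonality in \<open>C\<close>. Moreover an
  arrow from \<open>wge\<close> to \<open>wle\<close> that dies in the quotient factors through a cone in \<open>D \<inter> wge\<close>, and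
  hence through the heart of \<open>D\<close>. This identifies the hom-groups between objects of the heart
  with those of the factor category.
\<close>

text \<open>Fractions are controlled only from \<open>wge\<close> to \<open>wle\<close>: refining a
  denominator needs the source of the fraction in \<open>wge\<close>, extending the numerator needs
  its target in \<open>wle\<close>. An object of \<open>qge\<close> or \<open>qle\<close> is merely
  a retract, in the quotient, of an object of \<open>wge\<close> or \<open>wle\<close>, so a
  statement about it is first moved to such objects by composing with sections and retractions. The
  heart of \<open>C\<close> lies in both classes, which is why all its hom-sets in the quotient can
  be computed. Two features of the encoding shape the preparations. \<open>D\<close> need not be
  closed under isomorphism, so a cone is placed in \<open>D\<close> by exchanging it for an
  isomorphic one, and even a zero object in \<open>D\<close> has to be constructed. The operations
  of the quotient and of the factor are definite descriptions over representatives, so each needs a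
  proof of independence. For the quotient this is the calculus of fractions; for the factor it
  follows from functoriality of the localization, once the subgroup divided out is recognised as its
  kernel.\<close>

lemma in_Hom_iff [simp]: "f \<in> Hom C X Y \<longleftrightarrow> f \<in> Arr C \<and> Dom C f = X \<and> Cod C f = Y"
  by (auto simp: Hom_def)

section \<open>Preadditive categories\<close>

context preadditive_category
begin

lemma dom_obj [simp]: "f \<in> Arr C \<Longrightarrow> Dom C f \<in> Obj C"
  and cod_obj [simp]: "f \<in> Arr C \<Longrightarrow> Cod C f \<in> Obj C"
  using dom_cod by auto

lemma ident_arr [simp]:
  assumes "X \<in> Obj C"
  shows "Ident C X \<in> Arr C" "Dom C (Ident C X) = X" "Cod C (Ident C X) = X"
  using ident_hom[OF assms] by auto

lemma comp_arr [simp]: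
  assumes "f \<in> Arr C" "g \<in> Arr C" "Cod C f = Dom C g"
  shows "g \<cdot> f \<in> Arr C" "Dom C (g \<cdot> f) = Dom C f" "Cod C (g \<cdot> f) = Cod C g"
  using comp_hom[of f "Dom C f" "Cod C f" g "Cod C g"] assms by auto

lemma comp_ident_right [simp]: "f \<in> Arr C \<Longrightarrow> Dom C f = X \<Longrightarrow> f \<cdot> Ident C X = f"
  using ident_right by auto

lemma comp_ident_left [simp]: "f \<in> Arr C \<Longrightarrow> Cod C f = Y \<Longrightarrow> Ident C Y \<cdot> f = f"
  using ident_left by auto

lemma assoc [simp]:
  assumes "f \<in> Arr C" "g \<in> Arr C" "h \<in> Arr C" "Cod C f = Dom C g" "Cod C g = Dom C h"
  shows "(h \<cdot> g) \<cdot> f = h \<cdot> (g \<cdot> f)"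
  using comp_assoc[of f "Dom C f" "Cod C f" g "Cod C g" h "Cod C h"] assms by auto

text \<open>The simp rule \<open>assoc\<close> nests composites to the right and thereby hides
  \<open>g \<cdot> f\<close> inside \<open>g \<cdot> (f \<cdot> h)\<close>; this rule applies an
  equation of composites in that nested position.\<close>

lemma comp_cong:
  assumes "g \<cdot> f = g' \<cdot> f'" "f \<in> Arr C" "g \<in> Arr C" "f' \<in> Arr C" "g' \<in> Arr C" "h \<in> Arr C"
    "Cod C f = Dom C g" "Cod C f' = Dom C g'" "Cod C h = Dom C f" "Dom C f' = Dom C f"
  shows "g \<cdot> (f \<cdot> h) = g' \<cdot> (f' \<cdot> h)"
  using assms assoc[of h f g] assoc[of h f' g'] by simp

lemma zero_arr [simp]:
  assumes "X \<in> Obj C" "Y \<in> Obj C"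
  shows "ZeroArr C X Y \<in> Arr C" "Dom C (ZeroArr C X Y) = X" "Cod C (ZeroArr C X Y) = Y"
proof -
  interpret comm_group "hom_group C X Y" using hom_comm_group[OF assms] .
  from one_closed show "ZeroArr C X Y \<in> Arr C" "Dom C (ZeroArr C X Y) = X" "Cod C (ZeroArr C X Y) = Y"
    by (auto simp: hom_group_def)
qed

lemma add_arr [simp]:
  assumes "f \<in> Arr C" "g \<in> Arr C" "Dom C g = Dom C f" "Cod C g = Cod C f"
  shows "f \<boxplus> g \<in> Arr C" "Dom C (f \<boxplus> g) = Dom C f" "Cod C (f \<boxplus> g) = Cod C f"
proof -
  interpret comm_group "hom_group C (Dom C f) (Cod C f)" using assms by (intro hom_comm_group) auto
  from m_closed[of f g] assms
  show "f \<boxplus> g \<in> Arr C" "Dom C (f \<boxplus> g) = Dom C f" "Cod C (f \<boxplus> g) = Cod C f"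
    by (auto simp: hom_group_def)
qed

lemma neg_arr [simp]:
  assumes "f \<in> Arr C"
  shows "neg_arr C f \<in> Arr C" "Dom C (neg_arr C f) = Dom C f" "Cod C (neg_arr C f) = Cod C f"
proof -
  interpret comm_group "hom_group C (Dom C f) (Cod C f)" using assms by (intro hom_comm_group) auto
  from inv_closed[of f] assms
  show "neg_arr C f \<in> Arr C" "Dom C (neg_arr C f) = Dom C f" "Cod C (neg_arr C f) = Cod C f"
    by (auto simp: hom_group_def neg_arr_def)
qed

lemma add_zero [simp]:
  assumes "f \<in> Arr C" "Dom C f = X" "Cod C f = Y"
  shows "f \<boxplus> ZeroArr C X Y = f" "ZeroArr C X Y \<boxplus> f = f"
proof -
  interpret comm_group "hom_group C X Y" using assms by (intro hom_comm_group) auto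
  show "f \<boxplus> ZeroArr C X Y = f" "ZeroArr C X Y \<boxplus> f = f"
    using l_one[of f] r_one[of f] assms by (auto simp: hom_group_def)
qed

lemma add_neg [simp]:
  assumes "f \<in> Arr C"
  shows "f \<boxplus> neg_arr C f = ZeroArr C (Dom C f) (Cod C f)"
    "neg_arr C f \<boxplus> f = ZeroArr C (Dom C f) (Cod C f)"
proof -
  interpret comm_group "hom_group C (Dom C f) (Cod C f)" using assms by (intro hom_comm_group) auto
  show "f \<boxplus> neg_arr C f = ZeroArr C (Dom C f) (Cod C f)"
    "neg_arr C f \<boxplus> f = ZeroArr C (Dom C f) (Cod C f)"
    using l_inv[of f] r_inv[of f] assms by (auto simp: hom_group_def neg_arr_def)
qed

lemma add_assoc:
  assumes "f \<in> Arr C" "g \<in> Arr C" "h \<in> Arr C" "Dom C g = Dom C f" "Cod C g = Cod C f"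
    "Dom C h = Dom C f" "Cod C h = Cod C f"
  shows "f \<boxplus> g \<boxplus> h = f \<boxplus> (g \<boxplus> h)"
proof -
  interpret comm_group "hom_group C (Dom C f) (Cod C f)" using assms by (intro hom_comm_group) auto
  show ?thesis using m_assoc[of f g h] assms by (auto simp: hom_group_def)
qed

lemma add_comm:
  assumes "f \<in> Arr C" "g \<in> Arr C" "Dom C g = Dom C f" "Cod C g = Cod C f"
  shows "f \<boxplus> g = g \<boxplus> f"
proof -
  interpret comm_group "hom_group C (Dom C f) (Cod C f)" using assms by (intro hom_comm_group) auto
  show ?thesis using m_comm[of f g] assms by (auto simp: hom_group_def)
qed

lemma add_left_cancel:
  assumes "f \<boxplus> g = f \<boxplus> h" "f \<in> Arr C" "g \<in> Arr C" "h \<in> Arr C" "Dom C g = Dom C f" "Cod C g = Cod C f"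
    "Dom C h = Dom C f" "Cod C h = Cod C f"
  shows "g = h"
proof -
  have "neg_arr C f \<boxplus> (f \<boxplus> g) = neg_arr C f \<boxplus> (f \<boxplus> h)" using assms(1) by simp
  then show ?thesis
    using assms(2-) add_assoc[of "neg_arr C f" f g] add_assoc[of "neg_arr C f" f h] by simp
qed

text \<open>Any additive operation sends a zero arrow to an arrow equal to its own double.
  Composition and the shift are shown to preserve zero arrows in this way.\<close>

lemma add_idem_zero:
  assumes "f \<boxplus> f = f" "f \<in> Arr C"
  shows "f = ZeroArr C (Dom C f) (Cod C f)"
  by (rule add_left_cancel[of f]) (use assms in auto)

lemma neg_unique:
  assumes "f \<boxplus> g = ZeroArr C (Dom C f) (Cod C f)" "f \<in> Arr C" "g \<in> Arr C"
    "Dom C g = Dom C f" "Cod C g = Cod C f"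
  shows "g = neg_arr C f"
  by (rule add_left_cancel[of f]) (use assms in auto)

lemma neg_neg [simp]: "f \<in> Arr C \<Longrightarrow> neg_arr C (neg_arr C f) = f"
  by (rule neg_unique[symmetric]) auto

lemma eq_of_diff_zero:
  assumes "f \<boxplus> neg_arr C g = ZeroArr C (Dom C f) (Cod C f)" "f \<in> Arr C" "g \<in> Arr C"
    "Dom C g = Dom C f" "Cod C g = Cod C f"
  shows "f = g"
  using neg_unique[of f "neg_arr C g"] assms by (metis neg_arr neg_neg)

lemma comp_add [simp]:
  assumes "f \<in> Arr C" "f' \<in> Arr C" "g \<in> Arr C" "Dom C f' = Dom C f" "Cod C f' = Cod C f" "Cod C f = Dom C g"
  shows "g \<cdot> (f \<boxplus> f') = (g \<cdot> f) \<boxplus> (g \<cdot> f')"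
  using comp_add_right[of f "Dom C f" "Cod C f" f' g "Cod C g"] assms by simp

lemma add_comp [simp]:
  assumes "f \<in> Arr C" "g \<in> Arr C" "g' \<in> Arr C" "Dom C g' = Dom C g" "Cod C g' = Cod C g" "Cod C f = Dom C g"
  shows "(g \<boxplus> g') \<cdot> f = (g \<cdot> f) \<boxplus> (g' \<cdot> f)"
  using comp_add_left[of f "Dom C f" "Cod C f" g "Cod C g" g'] assms by simp

lemma comp_zero [simp]:
  assumes "g \<in> Arr C" "Dom C g = Y" "X \<in> Obj C"
  shows "g \<cdot> ZeroArr C X Y = ZeroArr C X (Cod C g)"
proof -
  have "Y \<in> Obj C" using assms by auto
  then have "g \<cdot> ZeroArr C X Y \<boxplus> g \<cdot> ZeroArr C X Y = g \<cdot> ZeroArr C X Y"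
    using assms comp_add[of "ZeroArr C X Y" "ZeroArr C X Y" g] by simp
  then show ?thesis using add_idem_zero \<open>Y \<in> Obj C\<close> assms by fastforce
qed

lemma zero_comp [simp]:
  assumes "f \<in> Arr C" "Cod C f = Y" "Z \<in> Obj C"
  shows "ZeroArr C Y Z \<cdot> f = ZeroArr C (Dom C f) Z"
proof -
  have "Y \<in> Obj C" using assms by auto
  then have "ZeroArr C Y Z \<cdot> f \<boxplus> ZeroArr C Y Z \<cdot> f = ZeroArr C Y Z \<cdot> f"
    using assms add_comp[of f "ZeroArr C Y Z" "ZeroArr C Y Z"] by simp
  then show ?thesis using add_idem_zero \<open>Y \<in> Obj C\<close> assms by fastforce
qed

lemma comp_neg [simp]:
  assumes "f \<in> Arr C" "g \<in> Arr C" "Cod C f = Dom C g"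
  shows "g \<cdot> neg_arr C f = neg_arr C (g \<cdot> f)"
proof (rule neg_unique)
  have "(g \<cdot> f) \<boxplus> (g \<cdot> neg_arr C f) = g \<cdot> (f \<boxplus> neg_arr C f)" by (subst comp_add) (use assms in auto)
  then show "(g \<cdot> f) \<boxplus> (g \<cdot> neg_arr C f) = ZeroArr C (Dom C (g \<cdot> f)) (Cod C (g \<cdot> f))" using assms by simp
qed (use assms in auto)

lemma neg_comp [simp]:
  assumes "f \<in> Arr C" "g \<in> Arr C" "Cod C f = Dom C g"
  shows "neg_arr C g \<cdot> f = neg_arr C (g \<cdot> f)"
proof (rule neg_unique)
  have "(g \<cdot> f) \<boxplus> (neg_arr C g \<cdot> f) = (g \<boxplus> neg_arr C g) \<cdot> f" by (subst add_comp) (use assms in auto)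
  then show "(g \<cdot> f) \<boxplus> (neg_arr C g \<cdot> f) = ZeroArr C (Dom C (g \<cdot> f)) (Cod C (g \<cdot> f))" using assms by simp
qed (use assms in auto)

lemma neg_zero [simp]: "X \<in> Obj C \<Longrightarrow> Y \<in> Obj C \<Longrightarrow> neg_arr C (ZeroArr C X Y) = ZeroArr C X Y"
  by (rule neg_unique[symmetric]) auto

lemma from_zero_object:
  assumes "zero_object C Z" "f \<in> Arr C" "Dom C f = Z"
  shows "f = ZeroArr C Z (Cod C f)"
proof -
  have "f = f \<cdot> ZeroArr C Z Z" using assms comp_ident_right[of f Z] by (simp add: zero_object_def)
  then show ?thesis using assms by (auto simp: zero_object_def)
qed

section \<open>Isomorphisms, retracts and Karoubi-closures\<close>

lemma iso_arr_ident: "X \<in> Obj C \<Longrightarrow> iso_arr C (Ident C X) X X"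
  unfolding iso_arr_def by (auto intro!: exI[of _ "Ident C X"])

lemma iso_arr_neg_ident:
  assumes "X \<in> Obj C"
  shows "iso_arr C (neg_arr C (Ident C X)) X X"
  unfolding iso_arr_def using assms by (auto intro!: bexI[of _ "neg_arr C (Ident C X)"])

lemma retractI:
  assumes "i \<in> Hom C X Y" "p \<in> Hom C Y X" "p \<cdot> i = Ident C X"
  shows "retract C X Y"
proof -
  have "X \<in> Obj C" "Y \<in> Obj C" using assms(1) by auto
  then show ?thesis unfolding retract_def using assms by blast
qed

lemma retract_refl: "X \<in> Obj C \<Longrightarrow> retract C X X"
  by (rule retractI[of "Ident C X" _ _ "Ident C X"]) auto

lemma retract_trans:
  assumes "retract C X Y" "retract C Y Z"
  shows "retract C X Z"
proof -
  obtain i p j q where ip: "i \<in> Hom C X Y" "p \<in> Hom C Y X" "p \<cdot> i = Ident C X"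
    and jq: "j \<in> Hom C Y Z" "q \<in> Hom C Z Y" "q \<cdot> j = Ident C Y"
    using assms unfolding retract_def by blast
  have "(p \<cdot> q) \<cdot> (j \<cdot> i) = p \<cdot> ((q \<cdot> j) \<cdot> i)" using ip(1,2) jq(1,2) by simp
  also have "\<dots> = Ident C X" unfolding jq(3) using ip by simp
  finally show ?thesis by (intro retractI[of "j \<cdot> i" _ _ "p \<cdot> q"]) (use ip jq in auto)
qed

lemma karoubi_closure_incl: "S \<subseteq> Obj C \<Longrightarrow> S \<subseteq> karoubi_closure C S"
  unfolding karoubi_closure_def using retract_refl by blast

lemma karoubi_closure_obj: "karoubi_closure C S \<subseteq> Obj C"
  unfolding karoubi_closure_def retract_def by blast

lemma karoubi_closed_closure: "karoubi_closed C (karoubi_closure C S)"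
  unfolding karoubi_closed_def unfolding karoubi_closure_def using retract_trans by blast

lemma iso_arr_if_left_right_inverse:
  assumes "c \<in> Hom C X Y" "l \<in> Hom C Y X" "r \<in> Hom C Y X" "l \<cdot> c = Ident C X" "c \<cdot> r = Ident C Y"
  shows "iso_arr C c X Y"
proof -
  have "l = l \<cdot> (c \<cdot> r)" unfolding assms(5) using assms(2) by simp
  also have "\<dots> = (l \<cdot> c) \<cdot> r" using assms(1-3) by simp
  also have "\<dots> = r" unfolding assms(4) using assms(3) by simp
  finally show ?thesis unfolding iso_arr_def using assms by blast
qed

text \<open>Prepares the inverse in \<open>triangle_endo_iso\<close>: with \<open>i\<close> an
  identity and \<open>n\<close> the difference of \<open>e\<close> and \<open>i\<close>, it says
  that subtracting \<open>n\<close> from \<open>e\<close> gives the identity.\<close>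

lemma add_neg_diff:
  assumes "e \<in> Arr C" "i \<in> Arr C" "Dom C i = Dom C e" "Cod C i = Cod C e"
  shows "e \<boxplus> neg_arr C (e \<boxplus> neg_arr C i) = i"
proof (rule add_left_cancel[of "e \<boxplus> neg_arr C i"])
  let ?n = "e \<boxplus> neg_arr C i"
  have "?n \<boxplus> (e \<boxplus> neg_arr C ?n) = ?n \<boxplus> (neg_arr C ?n \<boxplus> e)"
    using assms by (subst add_comm[of e]) auto
  also have "\<dots> = ?n \<boxplus> neg_arr C ?n \<boxplus> e" using assms by (subst add_assoc) auto
  also have "\<dots> = e" using assms by simp
  also have "\<dots> = e \<boxplus> (neg_arr C i \<boxplus> i)" using assms by simp
  also have "\<dots> = ?n \<boxplus> i" using assms by (subst add_assoc) auto
  finally show "?n \<boxplus> (e \<boxplus> neg_arr C ?n) = ?n \<boxplus> i" .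
qed (use assms in auto)

section \<open>Full subcategories and biproducts\<close>

lemma Hom_full_sub:
  "X \<in> S \<Longrightarrow> Y \<in> S \<Longrightarrow> Hom (full_sub C S) X Y = Hom C X Y"
  by (auto simp: full_sub_def Hom_def)

lemma full_sub_simps [simp]:
  "Obj (full_sub C S) = S" "Dom (full_sub C S) = Dom C" "Cod (full_sub C S) = Cod C"
  "Ident (full_sub C S) = Ident C" "Comp (full_sub C S) = Comp C" "ZeroArr (full_sub C S) = ZeroArr C"
  "AddArr (full_sub C S) = AddArr C"
  "f \<in> Arr (full_sub C S) \<longleftrightarrow> f \<in> Arr C \<and> Dom C f \<in> S \<and> Cod C f \<in> S"
  by (auto simp: full_sub_def)

lemma hom_group_full_sub: "X \<in> S \<Longrightarrow> Y \<in> S \<Longrightarrow> hom_group (full_sub C S) X Y = hom_group C X Y"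
  by (simp add: hom_group_def Hom_full_sub)

lemma preadditive_full_sub:
  assumes "S \<subseteq> Obj C"
  shows "preadditive_category (full_sub C S)"
proof (rule preadditive_category.intro)
  fix X Y assume "X \<in> Obj (full_sub C S)" "Y \<in> Obj (full_sub C S)"
  then show "comm_group (hom_group (full_sub C S) X Y)"
    using hom_comm_group[of X Y] assms by (auto simp: hom_group_full_sub)
qed (use assms in auto)

lemma biproduct_full_sub:
  "X \<in> S \<Longrightarrow> Y \<in> S \<Longrightarrow> S \<subseteq> Obj C \<Longrightarrow> biproduct (full_sub C S) X Y Z \<longleftrightarrow> Z \<in> S \<and> biproduct C X Y Z"
  by (cases "Z \<in> S") (simp_all add: biproduct_def Hom_full_sub subset_iff del: in_Hom_iff)

lemma retract_biproduct:
  assumes "retract C X X0" "retract C Y Y0" "biproduct C X Y P" "biproduct C X0 Y0 P0"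
  shows "retract C P P0"
proof -
  obtain i p where i: "i \<in> Hom C X X0" "p \<in> Hom C X0 X" "p \<cdot> i = Ident C X"
    using assms(1) unfolding retract_def by blast
  obtain j q where j: "j \<in> Hom C Y Y0" "q \<in> Hom C Y0 Y" "q \<cdot> j = Ident C Y"
    using assms(2) unfolding retract_def by blast
  obtain a b c d where P: "a \<in> Hom C X P" "b \<in> Hom C Y P" "c \<in> Hom C P X" "d \<in> Hom C P Y"
    "(a \<cdot> c) \<boxplus> (b \<cdot> d) = Ident C P"
    using assms(3) unfolding biproduct_def by blast
  obtain a0 b0 c0 d0 where P0: "a0 \<in> Hom C X0 P0" "b0 \<in> Hom C Y0 P0" "c0 \<in> Hom C P0 X0" "d0 \<in> Hom C P0 Y0"
    "c0 \<cdot> a0 = Ident C X0" "d0 \<cdot> b0 = Ident C Y0" "c0 \<cdot> b0 = ZeroArr C Y0 X0" "d0 \<cdot> a0 = ZeroArr C X0 Y0"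
    using assms(4) unfolding biproduct_def by blast
  note arrs = i(1,2) j(1,2) P(1-4) P0(1-4)
  have obj: "X \<in> Obj C" "Y \<in> Obj C" "X0 \<in> Obj C" "Y0 \<in> Obj C" using arrs by auto
  \<comment> \<open>\<open>I\<close> is the direct sum of the sections \<open>i\<close> and
    \<open>j\<close>; the retraction used below is the direct sum of \<open>p\<close> and
    \<open>q\<close>. Composing \<open>I\<close> with the projections \<open>c0\<close> and
    \<open>d0\<close> isolates its two components.\<close>
  define I where "I = a0 \<cdot> (i \<cdot> c) \<boxplus> b0 \<cdot> (j \<cdot> d)"
  have I: "I \<in> Hom C P P0" using arrs by (auto simp: I_def)
  have "c0 \<cdot> I = (c0 \<cdot> a0) \<cdot> (i \<cdot> c) \<boxplus> (c0 \<cdot> b0) \<cdot> (j \<cdot> d)" using arrs by (auto simp: I_def)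
  then have cI: "c0 \<cdot> I = i \<cdot> c" unfolding P0(5,7) using arrs obj by auto
  have "d0 \<cdot> I = (d0 \<cdot> a0) \<cdot> (i \<cdot> c) \<boxplus> (d0 \<cdot> b0) \<cdot> (j \<cdot> d)" using arrs by (auto simp: I_def)
  then have dI: "d0 \<cdot> I = j \<cdot> d" unfolding P0(6,8) using arrs obj by auto
  have "(a \<cdot> (p \<cdot> c0) \<boxplus> b \<cdot> (q \<cdot> d0)) \<cdot> I = a \<cdot> (p \<cdot> (c0 \<cdot> I)) \<boxplus> b \<cdot> (q \<cdot> (d0 \<cdot> I))"
    using arrs I by auto
  also have "\<dots> = a \<cdot> ((p \<cdot> i) \<cdot> c) \<boxplus> b \<cdot> ((q \<cdot> j) \<cdot> d)" unfolding cI dI using arrs by auto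
  also have "\<dots> = Ident C P" unfolding i(3) j(3) using arrs P(5) by auto
  finally show ?thesis by (intro retractI[OF I, of "a \<cdot> (p \<cdot> c0) \<boxplus> b \<cdot> (q \<cdot> d0)"]) (use arrs in auto)
qed

end

section \<open>Triangulated categories\<close>

context triangulated_category
begin

lemma ShO_obj [simp]: "X \<in> Obj C \<Longrightarrow> ShO C X \<in> Obj C"
  using shift_bij_obj by (auto simp: bij_betw_def)

lemma ShO_inj: "ShO C X = ShO C Y \<Longrightarrow> X \<in> Obj C \<Longrightarrow> Y \<in> Obj C \<Longrightarrow> X = Y"
  using shift_bij_obj by (auto simp: bij_betw_def inj_on_def)

lemma unshift_obj:
  assumes "X \<in> Obj C"
  obtains X' where "X' \<in> Obj C" "ShO C X' = X"
proof -
  have "X \<in> ShO C ` Obj C" using assms shift_bij_obj unfolding bij_betw_def by simp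
  then show ?thesis using that by auto
qed

lemma shift_obj_1 [simp]: "shift_obj C 1 X = ShO C X"
  by (simp add: shift_obj_def)

lemma shift_obj_minus1 [simp]:
  assumes "X \<in> Obj C"
  shows "shift_obj C (- 1) X \<in> Obj C" "ShO C (shift_obj C (- 1) X) = X"
  using assms shift_bij_obj
  by (auto simp: shift_obj_def bij_betw_def inv_into_into f_inv_into_f)

lemma ShM_arr [simp]:
  assumes "f \<in> Arr C"
  shows "ShM C f \<in> Arr C" "Dom C (ShM C f) = ShO C (Dom C f)" "Cod C (ShM C f) = ShO C (Cod C f)"
proof -
  have "ShM C f \<in> Hom C (ShO C (Dom C f)) (ShO C (Cod C f))"
    using shift_bij_hom[of "Dom C f" "Cod C f"] assms unfolding bij_betw_def by fastforce
  then show "ShM C f \<in> Arr C" "Dom C (ShM C f) = ShO C (Dom C f)" "Cod C (ShM C f) = ShO C (Cod C f)"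
    by auto
qed

lemma ShM_inj:
  assumes "ShM C f = ShM C g" "f \<in> Arr C" "g \<in> Arr C" "Dom C f = Dom C g" "Cod C f = Cod C g"
  shows "f = g"
  using shift_bij_hom[of "Dom C f" "Cod C f"] assms unfolding bij_betw_def inj_on_def by simp

lemma unshift_arr:
  assumes "\<phi> \<in> Arr C" "Dom C \<phi> = ShO C X" "Cod C \<phi> = ShO C Y" "X \<in> Obj C" "Y \<in> Obj C"
  obtains f where "f \<in> Arr C" "Dom C f = X" "Cod C f = Y" "ShM C f = \<phi>"
proof -
  have "\<phi> \<in> ShM C ` Hom C X Y" using shift_bij_hom[of X Y] assms unfolding bij_betw_def by simp
  then show ?thesis using that by auto
qed

lemma ShM_comp [simp]: "f \<in> Arr C \<Longrightarrow> g \<in> Arr C \<Longrightarrow> Cod C f = Dom C g \<Longrightarrow> ShM C (g \<cdot> f) = ShM C g \<cdot> ShM C f"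
  using shift_comp[of f "Dom C f" "Cod C f" g "Cod C g"] by auto

lemma ShM_add: "f \<in> Arr C \<Longrightarrow> g \<in> Arr C \<Longrightarrow> Dom C g = Dom C f \<Longrightarrow> Cod C g = Cod C f
    \<Longrightarrow> ShM C (f \<boxplus> g) = ShM C f \<boxplus> ShM C g"
  using shift_add[of f "Dom C f" "Cod C f" g] by auto

lemma ShM_zero [simp]:
  assumes "X \<in> Obj C" "Y \<in> Obj C"
  shows "ShM C (ZeroArr C X Y) = ZeroArr C (ShO C X) (ShO C Y)"
proof -
  have "ShM C (ZeroArr C X Y) \<boxplus> ShM C (ZeroArr C X Y) = ShM C (ZeroArr C X Y)"
    using assms by (subst ShM_add[symmetric]) auto
  then show ?thesis using add_idem_zero[of "ShM C (ZeroArr C X Y)"] assms by simp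
qed

lemma ShM_neg [simp]:
  assumes "f \<in> Arr C"
  shows "ShM C (neg_arr C f) = neg_arr C (ShM C f)"
proof (rule neg_unique)
  show "ShM C f \<boxplus> ShM C (neg_arr C f) = ZeroArr C (Dom C (ShM C f)) (Cod C (ShM C f))"
    using assms by (subst ShM_add[symmetric]) auto
qed (use assms in auto)

lemma zero_object_unshift:
  assumes "zero_object C (ShO C Z)" "Z \<in> Obj C"
  shows "zero_object C Z"
proof -
  have "ShM C (Ident C Z) = ShM C (ZeroArr C Z Z)" using assms by (simp add: shift_ident zero_object_def)
  then have "Ident C Z = ZeroArr C Z Z" by (rule ShM_inj) (use assms in auto)
  then show ?thesis using assms by (simp add: zero_object_def)
qed

section \<open>Rotation, weak kernels and weak cokernels\<close>

lemma dtri_arr: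
  assumes "DTri C f g h"
  shows "f \<in> Arr C" "g \<in> Arr C" "h \<in> Arr C" "Dom C g = Cod C f" "Dom C h = Cod C g"
    "Cod C h = ShO C (Dom C f)"
  using dtri_triangle[OF assms] by (auto simp: is_triangle_def)

lemma rotate: "DTri C f g h \<Longrightarrow> DTri C g h (neg_arr C (ShM C f))"
  using TR2 dtri_triangle by blast

text \<open>Rotation puts a sign on the shifted first arrow, so the new first arrow
  \<open>f'\<close> is chosen as the unshift of \<open>neg_arr C h\<close> rather than of
  \<open>h\<close>.\<close>

lemma unrotate:
  assumes "DTri C f g h"
  obtains f' where "DTri C f' f g" "f' \<in> Arr C" "ShO C (Dom C f') = Cod C g" "Cod C f' = Dom C f"
    "h = neg_arr C (ShM C f')"
proof -
  note t = dtri_arr[OF assms]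
  obtain Z where Z: "Z \<in> Obj C" "ShO C Z = Cod C g" using unshift_obj[of "Cod C g"] t by auto
  obtain f' where f': "f' \<in> Arr C" "Dom C f' = Z" "Cod C f' = Dom C f" "ShM C f' = neg_arr C h"
    using unshift_arr[of "neg_arr C h" Z "Dom C f"] Z t by auto
  then have h: "h = neg_arr C (ShM C f')" using t by simp
  have "is_triangle C f' f g" using f' t Z by (simp add: is_triangle_def)
  then have "DTri C f' f g" using assms TR2 h by blast
  then show ?thesis using that f' Z h by blast
qed

text \<open>The trivial triangle on \<open>Dom C f\<close> maps to the given one by the identity and
  \<open>f\<close>. The third arrow supplied by TR3 starts at a zero object, and
  \<open>g \<cdot> f\<close> factors through it.\<close>

lemma dtri_comp_zero:
  assumes "DTri C f g h"
  shows "g \<cdot> f = ZeroArr C (Dom C f) (Cod C g)"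
proof -
  note t = dtri_arr[OF assms]
  obtain Z where Z: "zero_object C Z" using ex_zero_object by blast
  then have ZO: "Z \<in> Obj C" by (simp add: zero_object_def)
  have "DTri C (Ident C (Dom C f)) (ZeroArr C (Dom C f) Z) (ZeroArr C Z (ShO C (Dom C f)))"
    using TR1_ident Z t by simp
  from TR3[OF this assms, of "Ident C (Dom C f)" f] t ZO
  obtain c where c: "c \<in> Hom C Z (Cod C g)" "c \<cdot> ZeroArr C (Dom C f) Z = g \<cdot> f"
    by auto
  then show ?thesis using t ZO by simp
qed

text \<open>Unrotating a trivial triangle gives
  \<open>V \<rightarrow> W \<rightarrow> W \<rightarrow> Z\<close> with \<open>V\<close> and
  \<open>Z\<close> zero and the identity in the middle. TR3 maps the given triangle to it, with
  \<open>k\<close> as second component; the third component is the factorization.\<close>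

lemma weak_cokernel:
  assumes "DTri C f g h" "k \<in> Arr C" "Dom C k = Cod C f" "k \<cdot> f = ZeroArr C (Dom C f) (Cod C k)"
  obtains m where "m \<in> Arr C" "Dom C m = Cod C g" "Cod C m = Cod C k" "m \<cdot> g = k"
proof -
  note t = dtri_arr[OF assms(1)]
  define W where "W = Cod C k"
  have W: "W \<in> Obj C" using assms by (simp add: W_def)
  obtain Z where Z: "zero_object C Z" using ex_zero_object by blast
  then have ZO: "Z \<in> Obj C" by (simp add: zero_object_def)
  have "DTri C (Ident C W) (ZeroArr C W Z) (ZeroArr C Z (ShO C W))" using TR1_ident Z W by simp
  from unrotate[OF this] obtain f' where f': "DTri C f' (Ident C W) (ZeroArr C W Z)" "f' \<in> Arr C"
      "ShO C (Dom C f') = Cod C (ZeroArr C W Z)" "Cod C f' = Dom C (Ident C W)"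
    by blast
  define V where "V = Dom C f'"
  have V: "V \<in> Obj C" "Dom C f' = V" "Cod C f' = W" using f' W by (auto simp: V_def)
  have "zero_object C V" using f' Z ZO W by (intro zero_object_unshift[of V]) (auto simp: V_def)
  then have "f' = ZeroArr C V W" using from_zero_object f'(2) V by metis
  then have e: "k \<cdot> f = f' \<cdot> ZeroArr C (Dom C f) V"
    using assms t V W by (simp add: W_def)
  have kW: "Cod C k = W" by (simp add: W_def)
  have "\<exists>c \<in> Hom C (Dom C h) (Dom C (ZeroArr C W Z)). c \<cdot> g = Ident C W \<cdot> k \<and>
      ShM C (ZeroArr C (Dom C f) V) \<cdot> h = ZeroArr C W Z \<cdot> c"
    by (rule TR3[OF assms(1) f'(1) _ _ e]) (use V t W ZO assms(2,3) kW in auto)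
  then obtain c where c: "c \<in> Hom C (Dom C h) (Dom C (ZeroArr C W Z))" "c \<cdot> g = Ident C W \<cdot> k"
    by blast
  show ?thesis by (rule that[of c]) (use c t W ZO kW assms(2) in auto)
qed

text \<open>TR3 only produces third components, so both triangles are rotated until the wanted arrow
  stands there. It is found as an arrow \<open>c\<close> between shifts and then unshifted; the
  signs which rotation introduces on both sides cancel.\<close>

lemma weak_kernel:
  assumes "DTri C f g h" "k \<in> Arr C" "Cod C k = Cod C f" "g \<cdot> k = ZeroArr C (Dom C k) (Cod C g)"
  obtains m where "m \<in> Arr C" "Dom C m = Dom C k" "Cod C m = Dom C f" "f \<cdot> m = k"
proof -
  note t = dtri_arr[OF assms(1)]
  define W where "W = Dom C k"
  have W: "W \<in> Obj C" using assms by (simp add: W_def)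
  obtain Z where Z: "zero_object C Z" using ex_zero_object by blast
  then have ZO: "Z \<in> Obj C" by (simp add: zero_object_def)
  have 1: "DTri C (ZeroArr C W Z) (ZeroArr C Z (ShO C W)) (neg_arr C (ShM C (Ident C W)))"
    using rotate[OF TR1_ident] Z W by simp
  have 2: "DTri C g h (neg_arr C (ShM C f))" using rotate assms(1) .
  have e: "ZeroArr C Z (Cod C g) \<cdot> ZeroArr C W Z = g \<cdot> k" using assms t W ZO by (simp add: W_def)
  have "\<exists>c\<in>Hom C (Dom C (neg_arr C (ShM C (Ident C W)))) (Dom C (neg_arr C (ShM C f))).
      c \<cdot> ZeroArr C Z (ShO C W) = h \<cdot> ZeroArr C Z (Cod C g) \<and>
      ShM C k \<cdot> neg_arr C (ShM C (Ident C W)) = neg_arr C (ShM C f) \<cdot> c"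
    using TR3[OF 1 2, of k "ZeroArr C Z (Cod C g)"] e t W ZO assms(2,3) by (simp add: W_def)
  then obtain c where c: "c \<in> Arr C" "Dom C c = ShO C W" "Cod C c = ShO C (Dom C f)"
      "ShM C k \<cdot> neg_arr C (ShM C (Ident C W)) = neg_arr C (ShM C f) \<cdot> c"
    using t W by auto
  obtain m where m: "m \<in> Arr C" "Dom C m = W" "Cod C m = Dom C f" "ShM C m = c"
    using unshift_arr[OF c(1-3)] t W by auto
  have "neg_arr C (ShM C k) = neg_arr C (ShM C f \<cdot> c)"
    using c(4) t c(1-3) W assms(2) by (simp add: shift_ident W_def)
  then have "ShM C k = ShM C f \<cdot> c" using neg_neg t c(1-3) assms(2) by (metis ShM_arr(1,2) comp_arr(1))
  then have "ShM C (f \<cdot> m) = ShM C k" using m t by simp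
  then have "f \<cdot> m = k" by (rule ShM_inj) (use m t assms in \<open>auto simp: W_def\<close>)
  then show ?thesis using that m by (simp add: W_def)
qed

text \<open>
  The difference \<open>n\<close> of \<open>e\<close> and the identity factors both through \<open>g\<close> and through \<open>h\<close>, so
  \<open>e \<cdot> n = n = n \<cdot> e\<close>, and the inverse of \<open>e\<close> is the identity minus \<open>n\<close>.
\<close>

lemma triangle_endo_iso:
  assumes "DTri C f g h" "e \<in> Arr C" "Dom C e = Cod C g" "Cod C e = Cod C g" "e \<cdot> g = g" "h \<cdot> e = h"
  obtains e' where "e' \<in> Hom C (Cod C g) (Cod C g)" "e' \<cdot> e = Ident C (Cod C g)" "e \<cdot> e' = Ident C (Cod C g)"
proof -
  note t = dtri_arr[OF assms(1)]
  note r = rotate[OF assms(1)]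
  let ?i = "Ident C (Cod C g)"
  define n where "n = e \<boxplus> neg_arr C ?i"
  have n: "n \<in> Arr C" "Dom C n = Cod C g" "Cod C n = Cod C g" using assms t by (auto simp: n_def)
  have "n \<cdot> g = ZeroArr C (Dom C g) (Cod C g)" "h \<cdot> n = ZeroArr C (Cod C g) (Cod C h)"
    using assms t by (auto simp: n_def)
  then obtain k m where k: "k \<in> Arr C" "Dom C k = Cod C h" "Cod C k = Cod C g" "k \<cdot> h = n"
    and m: "m \<in> Arr C" "Dom C m = Cod C g" "Cod C m = Dom C g" "g \<cdot> m = n"
    using weak_cokernel[OF r, of n] weak_kernel[OF r, of n] n t by metis
  have ne: "n \<cdot> e = n" using k t assms(2,3,4,6) by (metis assoc)
  have en: "e \<cdot> n = n" using m t assms(2,3,4,5) by (metis assoc)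
  have *: "e \<boxplus> neg_arr C n = ?i" unfolding n_def by (rule add_neg_diff) (use assms t in auto)
  show ?thesis
    by (rule that[of "?i \<boxplus> neg_arr C n"]) (use n ne en * assms t in auto)
qed

text \<open>TR3 gives comparison arrows \<open>c\<close> and \<open>c'\<close> in both directions,
  which need not be mutually inverse. Their composites, however, are compatible with the adjacent
  arrows of the triangles and hence invertible by \<open>triangle_endo_iso\<close>, which yields a
  left and a right inverse of \<open>c\<close>.\<close>

lemma cone_unique:
  assumes "DTri C f g h" "DTri C f g' h'"
  obtains c where "iso_arr C c (Cod C g) (Cod C g')" "c \<cdot> g = g'" "h' \<cdot> c = h"
proof -
  note t = dtri_arr[OF assms(1)] dtri_arr[OF assms(2)]
  have ex: "\<exists>c. c \<in> Arr C \<and> Dom C c = Cod C g \<and> Cod C c = Cod C g' \<and> c \<cdot> g = g' \<and> h' \<cdot> c = h"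
    if a: "DTri C f g h" "DTri C f g' h'" for g h g' h'
  proof -
    note u = dtri_arr[OF a(1)] dtri_arr[OF a(2)]
    have "\<exists>c \<in> Hom C (Dom C h) (Dom C h'). c \<cdot> g = g' \<cdot> Ident C (Cod C f) \<and> ShM C (Ident C (Dom C f)) \<cdot> h = h' \<cdot> c"
      by (rule TR3[OF a]) (use u in auto)
    then obtain c where c: "c \<in> Hom C (Dom C h) (Dom C h')" "c \<cdot> g = g' \<cdot> Ident C (Cod C f)"
      "ShM C (Ident C (Dom C f)) \<cdot> h = h' \<cdot> c" by blast
    have "c \<cdot> g = g'" using c(2) u by simp
    moreover have "h' \<cdot> c = h" unfolding c(3)[symmetric] using u by (simp add: shift_ident)
    ultimately show ?thesis using c(1) u by (intro exI[of _ c]) simp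
  qed
  obtain c c' where c: "c \<in> Arr C" "Dom C c = Cod C g" "Cod C c = Cod C g'" "c \<cdot> g = g'" "h' \<cdot> c = h"
    and c': "c' \<in> Arr C" "Dom C c' = Cod C g'" "Cod C c' = Cod C g" "c' \<cdot> g' = g" "h \<cdot> c' = h'"
    using ex[OF assms] ex[OF assms(2,1)] by blast
  have c'c: "(c' \<cdot> c) \<cdot> g = g" "h \<cdot> (c' \<cdot> c) = h" using c c' t assoc by metis+
  have cc': "(c \<cdot> c') \<cdot> g' = g'" "h' \<cdot> (c \<cdot> c') = h'" using c c' t assoc by metis+
  obtain e where e: "e \<in> Hom C (Cod C g) (Cod C g)" "e \<cdot> (c' \<cdot> c) = Ident C (Cod C g)"
    using triangle_endo_iso[OF assms(1) _ _ _ c'c] c c' by auto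
  obtain d where d: "d \<in> Hom C (Cod C g') (Cod C g')" "(c \<cdot> c') \<cdot> d = Ident C (Cod C g')"
    using triangle_endo_iso[OF assms(2) _ _ _ cc'] c c' by auto
  have "iso_arr C c (Cod C g) (Cod C g')"
    by (rule iso_arr_if_left_right_inverse[of _ _ _ "e \<cdot> c'" "c' \<cdot> d"]) (use c c' e d in auto)
  then show ?thesis using that c by blast
qed

text \<open>Makes the choice of cone flexible, as is needed for a \<open>D\<close> that is not
  closed under isomorphism.\<close>

lemma dtri_replace_cone:
  assumes "DTri C f g h" "iso_arr C c (Cod C g) E"
  obtains h' where "DTri C f (c \<cdot> g) h'"
proof -
  note t = dtri_arr[OF assms(1)]
  obtain d where d: "d \<in> Hom C E (Cod C g)" "d \<cdot> c = Ident C (Cod C g)" "c \<cdot> d = Ident C E"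
    and c: "c \<in> Hom C (Cod C g) E" using assms(2) unfolding iso_arr_def by blast
  have hd: "(h \<cdot> d) \<cdot> c = h" using d c t by simp
  have "triangle_iso C f g h f (c \<cdot> g) (h \<cdot> d)"
    unfolding triangle_iso_def
  proof (intro conjI exI)
    show "iso_arr C (Ident C (Dom C f)) (Dom C f) (Dom C f)"
      "iso_arr C (Ident C (Cod C f)) (Dom C g) (Dom C (c \<cdot> g))"
      using iso_arr_ident t c by auto
    show "iso_arr C c (Dom C h) (Dom C (h \<cdot> d))" using assms(2) d c t by simp
    show "is_triangle C f g h" "is_triangle C f (c \<cdot> g) (h \<cdot> d)"
      using t d c by (auto simp: is_triangle_def)
    show "ShM C (Ident C (Dom C f)) \<cdot> h = h \<cdot> d \<cdot> c" unfolding hd using t by (simp add: shift_ident)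
  qed (use t c in auto)
  then show ?thesis using that assms(1) TR1_iso by blast
qed

lemma iso_has_zero_cone:
  assumes "iso_arr C f X Y" "zero_object C Z"
  shows "DTri C f (ZeroArr C Y Z) (ZeroArr C Z (ShO C X))"
proof -
  have f: "f \<in> Hom C X Y" using assms(1) unfolding iso_arr_def by blast
  have XY: "X \<in> Obj C" "Y \<in> Obj C" using f by auto
  have Z: "Z \<in> Obj C" using assms(2) by (simp add: zero_object_def)
  have "triangle_iso C (Ident C X) (ZeroArr C X Z) (ZeroArr C Z (ShO C X))
      f (ZeroArr C Y Z) (ZeroArr C Z (ShO C X))"
    unfolding triangle_iso_def
  proof (intro conjI exI)
    show "iso_arr C (Ident C X) (Dom C (Ident C X)) (Dom C f)" using iso_arr_ident XY f by auto
    show "iso_arr C f (Dom C (ZeroArr C X Z)) (Dom C (ZeroArr C Y Z))" using assms XY Z by auto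
    show "iso_arr C (Ident C Z) (Dom C (ZeroArr C Z (ShO C X))) (Dom C (ZeroArr C Z (ShO C X)))"
      using iso_arr_ident XY Z by simp
  qed (use f XY Z in \<open>auto simp: is_triangle_def shift_ident\<close>)
  then show ?thesis using TR1_iso TR1_ident[OF XY(1) assms(2)] by blast
qed

text \<open>Three rotations amount to one shift, with a sign on every arrow. Weight decompositions
  and cones of denominators are moved along the shift by this rule.\<close>

lemma rotate3:
  assumes "DTri C f g h"
  shows "DTri C (neg_arr C (ShM C f)) (neg_arr C (ShM C g)) (neg_arr C (ShM C h))"
  using assms rotate by blast

lemma unrotate3:
  assumes "DTri C f g h"
  obtains f' g' h' where "DTri C f' g' h'" "f = neg_arr C (ShM C f')" "g = neg_arr C (ShM C g')"
    "h = neg_arr C (ShM C h')"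
  using assms unrotate by metis

lemma fibre:
  assumes "g \<in> Arr C"
  obtains f h where "DTri C f g h"
  using TR1_cone[OF assms] unrotate by metis

end

section \<open>Arrows with a cone in the subcategory\<close>

locale verdier_localization = triangulated_category C for C :: "('o, 'm, 'x) tri_cat_scheme" (structure) +
  fixes D :: "'o set"
  assumes sub: "triangulated_subcategory C D"
begin

abbreviation "den \<equiv> cone_in C D"

lemma D_obj: "X \<in> D \<Longrightarrow> X \<in> Obj C"
  using sub unfolding triangulated_subcategory_def by blast

lemma D_shift: "X \<in> D \<Longrightarrow> ShO C X \<in> D"
  using sub unfolding triangulated_subcategory_def by auto

lemma D_unshift:
  assumes "ShO C X \<in> D" "X \<in> Obj C"
  shows "X \<in> D"
proof -
  have "shift_obj C (- 1) (ShO C X) \<in> D" using sub assms unfolding triangulated_subcategory_def by blast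
  moreover have "shift_obj C (- 1) (ShO C X) = X"
    by (rule ShO_inj) (use shift_obj_minus1[of "ShO C X"] assms in auto)
  ultimately show ?thesis by simp
qed

lemma D_cone:
  assumes "f \<in> Arr C" "Dom C f \<in> D" "Cod C f \<in> D"
  obtains g h where "DTri C f g h" "Cod C g \<in> D"
proof -
  have "\<forall>X \<in> D. \<forall>Y \<in> D. \<forall>f \<in> Hom C X Y. \<exists>g h. DTri C f g h \<and> Cod C g \<in> D"
    using sub unfolding triangulated_subcategory_def by blast
  moreover have "f \<in> Hom C (Dom C f) (Cod C f)" using assms by simp
  ultimately show ?thesis using that assms by blast
qed

text \<open>The octahedral axiom yields the cone of interest only after a shift and up to
  isomorphism. Both have to be undone together: the isomorphism is unshifted along with its
  target.\<close>

lemma D_iso_unshift: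
  assumes "iso_arr C c (ShO C X) E" "E \<in> D" "X \<in> Obj C"
  obtains c' E' where "iso_arr C c' X E'" "E' \<in> D"
proof -
  obtain d where c: "c \<in> Hom C (ShO C X) E" and d: "d \<in> Hom C E (ShO C X)"
    "d \<cdot> c = Ident C (ShO C X)" "c \<cdot> d = Ident C E" using assms(1) unfolding iso_arr_def by blast
  obtain E' where E': "E' \<in> Obj C" "ShO C E' = E" using unshift_obj[of E] D_obj assms(2) by blast
  obtain c' where c': "c' \<in> Arr C" "Dom C c' = X" "Cod C c' = E'" "ShM C c' = c"
    using unshift_arr[of c X E'] c E' assms(3) by auto
  obtain d' where d': "d' \<in> Arr C" "Dom C d' = E'" "Cod C d' = X" "ShM C d' = d"
    using unshift_arr[of d E' X] d E' assms(3) by auto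
  have "d' \<cdot> c' = Ident C X"
    by (rule ShM_inj) (use c' d' d assms(3) in \<open>auto simp: shift_ident\<close>)
  moreover have "c' \<cdot> d' = Ident C E'"
    by (rule ShM_inj) (use c' d' d E' in \<open>auto simp: shift_ident\<close>)
  ultimately have "iso_arr C c' X E'" unfolding iso_arr_def using c' d'
    by (intro conjI bexI[of _ d']) auto
  then show ?thesis using that D_unshift E' assms(2) by blast
qed

text \<open>The cone of the identity of any object of \<open>D\<close> may be taken in
  \<open>D\<close>, and by uniqueness of cones it is isomorphic to a zero object \<open>Z\<close>.
  The isomorphism \<open>c\<close> starts at \<open>Z\<close> and so is zero, which forces the
  identity of its target to be zero.\<close>

lemma zero_in_D:
  obtains Z where "zero_object C Z" "Z \<in> D"
proof -
  obtain X where X: "X \<in> D" using sub unfolding triangulated_subcategory_def by blast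
  then have XO: "X \<in> Obj C" by (rule D_obj)
  obtain g h where gh: "DTri C (Ident C X) g h" "Cod C g \<in> D" using D_cone[of "Ident C X"] X XO by auto
  obtain Z where Z: "zero_object C Z" using ex_zero_object by blast
  obtain c where c: "iso_arr C c Z (Cod C g)"
    using cone_unique[OF TR1_ident[OF XO Z] gh(1)] Z XO by (auto simp: zero_object_def)
  then obtain d where d: "c \<in> Hom C Z (Cod C g)" "d \<in> Hom C (Cod C g) Z" "c \<cdot> d = Ident C (Cod C g)"
    unfolding iso_arr_def by blast
  define E where "E = Cod C g"
  have E: "E \<in> D" "E \<in> Obj C" using gh D_obj by (auto simp: E_def)
  have "c = ZeroArr C Z E" using from_zero_object[OF Z, of c] d by (simp add: E_def)
  then have "Ident C E = ZeroArr C E E" using d E by (auto simp flip: E_def)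
  then show ?thesis using that E by (simp add: zero_object_def)
qed

lemma den_arr [simp]: "den s \<Longrightarrow> s \<in> Arr C"
  unfolding cone_in_def using dtri_arr by blast

lemma den_if_cone_iso: "DTri C s g h \<Longrightarrow> iso_arr C c (Cod C g) E \<Longrightarrow> E \<in> D \<Longrightarrow> den s"
proof -
  assume a: "DTri C s g h" "iso_arr C c (Cod C g) E" "E \<in> D"
  obtain h' where "DTri C s (c \<cdot> g) h'" using dtri_replace_cone a by blast
  moreover have "Cod C (c \<cdot> g) = E" using a(2) dtri_arr[OF a(1)] by (auto simp: iso_arr_def)
  ultimately show ?thesis unfolding cone_in_def using a(3) by blast
qed

lemma den_if_shifted_cone_iso:
  assumes "DTri C s g h" "iso_arr C c (ShO C (Cod C g)) E" "E \<in> D"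
  shows "den s"
  using D_iso_unshift[OF assms(2,3)] den_if_cone_iso[OF assms(1)] dtri_arr[OF assms(1)] cod_obj by metis

lemma den_iso:
  assumes "iso_arr C f X Y"
  shows "den f"
proof -
  obtain Z where Z: "zero_object C Z" "Z \<in> D" by (rule zero_in_D)
  have "Y \<in> Obj C" using assms by (auto simp: iso_arr_def)
  then show ?thesis unfolding cone_in_def using iso_has_zero_cone[OF assms Z(1)] Z D_obj
    by (intro exI conjI) auto
qed

lemma den_ident [simp]: "X \<in> Obj C \<Longrightarrow> den (Ident C X)"
  using den_iso iso_arr_ident by blast

text \<open>By the octahedral axiom the cones of \<open>s\<close>, \<open>t \<cdot> s\<close> and
  \<open>t\<close> form a triangle. Its connecting arrow \<open>ShM C a \<cdot> d\<close> has both
  ends in \<open>D\<close>, hence a cone in \<open>D\<close>, and two rotations identify that cone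
  with the shifted cone of \<open>t \<cdot> s\<close>.\<close>

lemma den_comp [simp]:
  assumes "den s" "den t" "Cod C s = Dom C t"
  shows "den (t \<cdot> s)"
proof -
  obtain a b c d where ab: "DTri C s a b" "Cod C a \<in> D" and cd: "DTri C t c d" "Cod C c \<in> D"
    using assms unfolding cone_in_def by blast
  obtain e k where ek: "DTri C (t \<cdot> s) e k" using TR1_cone[of "t \<cdot> s"] assms by auto
  note arrs = dtri_arr[OF ab(1)] dtri_arr[OF cd(1)] dtri_arr[OF ek]
  have "s \<in> Hom C (Dom C s) (Cod C s)" "t \<in> Hom C (Cod C s) (Cod C t)" using assms by auto
  from TR4[OF this ab(1) cd(1) ek]
  obtain u v where uv: "DTri C u v (ShM C a \<cdot> d)" "u \<in> Hom C (Cod C a) (Cod C e)" by blast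
  obtain x y where xy: "DTri C (ShM C a \<cdot> d) x y" "Cod C x \<in> D"
    using D_cone[of "ShM C a \<cdot> d"] arrs assms(3) ab(2) cd(2) D_shift by auto
  obtain c where "iso_arr C c (Cod C (neg_arr C (ShM C u))) (Cod C x)"
    using cone_unique[OF rotate[OF rotate[OF uv(1)]] xy(1)] by blast
  then show ?thesis using den_if_shifted_cone_iso[OF ek _ xy(2)] uv(2) by simp
qed

text \<open>Same octahedron as for composites, read at another vertex: \<open>v\<close> runs between
  the cones of \<open>t \<cdot> s\<close> and \<open>t\<close>, both in \<open>D\<close>, and the
  cone of \<open>v\<close> is the shifted cone of \<open>s\<close>.\<close>

lemma den_cancel:
  assumes "den t" "den (t \<cdot> s)" "s \<in> Arr C" "Cod C s = Dom C t"
  shows "den s"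
proof -
  obtain c d e k where ek: "DTri C (t \<cdot> s) e k" "Cod C e \<in> D" and cd: "DTri C t c d" "Cod C c \<in> D"
    using assms unfolding cone_in_def by blast
  obtain a b where ab: "DTri C s a b" using TR1_cone assms(3) by blast
  note arrs = dtri_arr[OF ab(1)] dtri_arr[OF cd(1)] dtri_arr[OF ek(1)]
  have "s \<in> Hom C (Dom C s) (Cod C s)" "t \<in> Hom C (Cod C s) (Cod C t)" using assms by auto
  from TR4[OF this ab(1) cd(1) ek(1)]
  obtain u v where uv: "DTri C u v (ShM C a \<cdot> d)" "v \<in> Hom C (Cod C e) (Cod C c)" by blast
  obtain x y where xy: "DTri C v x y" "Cod C x \<in> D"
    using D_cone[of v] uv(2) ek(2) cd(2) by auto
  obtain c where "iso_arr C c (Cod C (ShM C a \<cdot> d)) (Cod C x)"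
    using cone_unique[OF rotate[OF uv(1)] xy(1)] by blast
  then show ?thesis using den_if_shifted_cone_iso[OF ab _ xy(2)] arrs assms(4) by simp
qed

text \<open>Take \<open>u\<close> as a fibre of \<open>c \<cdot> f\<close>, where \<open>c\<close>
  goes from the target of \<open>t\<close> to its cone. Then the cone of \<open>u\<close> is that of
  \<open>t\<close>, and \<open>f \<cdot> u\<close> is killed by \<open>c\<close>, so it lifts along
  \<open>t\<close>.\<close>

lemma ore:
  assumes "den t" "f \<in> Arr C" "Cod C f = Cod C t"
  obtains u v where "den u" "v \<in> Arr C" "Cod C u = Dom C f" "Cod C v = Dom C t" "Dom C v = Dom C u"
    "f \<cdot> u = t \<cdot> v"
proof -
  obtain c d where cd: "DTri C t c d" "Cod C c \<in> D" using assms unfolding cone_in_def by blast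
  note arrs = dtri_arr[OF cd(1)]
  obtain u h where u: "DTri C u (c \<cdot> f) h" using fibre[of "c \<cdot> f"] arrs assms by auto
  note arrs' = dtri_arr[OF u]
  have den: "den u" unfolding cone_in_def using u cd arrs assms by force
  have Codu: "Cod C u = Dom C f" using arrs' arrs assms by simp
  have "c \<cdot> (f \<cdot> u) = ZeroArr C (Dom C u) (Cod C c)"
    using dtri_comp_zero[OF u] arrs arrs' assms Codu by simp
  then obtain v where "v \<in> Arr C" "Dom C v = Dom C u" "Cod C v = Dom C t" "t \<cdot> v = f \<cdot> u"
    using weak_kernel[OF cd(1), of "f \<cdot> u"] arrs' Codu assms by auto
  then show ?thesis using that den Codu by metis
qed

text \<open>The difference \<open>k\<close> of \<open>f\<close> and \<open>g\<close> is killed by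
  \<open>t\<close>, so it factors as \<open>a \<cdot> m\<close> through the unshifted cone of
  \<open>t\<close>, an object of \<open>D\<close>. A fibre \<open>w\<close> of \<open>m\<close> has
  this object as cone and kills \<open>k\<close>.\<close>

lemma den_equalizer:
  assumes "den t" "f \<in> Arr C" "g \<in> Arr C" "Dom C g = Dom C f" "Cod C f = Dom C t" "Cod C g = Dom C t"
    "t \<cdot> f = t \<cdot> g"
  obtains w where "den w" "Cod C w = Dom C f" "f \<cdot> w = g \<cdot> w"
proof -
  obtain c d where cd: "DTri C t c d" "Cod C c \<in> D" using assms unfolding cone_in_def by blast
  note arrs = dtri_arr[OF cd(1)]
  obtain a where a: "DTri C a t c" "a \<in> Arr C" "ShO C (Dom C a) = Cod C c" "Cod C a = Dom C t"
    using unrotate[OF cd(1)] by blast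
  define k where "k = f \<boxplus> neg_arr C g"
  have k: "k \<in> Arr C" "Dom C k = Dom C f" "Cod C k = Dom C t" using assms by (auto simp: k_def)
  have "t \<cdot> k = ZeroArr C (Dom C k) (Cod C t)" using assms arrs by (simp add: k_def)
  then obtain m where m: "m \<in> Arr C" "Dom C m = Dom C k" "Cod C m = Dom C a" "a \<cdot> m = k"
    using weak_kernel[OF a(1), of k] a k by metis
  obtain w h where w: "DTri C w m h" using fibre m(1) by blast
  note arrs' = dtri_arr[OF w]
  have "Dom C a \<in> D" using D_unshift[of "Dom C a"] a cd by simp
  then have den: "den w" unfolding cone_in_def using w m by force
  have "k \<cdot> w = a \<cdot> (m \<cdot> w)" unfolding m(4)[symmetric] by (rule assoc) (use a m arrs' in auto)
  also have "\<dots> = ZeroArr C (Dom C w) (Dom C t)"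
    unfolding dtri_comp_zero[OF w] using a m arrs' by simp
  finally have *: "k \<cdot> w = ZeroArr C (Dom C w) (Dom C t)" .
  have Codw: "Cod C w = Dom C f" using arrs' m(2) k(2) by simp
  have "f \<cdot> w \<boxplus> neg_arr C (g \<cdot> w) = ZeroArr C (Dom C (f \<cdot> w)) (Cod C (f \<cdot> w))"
    using * assms(2-6) arrs'(1) Codw by (simp add: k_def)
  then have "f \<cdot> w = g \<cdot> w"
    by (rule eq_of_diff_zero) (use assms(2-6) arrs'(1) Codw in auto)
  then show ?thesis using that den arrs' m k by metis
qed

lemma den_neg: "den s \<Longrightarrow> den (neg_arr C s)"
  using den_comp[of s "neg_arr C (Ident C (Cod C s))"]
    den_iso[OF iso_arr_neg_ident[of "Cod C s"]] by simp

text \<open>A triangle on \<open>s\<close> becomes one on \<open>ShM C s\<close> by three rotations,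
  and conversely; the sign this leaves on the arrow is absorbed by \<open>den_neg\<close>.\<close>

lemma den_shift [simp]:
  assumes "s \<in> Arr C"
  shows "den (ShM C s) \<longleftrightarrow> den s"
proof
  assume "den s"
  then obtain g h where gh: "DTri C s g h" "Cod C g \<in> D" unfolding cone_in_def by blast
  have "Cod C (neg_arr C (ShM C g)) \<in> D" using dtri_arr[OF gh(1)] gh(2) D_shift by simp
  then have "den (neg_arr C (ShM C s))" unfolding cone_in_def using rotate3[OF gh(1)] by blast
  then show "den (ShM C s)" using den_neg assms neg_neg ShM_arr by metis
next
  assume "den (ShM C s)"
  then have "den (neg_arr C (ShM C s))" by (rule den_neg)
  then obtain g h where gh: "DTri C (neg_arr C (ShM C s)) g h" "Cod C g \<in> D" unfolding cone_in_def by blast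
  obtain f' g' h' where t: "DTri C f' g' h'" "neg_arr C (ShM C s) = neg_arr C (ShM C f')" "g = neg_arr C (ShM C g')"
    using unrotate3[OF gh(1)] by metis
  note arrs = dtri_arr[OF t(1)]
  have e: "ShM C s = ShM C f'" using neg_neg t(2) arrs assms ShM_arr by metis
  have "ShO C (Dom C s) = ShO C (Dom C f')" "ShO C (Cod C s) = ShO C (Cod C f')"
    using e ShM_arr arrs(1) assms by metis+
  then have "s = f'" by (intro ShM_inj[OF e]) (use assms arrs ShO_inj in auto)
  moreover have "Cod C g' \<in> D" by (rule D_unshift) (use gh(2) t(3) arrs in auto)
  ultimately show "den s" unfolding cone_in_def using t(1) by blast
qed

end

section \<open>The Verdier quotient is preadditive\<close>

context verdier_localization
begin

abbreviation "Q \<equiv> verdier_quotient C D"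

section \<open>Equivalence of roofs and equality of fractions\<close>

lemma roof_iff [simp]: "roof C D s f \<longleftrightarrow> den s \<and> f \<in> Arr C \<and> Dom C f = Dom C s"
  by (auto simp: roof_def)

lemma roof_equivI:
  assumes "roof C D s f" "roof C D s' f'" "Cod C s' = Cod C s" "Cod C f' = Cod C f"
    "t \<in> Arr C" "t' \<in> Arr C" "Cod C t = Dom C s" "Cod C t' = Dom C s'" "Dom C t' = Dom C t"
    "den t \<or> den t'" "s \<cdot> t = s' \<cdot> t'" "f \<cdot> t = f' \<cdot> t'"
  shows "roof_equiv C D s f s' f'"
proof -
  have "den (s \<cdot> t)" using assms(1,2,5-11) by (metis den_comp roof_iff)
  moreover have "t \<in> Hom C (Dom C t) (Dom C s)" "t' \<in> Hom C (Dom C t) (Dom C s')" using assms by auto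
  ultimately show ?thesis unfolding roof_equiv_def using assms(1-4,11,12) by metis
qed

text \<open>The definition only asks that the composite \<open>s \<cdot> t\<close> have a cone in
  \<open>D\<close>; cancelling \<open>s\<close> and \<open>s'\<close> shows that both legs
  \<open>t\<close> and \<open>t'\<close> are denominators themselves.\<close>

lemma roof_equivE:
  assumes "roof_equiv C D s f s' f'"
  obtains t t' where "den t" "den t'" "Cod C t = Dom C s" "Cod C t' = Dom C s'" "Dom C t' = Dom C t"
    "s \<cdot> t = s' \<cdot> t'" "f \<cdot> t = f' \<cdot> t'"
proof -
  have r: "den s" "den s'" using assms unfolding roof_equiv_def by auto
  obtain W t t' where h: "t \<in> Hom C W (Dom C s)" "t' \<in> Hom C W (Dom C s')"
    and t: "s \<cdot> t = s' \<cdot> t'" "f \<cdot> t = f' \<cdot> t'" "den (s \<cdot> t)"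
    using assms unfolding roof_equiv_def by blast
  have "den (s' \<cdot> t')" using t by simp
  then have "den t" "den t'" using den_cancel[of s t] den_cancel[of s' t'] t(3) h r by simp_all
  then show ?thesis using that[of t t'] h t(1,2) by simp
qed

lemma roof_equivD:
  assumes "roof_equiv C D s f s' f'"
  shows "roof C D s f" "roof C D s' f'" "Cod C s = Cod C s'" "Cod C f = Cod C f'"
  using assms unfolding roof_equiv_def by auto

lemma roof_equiv_refl: "roof C D s f \<Longrightarrow> roof_equiv C D s f s f"
  by (rule roof_equivI[of _ _ _ _ "Ident C (Dom C s)" "Ident C (Dom C s)"]) auto

lemma roof_equiv_sym: "roof_equiv C D s f s' f' \<Longrightarrow> roof_equiv C D s' f' s f"
proof -
  assume a: "roof_equiv C D s f s' f'"
  then obtain t t' where t: "den t" "den t'" "Cod C t = Dom C s" "Cod C t' = Dom C s'" "Dom C t' = Dom C t"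
    "s \<cdot> t = s' \<cdot> t'" "f \<cdot> t = f' \<cdot> t'" by (rule roof_equivE)
  show ?thesis
    by (rule roof_equivI[OF _ _ _ _ _ _ _ _ _ _ t(6,7)[symmetric]]) (use t(1-5) roof_equivD[OF a] in auto)
qed

lemma common_denominator:
  assumes "den s" "den s'" "Cod C s' = Cod C s"
  obtains t t' where "den t" "den t'" "Cod C t = Dom C s" "Cod C t' = Dom C s'" "Dom C t' = Dom C t"
    "s \<cdot> t = s' \<cdot> t'"
proof -
  obtain t t' where t: "den t" "t' \<in> Arr C" "Cod C t = Dom C s" "Cod C t' = Dom C s'" "Dom C t' = Dom C t"
    "s \<cdot> t = s' \<cdot> t'" using ore[of s' s] assms by auto
  have "den t'" by (rule den_cancel[of s']) (use t assms in \<open>auto simp flip: t(6)\<close>)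
  then show ?thesis using that t by blast
qed

lemma roof_equiv_trans:
  assumes "roof_equiv C D s f s' f'" "roof_equiv C D s' f' s'' f''"
  shows "roof_equiv C D s f s'' f''"
proof -
  note r = roof_equivD[OF assms(1)] roof_equivD[OF assms(2)]
  obtain t t' where t: "den t" "den t'" "Cod C t = Dom C s" "Cod C t' = Dom C s'" "Dom C t' = Dom C t"
    "s \<cdot> t = s' \<cdot> t'" "f \<cdot> t = f' \<cdot> t'" using assms(1) by (rule roof_equivE)
  obtain q q' where q: "den q" "den q'" "Cod C q = Dom C s'" "Cod C q' = Dom C s''" "Dom C q' = Dom C q"
    "s' \<cdot> q = s'' \<cdot> q'" "f' \<cdot> q = f'' \<cdot> q'" using assms(2) by (rule roof_equivE)
  \<comment> \<open>The two given equivalences meet over the domain of \<open>s'\<close>; a common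
    denominator of \<open>t'\<close> and \<open>q\<close> makes them comparable there.\<close>
  obtain u v where u: "den u" "den v" "Cod C u = Dom C t'" "Cod C v = Dom C q" "Dom C v = Dom C u"
    "t' \<cdot> u = q \<cdot> v" using common_denominator[of t' q] t q by auto
  note arrs = r t(1-5) q(1-5) u(1-5)
  have "s \<cdot> (t \<cdot> u) = s' \<cdot> (t' \<cdot> u)" by (rule comp_cong[OF t(6)]) (use arrs in auto)
  also have "\<dots> = s'' \<cdot> (q' \<cdot> v)" unfolding u(6) by (rule comp_cong[OF q(6)]) (use arrs in auto)
  finally have 1: "s \<cdot> (t \<cdot> u) = s'' \<cdot> (q' \<cdot> v)" .
  have "f \<cdot> (t \<cdot> u) = f' \<cdot> (t' \<cdot> u)" by (rule comp_cong[OF t(7)]) (use arrs in auto)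
  also have "\<dots> = f'' \<cdot> (q' \<cdot> v)" unfolding u(6) by (rule comp_cong[OF q(7)]) (use arrs in auto)
  finally have 2: "f \<cdot> (t \<cdot> u) = f'' \<cdot> (q' \<cdot> v)" .
  show ?thesis by (rule roof_equivI[OF _ _ _ _ _ _ _ _ _ _ 1 2]) (use arrs in auto)
qed

lemma frac_eq_iff:
  assumes "roof C D s f"
  shows "frac C D s f = frac C D s' f' \<longleftrightarrow> roof_equiv C D s f s' f'"
proof
  assume "frac C D s f = frac C D s' f'"
  then have "{(a, b). roof_equiv C D s f a b} = {(a, b). roof_equiv C D s' f' a b}"
    by (simp add: frac_def)
  moreover have "roof_equiv C D s f s f" using assms by (rule roof_equiv_refl)
  ultimately have "roof_equiv C D s' f' s f" by blast
  then show "roof_equiv C D s f s' f'" by (rule roof_equiv_sym)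
next
  assume a: "roof_equiv C D s f s' f'"
  then have "roof_equiv C D s f a b \<longleftrightarrow> roof_equiv C D s' f' a b" for a b
    using roof_equiv_trans roof_equiv_sym by blast
  then show "frac C D s f = frac C D s' f'" using roof_equivD[OF a] by (simp add: frac_def)
qed

lemma frac_expand:
  assumes "roof C D s f" "den a" "Cod C a = Dom C s"
  shows "frac C D (s \<cdot> a) (f \<cdot> a) = frac C D s f"
proof (subst frac_eq_iff)
  show "roof_equiv C D (s \<cdot> a) (f \<cdot> a) s f"
    by (rule roof_equivI[of _ _ _ _ "Ident C (Dom C a)" a]) (use assms in auto)
qed (use assms in auto)

lemma frac_eqE:
  assumes "frac C D s f = frac C D s' f'" "roof C D s f"
  obtains t t' where "den t" "den t'" "Cod C t = Dom C s" "Cod C t' = Dom C s'" "Dom C t' = Dom C t"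
    "s \<cdot> t = s' \<cdot> t'" "f \<cdot> t = f' \<cdot> t'"
proof -
  have "roof_equiv C D s f s' f'" using assms frac_eq_iff by blast
  then show ?thesis by (rule roof_equivE) (rule that)
qed

text \<open>An equivalence may expand the same denominator along two different arrows
  \<open>t\<close> and \<open>t'\<close>. They agree after \<open>s\<close>, so
  \<open>den_equalizer\<close> makes them agree outright after one more denominator.\<close>

lemma frac_eq_same_denE:
  assumes "frac C D s f = frac C D s g" "roof C D s f" "roof C D s g"
  obtains w where "den w" "Cod C w = Dom C s" "f \<cdot> w = g \<cdot> w"
proof -
  obtain t t' where t: "den t" "den t'" "Cod C t = Dom C s" "Cod C t' = Dom C s" "Dom C t' = Dom C t"
    "s \<cdot> t = s \<cdot> t'" "f \<cdot> t = g \<cdot> t'" using assms(1,2) by (rule frac_eqE)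
  obtain w where w: "den w" "Cod C w = Dom C t" "t \<cdot> w = t' \<cdot> w"
    using den_equalizer[of s t t'] t assms by auto
  have "f \<cdot> (t \<cdot> w) = g \<cdot> (t' \<cdot> w)" by (rule comp_cong[OF t(7)]) (use t(1-5) w(1,2) assms(2,3) in auto)
  then show ?thesis using that[of "t \<cdot> w"] t(1-5) w by simp
qed

lemma frac_cod:
  assumes "frac C D s f = frac C D s' f'"
  shows "Cod C s = Cod C s'" "Cod C f = Cod C f'"
  using assms by (auto simp: frac_def)

lemma Q_fields:
  "Obj Q = Obj C" "Arr Q = {frac C D s f | s f. roof C D s f}"
  "Dom Q (frac C D s f) = Cod C s" "Cod Q (frac C D s f) = Cod C f"
  "Ident Q X = frac C D (Ident C X) (Ident C X)"
  "ZeroArr Q X Y = frac C D (Ident C X) (ZeroArr C X Y)"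
  "ShO Q = ShO C"
  by (auto simp: verdier_quotient_def verdier_shift_cat_def shift_cat.extend_def tri_cat.fields_def frac_def)

lemma frac_arr [simp]: "roof C D s f \<Longrightarrow> frac C D s f \<in> Arr Q"
  unfolding Q_fields by blast

lemma Q_arrE:
  assumes "\<phi> \<in> Arr Q"
  obtains s f where "\<phi> = frac C D s f" "roof C D s f" "Cod C s = Dom Q \<phi>" "Cod C f = Cod Q \<phi>"
  using assms Q_fields(2,3,4) by force

section \<open>Composition and addition of fractions are well defined\<close>

text \<open>The square required in the quotient's composition, isolated so that independence of the
  square can be proved before independence of the representing roofs.\<close>

definition ore_square :: "'m \<Rightarrow> 'm \<Rightarrow> 'm \<Rightarrow> 'm \<Rightarrow> bool" where
  "ore_square f t u v \<longleftrightarrow> den u \<and> v \<in> Arr C \<and> Cod C u = Dom C f \<and> Cod C v = Dom C t \<and>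
     Dom C v = Dom C u \<and> f \<cdot> u = t \<cdot> v"

lemma ex_ore_square:
  assumes "den t" "f \<in> Arr C" "Cod C f = Cod C t"
  obtains u v where "ore_square f t u v"
  using ore[OF assms] unfolding ore_square_def by metis

lemma ore_square_indep:
  assumes "roof C D s f" "roof C D t g" "Cod C f = Cod C t" "ore_square f t u v" "ore_square f t u' v'"
  shows "frac C D (s \<cdot> u) (g \<cdot> v) = frac C D (s \<cdot> u') (g \<cdot> v')"
proof -
  note u = assms(4,5)[unfolded ore_square_def]
  obtain a a' where a: "den a" "den a'" "Cod C a = Dom C u" "Cod C a' = Dom C u'" "Dom C a' = Dom C a"
    "u \<cdot> a = u' \<cdot> a'" using common_denominator[of u u'] u by auto
  note arrs = assms(1-3) a(1-5)
  have fu: "f \<cdot> u = t \<cdot> v" "f \<cdot> u' = t \<cdot> v'" using u by auto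
  have "t \<cdot> (v \<cdot> a) = f \<cdot> (u \<cdot> a)" by (rule comp_cong[OF fu(1)[symmetric]]) (use arrs u in auto)
  also have "\<dots> = t \<cdot> (v' \<cdot> a')" unfolding a(6) by (rule comp_cong[OF fu(2)]) (use arrs u in auto)
  finally have "t \<cdot> (v \<cdot> a) = t \<cdot> (v' \<cdot> a')" .
  \<comment> \<open>Over the common denominator of \<open>u\<close> and \<open>u'\<close> the other
    legs are only known to agree after \<open>t\<close>. Removing \<open>t\<close> costs a further
    denominator \<open>w\<close>.\<close>
  then obtain w where w: "den w" "Cod C w = Dom C a" "(v \<cdot> a) \<cdot> w = (v' \<cdot> a') \<cdot> w"
    using den_equalizer[of t "v \<cdot> a" "v' \<cdot> a'"] arrs u by auto
  have w': "v \<cdot> (a \<cdot> w) = v' \<cdot> (a' \<cdot> w)" using w u arrs by simp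
  have uw: "u \<cdot> (a \<cdot> w) = u' \<cdot> (a' \<cdot> w)" by (rule comp_cong[OF a(6)]) (use arrs u w in auto)
  have "frac C D (s \<cdot> u) (g \<cdot> v) = frac C D ((s \<cdot> u) \<cdot> (a \<cdot> w)) ((g \<cdot> v) \<cdot> (a \<cdot> w))"
    by (rule frac_expand[symmetric]) (use arrs u w(1,2) in auto)
  also have "\<dots> = frac C D (s \<cdot> (u \<cdot> (a \<cdot> w))) (g \<cdot> (v \<cdot> (a \<cdot> w)))"
    using arrs u w(1,2) by simp
  also have "\<dots> = frac C D (s \<cdot> (u' \<cdot> (a' \<cdot> w))) (g \<cdot> (v' \<cdot> (a' \<cdot> w)))"
    unfolding uw w' ..
  also have "\<dots> = frac C D ((s \<cdot> u') \<cdot> (a' \<cdot> w)) ((g \<cdot> v') \<cdot> (a' \<cdot> w))"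
    using arrs u w(1,2) by simp
  also have "\<dots> = frac C D (s \<cdot> u') (g \<cdot> v')"
    by (rule frac_expand) (use arrs u w(1,2) in auto)
  finally show ?thesis .
qed

lemma ore_square_frac_cong:
  assumes "roof C D s f" "roof C D t g" "Cod C f = Cod C t" "ore_square f t u v"
    and "roof C D s' f'" "roof C D t' g'" "Cod C f' = Cod C t'" "ore_square f' t' u' v'"
    and eq: "frac C D s f = frac C D s' f'" "frac C D t g = frac C D t' g'"
  shows "frac C D (s \<cdot> u) (g \<cdot> v) = frac C D (s' \<cdot> u') (g' \<cdot> v')"
proof -
  obtain a a' where a: "den a" "den a'" "Cod C a = Dom C s" "Cod C a' = Dom C s'" "Dom C a' = Dom C a"
    "s \<cdot> a = s' \<cdot> a'" "f \<cdot> a = f' \<cdot> a'" using eq(1) assms(1) by (rule frac_eqE)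
  obtain b b' where b: "den b" "den b'" "Cod C b = Dom C t" "Cod C b' = Dom C t'" "Dom C b' = Dom C b"
    "t \<cdot> b = t' \<cdot> b'" "g \<cdot> b = g' \<cdot> b'" using eq(2) assms(2) by (rule frac_eqE)
  note arrs = assms(1-3,5-7) a(1-5) b(1-5)
  \<comment> \<open>A single square over the expanded roofs: composed with \<open>a\<close>,
    \<open>b\<close> it is a square for the first pair of roofs, with \<open>a'\<close>,
    \<open>b'\<close> one for the second. \<open>ore_square_indep\<close> then finishes on each
    side.\<close>
  obtain p q where p: "den p" "q \<in> Arr C" "Cod C p = Dom C (f \<cdot> a)" "Cod C q = Dom C (t \<cdot> b)"
    "Dom C q = Dom C p" "(f \<cdot> a) \<cdot> p = (t \<cdot> b) \<cdot> q"
    using ore[of "t \<cdot> b" "f \<cdot> a"] arrs by auto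
  have pq: "Cod C p = Dom C a" "Cod C q = Dom C b" using p arrs by auto
  have fa: "f \<cdot> (a \<cdot> p) = t \<cdot> (b \<cdot> q)" using p(6) pq p(1,2,5) arrs by simp
  have "f' \<cdot> (a' \<cdot> p) = f \<cdot> (a \<cdot> p)" by (rule comp_cong[OF a(7)[symmetric]]) (use arrs pq p(1,2,5) in auto)
  also have "\<dots> = t' \<cdot> (b' \<cdot> q)" unfolding fa by (rule comp_cong[OF b(6)]) (use arrs pq p(1,2,5) in auto)
  finally have fa': "f' \<cdot> (a' \<cdot> p) = t' \<cdot> (b' \<cdot> q)" .
  have sap: "s \<cdot> (a \<cdot> p) = s' \<cdot> (a' \<cdot> p)" by (rule comp_cong[OF a(6)]) (use arrs pq p(1,2,5) in auto)
  have gbq: "g \<cdot> (b \<cdot> q) = g' \<cdot> (b' \<cdot> q)" by (rule comp_cong[OF b(7)]) (use arrs pq p(1,2,5) in auto)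
  have sq: "ore_square f t (a \<cdot> p) (b \<cdot> q)" "ore_square f' t' (a' \<cdot> p) (b' \<cdot> q)"
    unfolding ore_square_def using arrs pq p(1,2,5) fa fa' by auto
  show ?thesis
    unfolding ore_square_indep[OF assms(1-4) sq(1)] ore_square_indep[OF assms(5-8) sq(2)] sap gbq ..
qed

lemma comp_frac:
  assumes "roof C D s f" "roof C D t g" "Cod C f = Cod C t" "ore_square f t u v"
  shows "frac C D t g \<cdot>\<^bsub>Q\<^esub> frac C D s f = frac C D (s \<cdot> u) (g \<cdot> v)"
proof -
  have "frac C D t g \<cdot>\<^bsub>Q\<^esub> frac C D s f = (THE \<chi>. \<exists>s' f' t' g' W u v.
       roof C D s' f' \<and> roof C D t' g' \<and> frac C D s f = frac C D s' f' \<and> frac C D t g = frac C D t' g' \<and>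
       u \<in> Hom C W (Dom C f') \<and> v \<in> Hom C W (Dom C t') \<and> cone_in C D u \<and>
       Cod C f' = Cod C t' \<and> f' \<cdot> u = t' \<cdot> v \<and>
       \<chi> = frac C D (s' \<cdot> u) (g' \<cdot> v))"
    by (simp add: verdier_quotient_def verdier_shift_cat_def shift_cat.extend_def tri_cat.fields_def)
  also have "\<dots> = frac C D (s \<cdot> u) (g \<cdot> v)"
  proof (rule the_equality, goal_cases)
    case 1
    note u = assms(4)[unfolded ore_square_def]
    show ?case
      by (rule exI[of _ s], rule exI[of _ f], rule exI[of _ t], rule exI[of _ g],
        rule exI[of _ "Dom C u"], rule exI[of _ u], rule exI[of _ v])
        (use assms(1-3) u in simp)
  next
    case (2 \<chi>)
    then obtain s' f' t' g' W u' v' where h: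
       "roof C D s' f'" "roof C D t' g'" "frac C D s f = frac C D s' f'" "frac C D t g = frac C D t' g'"
       "u' \<in> Hom C W (Dom C f')" "v' \<in> Hom C W (Dom C t')" "cone_in C D u'"
       "Cod C f' = Cod C t'" "f' \<cdot> u' = t' \<cdot> v'" "\<chi> = frac C D (s' \<cdot> u') (g' \<cdot> v')" by blast
    have sq: "ore_square f' t' u' v'" unfolding ore_square_def using h(5-9) by auto
    show ?case
      unfolding h(10) by (rule ore_square_frac_cong[OF assms h(1,2,8) sq h(3,4), symmetric])
  qed
  finally show ?thesis .
qed

lemma add_frac:
  assumes "roof C D s f" "roof C D s g" "Cod C f = Cod C g"
  shows "frac C D s f \<boxplus>\<^bsub>Q\<^esub> frac C D s g = frac C D s (f \<boxplus> g)"
proof -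
  have "frac C D s f \<boxplus>\<^bsub>Q\<^esub> frac C D s g = (THE \<chi>. \<exists>s' f' g'.
       roof C D s' f' \<and> roof C D s' g' \<and> Cod C f' = Cod C g' \<and>
       frac C D s f = frac C D s' f' \<and> frac C D s g = frac C D s' g' \<and> \<chi> = frac C D s' (f' \<boxplus> g'))"
    by (simp add: verdier_quotient_def verdier_shift_cat_def shift_cat.extend_def tri_cat.fields_def)
  also have "\<dots> = frac C D s (f \<boxplus> g)"
  proof (rule the_equality, goal_cases)
    case 1
    show ?case using assms by blast
  next
    case (2 \<chi>)
    then obtain s' f' g' where h: "roof C D s' f'" "roof C D s' g'" "Cod C f' = Cod C g'"
       "frac C D s f = frac C D s' f'" "frac C D s g = frac C D s' g'" "\<chi> = frac C D s' (f' \<boxplus> g')" by blast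
    obtain a a' where a: "den a" "den a'" "Cod C a = Dom C s" "Cod C a' = Dom C s'" "Dom C a' = Dom C a"
      "s \<cdot> a = s' \<cdot> a'" "f \<cdot> a = f' \<cdot> a'" using h(4) assms(1) by (rule frac_eqE)
    note arrs = assms h(1-3) a(1-5) frac_cod[OF h(4)] frac_cod[OF h(5)]
    \<comment> \<open>The expansion by \<open>a\<close> and \<open>a'\<close> was chosen to match
      the numerators of the first summand. Those of the second now lie over the same denominator and
      agree only after expanding by \<open>w\<close>, which does not disturb the first
      match.\<close>
    have "frac C D (s \<cdot> a) (g \<cdot> a) = frac C D s g" using arrs by (intro frac_expand) auto
    also have "\<dots> = frac C D (s \<cdot> a) (g' \<cdot> a')"
      unfolding h(5) a(6) using arrs by (intro frac_expand[symmetric]) auto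
    finally obtain w where w: "den w" "Cod C w = Dom C a" "(g \<cdot> a) \<cdot> w = (g' \<cdot> a') \<cdot> w"
      using frac_eq_same_denE[of "s \<cdot> a" "g \<cdot> a" "g' \<cdot> a'"] arrs by auto
    have gw: "g \<cdot> (a \<cdot> w) = g' \<cdot> (a' \<cdot> w)" using w arrs by simp
    have fw: "f \<cdot> (a \<cdot> w) = f' \<cdot> (a' \<cdot> w)" by (rule comp_cong[OF a(7)]) (use arrs w(1,2) in auto)
    have sw: "s \<cdot> (a \<cdot> w) = s' \<cdot> (a' \<cdot> w)" by (rule comp_cong[OF a(6)]) (use arrs w(1,2) in auto)
    have "frac C D s (f \<boxplus> g) = frac C D (s \<cdot> (a \<cdot> w)) ((f \<boxplus> g) \<cdot> (a \<cdot> w))"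
      using arrs w(1,2) by (intro frac_expand[symmetric]) auto
    also have "\<dots> = frac C D (s \<cdot> (a \<cdot> w)) (f \<cdot> (a \<cdot> w) \<boxplus> g \<cdot> (a \<cdot> w))" using arrs w(1,2) by simp
    also have "\<dots> = frac C D (s' \<cdot> (a' \<cdot> w)) (f' \<cdot> (a' \<cdot> w) \<boxplus> g' \<cdot> (a' \<cdot> w))" unfolding sw fw gw ..
    also have "\<dots> = frac C D (s' \<cdot> (a' \<cdot> w)) ((f' \<boxplus> g') \<cdot> (a' \<cdot> w))" using arrs w(1,2) by simp
    also have "\<dots> = frac C D s' (f' \<boxplus> g')" using arrs w(1,2) by (intro frac_expand) auto
    finally show ?case using h(6) by simp
  qed
  finally show ?thesis .
qed

section \<open>The axioms of a preadditive category for fractions\<close>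

lemma Q_hom_fracE:
  assumes "\<phi> \<in> Hom Q X Y"
  obtains s f where "\<phi> = frac C D s f" "roof C D s f" "Cod C s = X" "Cod C f = Y"
  using assms Q_arrE[of \<phi>] by auto

lemma frac_hom: "roof C D s f \<Longrightarrow> frac C D s f \<in> Hom Q (Cod C s) (Cod C f)"
  by (auto simp: Q_fields(3,4))

lemma common_denominator2:
  assumes "\<phi> \<in> Hom Q X Y" "\<psi> \<in> Hom Q X Z"
  obtains s f g where "roof C D s f" "roof C D s g" "Cod C s = X" "Cod C f = Y" "Cod C g = Z"
    "\<phi> = frac C D s f" "\<psi> = frac C D s g"
proof -
  obtain s f where f: "\<phi> = frac C D s f" "roof C D s f" "Cod C s = X" "Cod C f = Y"
    using assms(1) by (rule Q_hom_fracE)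
  obtain t g where g: "\<psi> = frac C D t g" "roof C D t g" "Cod C t = X" "Cod C g = Z"
    using assms(2) by (rule Q_hom_fracE)
  obtain u v where u: "den u" "den v" "Cod C u = Dom C s" "Cod C v = Dom C t" "Dom C v = Dom C u"
    "s \<cdot> u = t \<cdot> v" using common_denominator[of s t] f(2,3) g(2,3) by auto
  have "\<phi> = frac C D (s \<cdot> u) (f \<cdot> u)" unfolding f(1) using f(2) u(1,3) by (intro frac_expand[symmetric]) auto
  moreover have "\<psi> = frac C D (s \<cdot> u) (g \<cdot> v)"
    unfolding g(1) u(6) using g(2) u(2,4) by (intro frac_expand[symmetric]) auto
  ultimately show ?thesis using that[of "s \<cdot> u" "f \<cdot> u" "g \<cdot> v"] f(2-4) g(2-4) u(1-5) by simp
qed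

lemma common_denominator3:
  assumes "\<phi> \<in> Hom Q X Y" "\<psi> \<in> Hom Q X Z" "\<chi> \<in> Hom Q X W"
  obtains s f g h where "roof C D s f" "roof C D s g" "roof C D s h"
    "Cod C s = X" "Cod C f = Y" "Cod C g = Z" "Cod C h = W"
    "\<phi> = frac C D s f" "\<psi> = frac C D s g" "\<chi> = frac C D s h"
proof -
  obtain s f g where f: "roof C D s f" "roof C D s g" "Cod C s = X" "Cod C f = Y" "Cod C g = Z"
    "\<phi> = frac C D s f" "\<psi> = frac C D s g"
    using assms(1,2) by (rule common_denominator2)
  obtain t h where h: "\<chi> = frac C D t h" "roof C D t h" "Cod C t = X" "Cod C h = W"
    using assms(3) by (rule Q_hom_fracE)
  obtain u v where u: "den u" "den v" "Cod C u = Dom C s" "Cod C v = Dom C t" "Dom C v = Dom C u"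
    "s \<cdot> u = t \<cdot> v" using common_denominator[of s t] f(1,3) h(2,3) by auto
  have "\<phi> = frac C D (s \<cdot> u) (f \<cdot> u)" "\<psi> = frac C D (s \<cdot> u) (g \<cdot> u)"
    unfolding f(6,7) using f(1,2) u(1,3) by (auto intro!: frac_expand[symmetric])
  moreover have "\<chi> = frac C D (s \<cdot> u) (h \<cdot> v)"
    unfolding h(1) u(6) using h(2) u(2,4) by (intro frac_expand[symmetric]) auto
  ultimately show ?thesis
    using that[of "s \<cdot> u" "f \<cdot> u" "g \<cdot> u" "h \<cdot> v"] f(1-5) h(2-4) u(1-5) by simp
qed

text \<open>The zero arrow is defined over the identity; sums need it over the denominator of the
  other summand.\<close>

lemma zero_frac:
  assumes "den s" "Y \<in> Obj C"
  shows "ZeroArr Q (Cod C s) Y = frac C D s (ZeroArr C (Dom C s) Y)"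
proof -
  have "frac C D (Ident C (Cod C s) \<cdot> s) (ZeroArr C (Cod C s) Y \<cdot> s)
      = frac C D (Ident C (Cod C s)) (ZeroArr C (Cod C s) Y)"
    using assms by (intro frac_expand) auto
  then show ?thesis using assms by (simp add: Q_fields)
qed

lemma comp_frac_typed:
  assumes "roof C D s f" "roof C D t g" "Cod C f = Cod C t" "den u" "v \<in> Arr C" "Cod C u = Dom C s"
    "Cod C v = Dom C t" "Dom C v = Dom C u" "f \<cdot> u = t \<cdot> v"
  shows "frac C D t g \<cdot>\<^bsub>Q\<^esub> frac C D s f = frac C D (s \<cdot> u) (g \<cdot> v)"
  using assms by (intro comp_frac) (auto simp: ore_square_def)

lemma Q_ident_right:
  assumes "roof C D s f" "Cod C s = X"
  shows "frac C D s f \<cdot>\<^bsub>Q\<^esub> Ident Q X = frac C D s f"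
proof -
  have X: "X \<in> Obj C" using assms by auto
  have "frac C D s f \<cdot>\<^bsub>Q\<^esub> frac C D (Ident C X) (Ident C X)
      = frac C D (Ident C X \<cdot> s) (f \<cdot> Ident C (Dom C s))"
    by (rule comp_frac_typed) (use assms X in auto)
  then show ?thesis using assms by (simp add: Q_fields)
qed

lemma Q_ident_left:
  assumes "roof C D s f" "Cod C f = Y"
  shows "Ident Q Y \<cdot>\<^bsub>Q\<^esub> frac C D s f = frac C D s f"
proof -
  have Y: "Y \<in> Obj C" using assms by auto
  have "frac C D (Ident C Y) (Ident C Y) \<cdot>\<^bsub>Q\<^esub> frac C D s f
      = frac C D (s \<cdot> Ident C (Dom C s)) (Ident C Y \<cdot> f)"
    by (rule comp_frac_typed) (use assms Y in auto)
  then show ?thesis using assms by (simp add: Q_fields)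
qed

lemma Q_comp_hom:
  assumes "\<phi> \<in> Hom Q X Y" "\<psi> \<in> Hom Q Y Z"
  shows "\<psi> \<cdot>\<^bsub>Q\<^esub> \<phi> \<in> Hom Q X Z"
proof -
  obtain s f where f: "\<phi> = frac C D s f" "roof C D s f" "Cod C s = X" "Cod C f = Y"
    using assms(1) by (rule Q_hom_fracE)
  obtain t g where g: "\<psi> = frac C D t g" "roof C D t g" "Cod C t = Y" "Cod C g = Z"
    using assms(2) by (rule Q_hom_fracE)
  obtain u v where sq: "ore_square f t u v" using ex_ore_square[of t f] f g by auto
  have "\<psi> \<cdot>\<^bsub>Q\<^esub> \<phi> = frac C D (s \<cdot> u) (g \<cdot> v)"
    unfolding f(1) g(1) by (rule comp_frac) (use f g sq in auto)
  then show ?thesis using frac_hom[of "s \<cdot> u" "g \<cdot> v"] f(2-4) g(2-4) sq by (simp add: ore_square_def)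
qed

lemma Q_assoc:
  assumes "\<phi> \<in> Hom Q X Y" "\<psi> \<in> Hom Q Y Z" "\<chi> \<in> Hom Q Z W"
  shows "\<chi> \<cdot>\<^bsub>Q\<^esub> (\<psi> \<cdot>\<^bsub>Q\<^esub> \<phi>) = (\<chi> \<cdot>\<^bsub>Q\<^esub> \<psi>) \<cdot>\<^bsub>Q\<^esub> \<phi>"
proof -
  obtain s f where f: "\<phi> = frac C D s f" "roof C D s f" "Cod C s = X" "Cod C f = Y"
    using assms(1) by (rule Q_hom_fracE)
  obtain t g where g: "\<psi> = frac C D t g" "roof C D t g" "Cod C t = Y" "Cod C g = Z"
    using assms(2) by (rule Q_hom_fracE)
  obtain r h where h: "\<chi> = frac C D r h" "roof C D r h" "Cod C r = Z" "Cod C h = W"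
    using assms(3) by (rule Q_hom_fracE)
  obtain u v where u: "den u" "v \<in> Arr C" "Cod C u = Dom C g" "Cod C v = Dom C r" "Dom C v = Dom C u"
    "g \<cdot> u = r \<cdot> v" using ore[of r g] g h by auto
  have tu: "den (t \<cdot> u)" "Cod C f = Cod C (t \<cdot> u)" "f \<in> Arr C" using f(2,4) g(2-4) u(1-3) by auto
  \<comment> \<open>The second square is formed against \<open>t \<cdot> u\<close>, the denominator
    of the composite of the last two fractions. It thereby serves both bracketings, which end in the
    same roof.\<close>
  obtain p q where p: "den p" "q \<in> Arr C" "Cod C p = Dom C f" "Cod C q = Dom C (t \<cdot> u)" "Dom C q = Dom C p"
    "f \<cdot> p = (t \<cdot> u) \<cdot> q" using ore[OF tu(1,3,2)] by metis
  note arrs = f(2-4) g(2-4) h(2-4) u(1-5) p(1-5)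
  have q: "Cod C q = Dom C u" using arrs by simp
  have fp: "f \<cdot> p = t \<cdot> (u \<cdot> q)" unfolding p(6) using arrs q by simp
  have "g \<cdot> (u \<cdot> q) = r \<cdot> (v \<cdot> q)" by (rule comp_cong[OF u(6)]) (use arrs q in auto)
  then have guq: "(g \<cdot> (u \<cdot> q)) \<cdot> Ident C (Dom C p) = r \<cdot> (v \<cdot> q)" using arrs q by simp
  have "\<psi> \<cdot>\<^bsub>Q\<^esub> \<phi> = frac C D (s \<cdot> p) (g \<cdot> (u \<cdot> q))"
    unfolding f(1) g(1) by (rule comp_frac_typed[OF _ _ _ _ _ _ _ _ fp]) (use arrs q in auto)
  moreover have "\<chi> \<cdot>\<^bsub>Q\<^esub> frac C D (s \<cdot> p) (g \<cdot> (u \<cdot> q))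
      = frac C D ((s \<cdot> p) \<cdot> Ident C (Dom C p)) (h \<cdot> (v \<cdot> q))"
    unfolding h(1) by (rule comp_frac_typed[OF _ _ _ _ _ _ _ _ guq]) (use arrs q in auto)
  moreover have "\<chi> \<cdot>\<^bsub>Q\<^esub> \<psi> = frac C D (t \<cdot> u) (h \<cdot> v)"
    unfolding g(1) h(1) by (rule comp_frac_typed[OF _ _ _ _ _ _ _ _ u(6)]) (use arrs in auto)
  moreover have "frac C D (t \<cdot> u) (h \<cdot> v) \<cdot>\<^bsub>Q\<^esub> \<phi> = frac C D (s \<cdot> p) ((h \<cdot> v) \<cdot> q)"
    unfolding f(1) by (rule comp_frac_typed[OF _ _ _ _ _ _ _ _ p(6)]) (use arrs q in auto)
  ultimately show ?thesis using arrs q by simp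
qed

lemma Q_comp_add:
  assumes "\<phi> \<in> Hom Q X Y" "\<phi>' \<in> Hom Q X Y" "\<psi> \<in> Hom Q Y Z"
  shows "\<psi> \<cdot>\<^bsub>Q\<^esub> (\<phi> \<boxplus>\<^bsub>Q\<^esub> \<phi>') = (\<psi> \<cdot>\<^bsub>Q\<^esub> \<phi>) \<boxplus>\<^bsub>Q\<^esub> (\<psi> \<cdot>\<^bsub>Q\<^esub> \<phi>')"
proof -
  obtain s f f' where f: "roof C D s f" "roof C D s f'" "Cod C s = X" "Cod C f = Y" "Cod C f' = Y"
    "\<phi> = frac C D s f" "\<phi>' = frac C D s f'" using assms(1,2) by (rule common_denominator2)
  obtain t g where g: "\<psi> = frac C D t g" "roof C D t g" "Cod C t = Y" "Cod C g = Z"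
    using assms(3) by (rule Q_hom_fracE)
  obtain u v where u: "den u" "v \<in> Arr C" "Cod C u = Dom C f" "Cod C v = Dom C t" "Dom C v = Dom C u"
    "f \<cdot> u = t \<cdot> v" using ore[of t f] f g by auto
  obtain u' v' where u': "den u'" "v' \<in> Arr C" "Cod C u' = Dom C f'" "Cod C v' = Dom C t" "Dom C v' = Dom C u'"
    "f' \<cdot> u' = t \<cdot> v'" using ore[of t f'] f g by auto
  \<comment> \<open>The squares for \<open>f\<close> and \<open>f'\<close> are brought to a common
    left leg \<open>u \<cdot> a\<close>, so that adding their right legs gives a square for the
    sum.\<close>
  obtain a a' where a: "den a" "den a'" "Cod C a = Dom C u" "Cod C a' = Dom C u'" "Dom C a' = Dom C a"
    "u \<cdot> a = u' \<cdot> a'" using common_denominator[of u u'] u(1-5) u'(1-5) f(1,2) by auto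
  note arrs = f(1-5) g(2-4) u(1-5) u'(1-5) a(1-5)
  have 1: "f \<cdot> (u \<cdot> a) = t \<cdot> (v \<cdot> a)" by (rule comp_cong[OF u(6)]) (use arrs in auto)
  have 2: "f' \<cdot> (u \<cdot> a) = t \<cdot> (v' \<cdot> a')" unfolding a(6) by (rule comp_cong[OF u'(6)]) (use arrs in auto)
  have 3: "(f \<boxplus> f') \<cdot> (u \<cdot> a) = t \<cdot> (v \<cdot> a \<boxplus> v' \<cdot> a')"
    using arrs 1 2 by (subst add_comp) auto
  have "\<psi> \<cdot>\<^bsub>Q\<^esub> \<phi> = frac C D (s \<cdot> (u \<cdot> a)) (g \<cdot> (v \<cdot> a))"
    unfolding f(6) g(1) by (rule comp_frac_typed[OF _ _ _ _ _ _ _ _ 1]) (use arrs in auto)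
  moreover have "\<psi> \<cdot>\<^bsub>Q\<^esub> \<phi>' = frac C D (s \<cdot> (u \<cdot> a)) (g \<cdot> (v' \<cdot> a'))"
    unfolding f(7) g(1) by (rule comp_frac_typed[OF _ _ _ _ _ _ _ _ 2]) (use arrs in auto)
  moreover have "\<phi> \<boxplus>\<^bsub>Q\<^esub> \<phi>' = frac C D s (f \<boxplus> f')"
    unfolding f(6,7) by (rule add_frac) (use arrs in auto)
  moreover have "\<psi> \<cdot>\<^bsub>Q\<^esub> frac C D s (f \<boxplus> f') = frac C D (s \<cdot> (u \<cdot> a)) (g \<cdot> (v \<cdot> a \<boxplus> v' \<cdot> a'))"
    unfolding g(1) by (rule comp_frac_typed[OF _ _ _ _ _ _ _ _ 3]) (use arrs in auto)
  moreover have "frac C D (s \<cdot> (u \<cdot> a)) (g \<cdot> (v \<cdot> a)) \<boxplus>\<^bsub>Q\<^esub> frac C D (s \<cdot> (u \<cdot> a)) (g \<cdot> (v' \<cdot> a'))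
      = frac C D (s \<cdot> (u \<cdot> a)) (g \<cdot> (v \<cdot> a) \<boxplus> g \<cdot> (v' \<cdot> a'))"
    by (rule add_frac) (use arrs in auto)
  ultimately show ?thesis using arrs by simp
qed

lemma Q_add_comp:
  assumes "\<phi> \<in> Hom Q X Y" "\<psi> \<in> Hom Q Y Z" "\<psi>' \<in> Hom Q Y Z"
  shows "(\<psi> \<boxplus>\<^bsub>Q\<^esub> \<psi>') \<cdot>\<^bsub>Q\<^esub> \<phi> = (\<psi> \<cdot>\<^bsub>Q\<^esub> \<phi>) \<boxplus>\<^bsub>Q\<^esub> (\<psi>' \<cdot>\<^bsub>Q\<^esub> \<phi>)"
proof -
  obtain s f where f: "\<phi> = frac C D s f" "roof C D s f" "Cod C s = X" "Cod C f = Y"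
    using assms(1) by (rule Q_hom_fracE)
  obtain t g g' where g: "roof C D t g" "roof C D t g'" "Cod C t = Y" "Cod C g = Z" "Cod C g' = Z"
    "\<psi> = frac C D t g" "\<psi>' = frac C D t g'" using assms(2,3) by (rule common_denominator2)
  obtain u v where u: "den u" "v \<in> Arr C" "Cod C u = Dom C f" "Cod C v = Dom C t" "Dom C v = Dom C u"
    "f \<cdot> u = t \<cdot> v" using ore[of t f] f g by auto
  note arrs = f(2-4) g(1-5) u(1-5)
  have "\<psi> \<cdot>\<^bsub>Q\<^esub> \<phi> = frac C D (s \<cdot> u) (g \<cdot> v)"
    unfolding f(1) g(6) by (rule comp_frac_typed[OF _ _ _ _ _ _ _ _ u(6)]) (use arrs in auto)
  moreover have "\<psi>' \<cdot>\<^bsub>Q\<^esub> \<phi> = frac C D (s \<cdot> u) (g' \<cdot> v)"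
    unfolding f(1) g(7) by (rule comp_frac_typed[OF _ _ _ _ _ _ _ _ u(6)]) (use arrs in auto)
  moreover have "\<psi> \<boxplus>\<^bsub>Q\<^esub> \<psi>' = frac C D t (g \<boxplus> g')"
    unfolding g(6,7) by (rule add_frac) (use arrs in auto)
  moreover have "frac C D t (g \<boxplus> g') \<cdot>\<^bsub>Q\<^esub> \<phi> = frac C D (s \<cdot> u) ((g \<boxplus> g') \<cdot> v)"
    unfolding f(1) by (rule comp_frac_typed[OF _ _ _ _ _ _ _ _ u(6)]) (use arrs in auto)
  moreover have "frac C D (s \<cdot> u) (g \<cdot> v) \<boxplus>\<^bsub>Q\<^esub> frac C D (s \<cdot> u) (g' \<cdot> v)
      = frac C D (s \<cdot> u) (g \<cdot> v \<boxplus> g' \<cdot> v)"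
    by (rule add_frac) (use arrs in auto)
  ultimately show ?thesis using arrs by simp
qed

lemma Q_hom_comm_group:
  assumes "X \<in> Obj C" "Y \<in> Obj C"
  shows "comm_group (hom_group Q X Y)"
proof (rule comm_groupI, unfold hom_group_def, simp_all only: monoid.simps partial_object.simps)
  fix \<phi> \<psi> assume a: "\<phi> \<in> Hom Q X Y" "\<psi> \<in> Hom Q X Y"
  then obtain s f g where f: "roof C D s f" "roof C D s g" "Cod C s = X" "Cod C f = Y" "Cod C g = Y"
    "\<phi> = frac C D s f" "\<psi> = frac C D s g" by (rule common_denominator2)
  have 1: "\<phi> \<boxplus>\<^bsub>Q\<^esub> \<psi> = frac C D s (f \<boxplus> g)" unfolding f(6,7) by (rule add_frac) (use f(1-5) in auto)
  then show "\<phi> \<boxplus>\<^bsub>Q\<^esub> \<psi> \<in> Hom Q X Y" using frac_hom[of s "f \<boxplus> g"] f(1-5) by simp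
  have 2: "\<psi> \<boxplus>\<^bsub>Q\<^esub> \<phi> = frac C D s (g \<boxplus> f)" unfolding f(6,7) by (rule add_frac) (use f(1-5) in auto)
  show "\<phi> \<boxplus>\<^bsub>Q\<^esub> \<psi> = \<psi> \<boxplus>\<^bsub>Q\<^esub> \<phi>" unfolding 1 2 using f(1-5) by (subst add_comm) auto
next
  show "ZeroArr Q X Y \<in> Hom Q X Y"
    using frac_hom[of "Ident C X" "ZeroArr C X Y"] assms by (simp add: Q_fields(6))
next
  fix \<phi> \<psi> \<chi> assume "\<phi> \<in> Hom Q X Y" "\<psi> \<in> Hom Q X Y" "\<chi> \<in> Hom Q X Y"
  then obtain s f g h where f: "roof C D s f" "roof C D s g" "roof C D s h"
    "Cod C s = X" "Cod C f = Y" "Cod C g = Y" "Cod C h = Y"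
    "\<phi> = frac C D s f" "\<psi> = frac C D s g" "\<chi> = frac C D s h" by (rule common_denominator3)
  have "\<phi> \<boxplus>\<^bsub>Q\<^esub> \<psi> \<boxplus>\<^bsub>Q\<^esub> \<chi> = frac C D s (f \<boxplus> g \<boxplus> h)"
    unfolding f(8-10) using f(1-7) by (simp add: add_frac)
  moreover have "\<phi> \<boxplus>\<^bsub>Q\<^esub> (\<psi> \<boxplus>\<^bsub>Q\<^esub> \<chi>) = frac C D s (f \<boxplus> (g \<boxplus> h))"
    unfolding f(8-10) using f(1-7) by (simp add: add_frac)
  ultimately show "\<phi> \<boxplus>\<^bsub>Q\<^esub> \<psi> \<boxplus>\<^bsub>Q\<^esub> \<chi> = \<phi> \<boxplus>\<^bsub>Q\<^esub> (\<psi> \<boxplus>\<^bsub>Q\<^esub> \<chi>)"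
    using f(1-7) by (simp add: add_assoc)
next
  fix \<phi> assume "\<phi> \<in> Hom Q X Y"
  then obtain s f where f: "\<phi> = frac C D s f" "roof C D s f" "Cod C s = X" "Cod C f = Y"
    by (rule Q_hom_fracE)
  have z: "ZeroArr Q X Y = frac C D s (ZeroArr C (Dom C s) Y)" using zero_frac[of s Y] f(2,3) assms(2) by simp
  have "ZeroArr Q X Y \<boxplus>\<^bsub>Q\<^esub> \<phi> = frac C D s (ZeroArr C (Dom C s) Y \<boxplus> f)"
    unfolding z f(1) by (rule add_frac) (use f(2-4) assms in auto)
  then show "ZeroArr Q X Y \<boxplus>\<^bsub>Q\<^esub> \<phi> = \<phi>" using f by simp
  have "frac C D s (neg_arr C f) \<boxplus>\<^bsub>Q\<^esub> \<phi> = frac C D s (neg_arr C f \<boxplus> f)"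
    unfolding f(1) by (rule add_frac) (use f(2-4) assms in auto)
  then have "frac C D s (neg_arr C f) \<boxplus>\<^bsub>Q\<^esub> \<phi> = ZeroArr Q X Y" unfolding z using f(2-4) by simp
  moreover have "frac C D s (neg_arr C f) \<in> Hom Q X Y" using frac_hom[of s "neg_arr C f"] f(2-4) by simp
  ultimately show "\<exists>\<psi>\<in>Hom Q X Y. \<psi> \<boxplus>\<^bsub>Q\<^esub> \<phi> = ZeroArr Q X Y" by blast
qed

lemma Q_preadditive: "preadditive_category Q"
proof (rule preadditive_category.intro)
  fix \<phi> assume "\<phi> \<in> Arr Q"
  then obtain s f where "\<phi> = frac C D s f" "roof C D s f" by (rule Q_arrE)
  then show "Dom Q \<phi> \<in> Obj Q \<and> Cod Q \<phi> \<in> Obj Q" by (simp add: Q_fields)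
next
  fix X assume "X \<in> Obj Q"
  then show "Ident Q X \<in> Hom Q X X"
    using frac_hom[of "Ident C X" "Ident C X"] by (simp add: Q_fields(1,5))
next
  fix \<phi> X Y assume "\<phi> \<in> Hom Q X Y"
  then show "\<phi> \<cdot>\<^bsub>Q\<^esub> Ident Q X = \<phi>" "Ident Q Y \<cdot>\<^bsub>Q\<^esub> \<phi> = \<phi>"
    using Q_ident_right Q_ident_left by (metis Q_hom_fracE)+
next
  fix X Y assume "X \<in> Obj Q" "Y \<in> Obj Q"
  then show "comm_group (hom_group Q X Y)" using Q_hom_comm_group by (simp add: Q_fields(1))
qed (rule Q_comp_hom Q_assoc Q_comp_add Q_add_comp; assumption)+

section \<open>The localization functor\<close>

sublocale Q: preadditive_category Q
  by (rule Q_preadditive)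

lemmas Q_obj [simp] = Q_fields(1)
lemmas Q_ShO [simp] = Q_fields(7)
lemmas frac_dom_cod [simp] = Q_fields(3,4)

lemma Q_dom_cod_obj [simp]: "\<phi> \<in> Arr Q \<Longrightarrow> Dom Q \<phi> \<in> Obj C" "\<phi> \<in> Arr Q \<Longrightarrow> Cod Q \<phi> \<in> Obj C"
  using Q.dom_obj Q.cod_obj by auto

abbreviation "loc \<equiv> loc_arr C D"

lemma loc_simps [simp]:
  assumes "f \<in> Arr C"
  shows "loc f \<in> Arr Q" "Dom Q (loc f) = Dom C f" "Cod Q (loc f) = Cod C f"
  using assms by (auto simp: loc_arr_def)

lemma loc_ident: "X \<in> Obj C \<Longrightarrow> loc (Ident C X) = Ident Q X"
  by (simp add: loc_arr_def Q_fields)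

lemma loc_zero: "X \<in> Obj C \<Longrightarrow> Y \<in> Obj C \<Longrightarrow> loc (ZeroArr C X Y) = ZeroArr Q X Y"
  by (simp add: loc_arr_def Q_fields)

lemma loc_comp:
  assumes "f \<in> Arr C" "g \<in> Arr C" "Cod C f = Dom C g"
  shows "loc (g \<cdot> f) = loc g \<cdot>\<^bsub>Q\<^esub> loc f"
proof -
  have "loc g \<cdot>\<^bsub>Q\<^esub> loc f = frac C D (Ident C (Dom C f) \<cdot> Ident C (Dom C f)) (g \<cdot> f)"
    unfolding loc_arr_def by (rule comp_frac_typed) (use assms in auto)
  then show ?thesis using assms by (simp add: loc_arr_def)
qed

lemma loc_add:
  assumes "f \<in> Arr C" "g \<in> Arr C" "Dom C g = Dom C f" "Cod C g = Cod C f"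
  shows "loc (f \<boxplus> g) = loc f \<boxplus>\<^bsub>Q\<^esub> loc g"
  using assms by (simp add: loc_arr_def add_frac)

lemma loc_eq_zeroE:
  assumes "loc f = ZeroArr Q (Dom C f) (Cod C f)" "f \<in> Arr C"
  obtains w where "den w" "Cod C w = Dom C f" "f \<cdot> w = ZeroArr C (Dom C w) (Cod C f)"
proof -
  have "frac C D (Ident C (Dom C f)) f = frac C D (Ident C (Dom C f)) (ZeroArr C (Dom C f) (Cod C f))"
    using assms unfolding loc_arr_def Q_fields by simp
  then obtain w where "den w" "Cod C w = Dom C (Ident C (Dom C f))"
      "f \<cdot> w = ZeroArr C (Dom C f) (Cod C f) \<cdot> w"
    by (rule frac_eq_same_denE) (use assms in auto)
  then show ?thesis using that[of w] assms by simp
qed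

text \<open>The criterion behind fullness: a fraction comes from \<open>C\<close> as soon as its
  numerator, after expansion by some denominator \<open>t\<close>, extends along the expanded
  denominator.\<close>

lemma frac_eq_loc:
  assumes "roof C D s f" "den t" "Cod C t = Dom C s" "k \<in> Arr C" "Dom C k = Cod C s"
    "f \<cdot> t = k \<cdot> (s \<cdot> t)"
  shows "frac C D s f = loc k"
proof -
  have "frac C D s f = frac C D (s \<cdot> t) (f \<cdot> t)" using assms by (intro frac_expand[symmetric]) auto
  also have "\<dots> = frac C D (Ident C (Cod C s) \<cdot> (s \<cdot> t)) (k \<cdot> (s \<cdot> t))" unfolding assms(6) using assms(1-3) by simp
  also have "\<dots> = frac C D (Ident C (Cod C s)) k" using assms(1-5) by (intro frac_expand) auto
  finally show ?thesis using assms by (simp add: loc_arr_def)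
qed

lemma loc_eq_zero:
  assumes "den t" "f \<in> Arr C" "Cod C t = Dom C f" "f \<cdot> t = ZeroArr C (Dom C t) (Cod C f)"
  shows "loc f = ZeroArr Q (Dom C f) (Cod C f)"
proof -
  have "frac C D (Ident C (Dom C f)) f = loc (ZeroArr C (Dom C f) (Cod C f))"
    by (rule frac_eq_loc[of _ _ t]) (use assms in auto)
  then show ?thesis using assms by (simp add: loc_zero) (simp add: loc_arr_def)
qed

lemma loc_biproduct:
  assumes "biproduct C X Y Z"
  shows "biproduct Q X Y Z"
proof -
  obtain i j p q where Z: "i \<in> Hom C X Z" "j \<in> Hom C Y Z" "p \<in> Hom C Z X" "q \<in> Hom C Z Y"
    "p \<cdot> i = Ident C X" "q \<cdot> j = Ident C Y" "p \<cdot> j = ZeroArr C Y X" "q \<cdot> i = ZeroArr C X Y"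
    "(i \<cdot> p) \<boxplus> (j \<cdot> q) = Ident C Z" "Z \<in> Obj C"
    using assms unfolding biproduct_def by blast
  have obj: "X \<in> Obj C" "Y \<in> Obj C" using Z by auto
  have hom: "loc i \<in> Hom Q X Z" "loc j \<in> Hom Q Y Z" "loc p \<in> Hom Q Z X" "loc q \<in> Hom Q Z Y"
    using Z(1-4) by auto
  have 1: "loc p \<cdot>\<^bsub>Q\<^esub> loc i = Ident Q X" "loc q \<cdot>\<^bsub>Q\<^esub> loc j = Ident Q Y"
    "loc p \<cdot>\<^bsub>Q\<^esub> loc j = ZeroArr Q Y X" "loc q \<cdot>\<^bsub>Q\<^esub> loc i = ZeroArr Q X Y"
    using Z(1-8) obj by (simp_all add: loc_comp[symmetric] loc_ident loc_zero)
  have "(loc i \<cdot>\<^bsub>Q\<^esub> loc p) \<boxplus>\<^bsub>Q\<^esub> (loc j \<cdot>\<^bsub>Q\<^esub> loc q) = loc ((i \<cdot> p) \<boxplus> (j \<cdot> q))"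
    using Z(1-4) by (simp add: loc_comp loc_add)
  then have 2: "(loc i \<cdot>\<^bsub>Q\<^esub> loc p) \<boxplus>\<^bsub>Q\<^esub> (loc j \<cdot>\<^bsub>Q\<^esub> loc q) = Ident Q Z"
    using Z(9,10) by (simp add: loc_ident)
  have "Z \<in> Obj Q" using Z(10) by simp
  then show ?thesis unfolding biproduct_def using hom 1 2 by blast
qed

section \<open>The shift and the distinguished triangles of the quotient\<close>

text \<open>One direction makes the shift of the quotient well defined, the other makes it faithful;
  for the latter the two legs witnessing the equivalence are unshifted.\<close>

lemma roof_equiv_shift:
  assumes "roof C D s f" "roof C D s' f'" "Cod C s = Cod C s'" "Cod C f = Cod C f'"
  shows "roof_equiv C D (ShM C s) (ShM C f) (ShM C s') (ShM C f') \<longleftrightarrow> roof_equiv C D s f s' f'"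
proof
  assume "roof_equiv C D s f s' f'"
  then obtain t t' where t: "den t" "den t'" "Cod C t = Dom C s" "Cod C t' = Dom C s'" "Dom C t' = Dom C t"
    "s \<cdot> t = s' \<cdot> t'" "f \<cdot> t = f' \<cdot> t'" by (rule roof_equivE)
  have 1: "ShM C s \<cdot> ShM C t = ShM C s' \<cdot> ShM C t'" using arg_cong[OF t(6), of "ShM C"] t(1-5) assms by simp
  have 2: "ShM C f \<cdot> ShM C t = ShM C f' \<cdot> ShM C t'" using arg_cong[OF t(7), of "ShM C"] t(1-5) assms by simp
  show "roof_equiv C D (ShM C s) (ShM C f) (ShM C s') (ShM C f')"
    by (rule roof_equivI[OF _ _ _ _ _ _ _ _ _ _ 1 2]) (use t(1-5) assms in auto)
next
  assume "roof_equiv C D (ShM C s) (ShM C f) (ShM C s') (ShM C f')"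
  then obtain t t' where t: "den t" "den t'" "Cod C t = Dom C (ShM C s)" "Cod C t' = Dom C (ShM C s')" "Dom C t' = Dom C t"
    "ShM C s \<cdot> t = ShM C s' \<cdot> t'" "ShM C f \<cdot> t = ShM C f' \<cdot> t'" by (rule roof_equivE)
  have "Dom C t \<in> Obj C" using t(1) by simp
  then obtain W where W: "W \<in> Obj C" "ShO C W = Dom C t" by (rule unshift_obj)
  obtain q where q: "q \<in> Arr C" "Dom C q = W" "Cod C q = Dom C s" "ShM C q = t"
    using unshift_arr[of t W "Dom C s"] t W assms by auto
  obtain q' where q': "q' \<in> Arr C" "Dom C q' = W" "Cod C q' = Dom C s'" "ShM C q' = t'"
    using unshift_arr[of t' W "Dom C s'"] t(2,4,5) W assms by auto
  have 1: "s \<cdot> q = s' \<cdot> q'" by (rule ShM_inj) (use q q' t(6) assms in auto)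
  have 2: "f \<cdot> q = f' \<cdot> q'" by (rule ShM_inj) (use q q' t(7) assms in auto)
  have den: "den q" using q t(1) den_shift by metis
  show "roof_equiv C D s f s' f'"
    by (rule roof_equivI[OF _ _ _ _ _ _ _ _ _ _ 1 2]) (use den q(1-3) q'(1-3) assms in auto)
qed

lemma ShM_frac:
  assumes "roof C D s f"
  shows "ShM Q (frac C D s f) = frac C D (ShM C s) (ShM C f)"
proof -
  have "ShM Q (frac C D s f) = (THE \<chi>. \<exists>s' f'. roof C D s' f' \<and> frac C D s f = frac C D s' f' \<and>
       \<chi> = frac C D (ShM C s') (ShM C f'))"
    by (simp add: verdier_quotient_def verdier_shift_cat_def shift_cat.extend_def tri_cat.fields_def)
  also have "\<dots> = frac C D (ShM C s) (ShM C f)"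
  proof (rule the_equality, goal_cases)
    case 1
    show ?case using assms by blast
  next
    case (2 \<chi>)
    then obtain s' f' where h: "roof C D s' f'" "frac C D s f = frac C D s' f'"
      "\<chi> = frac C D (ShM C s') (ShM C f')" by blast
    have "roof_equiv C D (ShM C s) (ShM C f) (ShM C s') (ShM C f')"
      using h assms frac_cod[OF h(2)] by (subst roof_equiv_shift) (auto simp: frac_eq_iff)
    then have "frac C D (ShM C s) (ShM C f) = frac C D (ShM C s') (ShM C f')"
      using assms by (subst frac_eq_iff) auto
    then show ?case using h(3) by simp
  qed
  finally show ?thesis .
qed

lemma ShM_Q_hom:
  assumes "\<phi> \<in> Hom Q X Y"
  shows "ShM Q \<phi> \<in> Hom Q (ShO C X) (ShO C Y)"
proof -
  obtain s f where f: "\<phi> = frac C D s f" "roof C D s f" "Cod C s = X" "Cod C f = Y"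
    using assms by (rule Q_hom_fracE)
  then show ?thesis using frac_hom[of "ShM C s" "ShM C f"] by (simp add: ShM_frac)
qed

lemma ShM_Q_inj:
  assumes "\<phi> \<in> Hom Q X Y" "\<psi> \<in> Hom Q X Y" "ShM Q \<phi> = ShM Q \<psi>"
  shows "\<phi> = \<psi>"
proof -
  obtain s f where f: "\<phi> = frac C D s f" "roof C D s f" "Cod C s = X" "Cod C f = Y"
    using assms(1) by (rule Q_hom_fracE)
  obtain t g where g: "\<psi> = frac C D t g" "roof C D t g" "Cod C t = X" "Cod C g = Y"
    using assms(2) by (rule Q_hom_fracE)
  have "frac C D (ShM C s) (ShM C f) = frac C D (ShM C t) (ShM C g)"
    using assms(3) unfolding f(1) g(1) ShM_frac[OF f(2)] ShM_frac[OF g(2)] .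
  then have "roof_equiv C D (ShM C s) (ShM C f) (ShM C t) (ShM C g)"
    using f(2) by (subst (asm) frac_eq_iff) auto
  then have "roof_equiv C D s f t g" using f g by (subst (asm) roof_equiv_shift) auto
  then show ?thesis unfolding f(1) g(1) using f(2) frac_eq_iff by blast
qed

lemma ShM_Q_surj:
  assumes "\<phi> \<in> Hom Q (ShO C X) (ShO C Y)" "X \<in> Obj C" "Y \<in> Obj C"
  obtains \<psi> where "\<psi> \<in> Hom Q X Y" "ShM Q \<psi> = \<phi>"
proof -
  obtain s f where f: "\<phi> = frac C D s f" "roof C D s f" "Cod C s = ShO C X" "Cod C f = ShO C Y"
    using assms(1) by (rule Q_hom_fracE)
  have "Dom C s \<in> Obj C" using f by simp
  then obtain W where W: "W \<in> Obj C" "ShO C W = Dom C s" by (rule unshift_obj)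
  obtain t where t: "t \<in> Arr C" "Dom C t = W" "Cod C t = X" "ShM C t = s"
    using unshift_arr[of s W X] W f assms by auto
  obtain g where g: "g \<in> Arr C" "Dom C g = W" "Cod C g = Y" "ShM C g = f"
    using unshift_arr[of f W Y] W f assms by auto
  have "den t" using t f(2) den_shift by (metis roof_iff)
  then show ?thesis using that[of "frac C D t g"] f(1) t g by (simp add: ShM_frac)
qed

lemma ShM_Q_ident: "X \<in> Obj C \<Longrightarrow> ShM Q (Ident Q X) = Ident Q (ShO C X)"
  by (simp add: Q_fields ShM_frac shift_ident)

lemma ShM_Q_comp:
  assumes "\<phi> \<in> Hom Q X Y" "\<psi> \<in> Hom Q Y Z"
  shows "ShM Q (\<psi> \<cdot>\<^bsub>Q\<^esub> \<phi>) = ShM Q \<psi> \<cdot>\<^bsub>Q\<^esub> ShM Q \<phi>"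
proof -
  obtain s f where f: "\<phi> = frac C D s f" "roof C D s f" "Cod C s = X" "Cod C f = Y"
    using assms(1) by (rule Q_hom_fracE)
  obtain t g where g: "\<psi> = frac C D t g" "roof C D t g" "Cod C t = Y" "Cod C g = Z"
    using assms(2) by (rule Q_hom_fracE)
  obtain u v where u: "den u" "v \<in> Arr C" "Cod C u = Dom C f" "Cod C v = Dom C t" "Dom C v = Dom C u"
    "f \<cdot> u = t \<cdot> v" using ore[of t f] f g by auto
  note arrs = f(2-4) g(2-4) u(1-5)
  have e: "ShM C f \<cdot> ShM C u = ShM C t \<cdot> ShM C v" using arg_cong[OF u(6), of "ShM C"] arrs by simp
  have "\<psi> \<cdot>\<^bsub>Q\<^esub> \<phi> = frac C D (s \<cdot> u) (g \<cdot> v)"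
    unfolding f(1) g(1) by (rule comp_frac_typed[OF _ _ _ _ _ _ _ _ u(6)]) (use arrs in auto)
  moreover have "ShM Q \<psi> \<cdot>\<^bsub>Q\<^esub> ShM Q \<phi> = frac C D (ShM C s \<cdot> ShM C u) (ShM C g \<cdot> ShM C v)"
    unfolding f(1) g(1) ShM_frac[OF f(2)] ShM_frac[OF g(2)]
    by (rule comp_frac_typed[OF _ _ _ _ _ _ _ _ e]) (use arrs in auto)
  ultimately show ?thesis using arrs by (simp add: ShM_frac)
qed

text \<open>Lets Karoubi-closures in the quotient inherit the shift conditions. Descending from the
  shifted objects uses that the shift is full and faithful on the quotient.\<close>

lemma retract_Q_shift:
  assumes "X \<in> Obj C" "Y \<in> Obj C"
  shows "retract Q (ShO C X) (ShO C Y) \<longleftrightarrow> retract Q X Y"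
proof
  assume "retract Q X Y"
  then obtain i p where i: "i \<in> Hom Q X Y" "p \<in> Hom Q Y X" "p \<cdot>\<^bsub>Q\<^esub> i = Ident Q X"
    unfolding retract_def by blast
  have "ShM Q p \<cdot>\<^bsub>Q\<^esub> ShM Q i = Ident Q (ShO C X)"
    using ShM_Q_comp[OF i(1,2)] i(3) assms ShM_Q_ident by simp
  then show "retract Q (ShO C X) (ShO C Y)" using Q.retractI ShM_Q_hom i(1,2) by blast
next
  assume "retract Q (ShO C X) (ShO C Y)"
  then obtain i p where i: "i \<in> Hom Q (ShO C X) (ShO C Y)" "p \<in> Hom Q (ShO C Y) (ShO C X)"
    "p \<cdot>\<^bsub>Q\<^esub> i = Ident Q (ShO C X)" unfolding retract_def by blast
  obtain j where j: "j \<in> Hom Q X Y" "ShM Q j = i" using ShM_Q_surj[OF i(1) assms] by blast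
  obtain q where q: "q \<in> Hom Q Y X" "ShM Q q = p" using ShM_Q_surj[OF i(2) assms(2,1)] by blast
  have "q \<cdot>\<^bsub>Q\<^esub> j = Ident Q X"
  proof (rule ShM_Q_inj)
    show "q \<cdot>\<^bsub>Q\<^esub> j \<in> Hom Q X X" using Q_comp_hom j q by blast
    show "Ident Q X \<in> Hom Q X X" using assms by simp
    show "ShM Q (q \<cdot>\<^bsub>Q\<^esub> j) = ShM Q (Ident Q X)"
      using ShM_Q_comp[OF j(1) q(1)] j q i(3) ShM_Q_ident assms by simp
  qed
  then show "retract Q X Y" using Q.retractI j(1) q(1) by blast
qed

lemma shift_obj_Q: "shift_obj Q n X = shift_obj C n X"
  by (simp add: shift_obj_def)

lemma loc_dtri:
  assumes "DTri C f g h"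
  shows "DTri Q (loc f) (loc g) (loc h)"
proof -
  let ?V = "verdier_shift_cat C D"
  note t = dtri_arr[OF assms]
  \<comment> \<open>Distinguished triangles of the quotient are defined by isomorphisms in
    \<open>verdier_shift_cat C D\<close>, a record without triangles. The fields involved agree with
    those of \<open>Q\<close>, so the required isomorphism can be given by identities of
    \<open>Q\<close>.\<close>
  have V: "Arr ?V = Arr Q" "Dom ?V = Dom Q" "Cod ?V = Cod Q" "Ident ?V = Ident Q" "Comp ?V = Comp Q"
    "ShO ?V = ShO Q" "ShM ?V = ShM Q"
    by (simp_all add: verdier_quotient_def shift_cat.extend_def tri_cat.fields_def)
  have "Hom ?V = Hom Q" by (intro ext) (simp add: Hom_def V)
  then have iso: "iso_arr ?V = iso_arr Q" by (intro ext) (simp add: iso_arr_def V)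
  have tri: "is_triangle Q (loc f) (loc g) (loc h)" using t by (simp add: is_triangle_def)
  have "triangle_iso Q (loc f) (loc g) (loc h) (loc f) (loc g) (loc h)"
    unfolding triangle_iso_def
  proof (intro conjI exI)
    show "iso_arr Q (Ident Q (Dom C f)) (Dom Q (loc f)) (Dom Q (loc f))"
      "iso_arr Q (Ident Q (Dom C g)) (Dom Q (loc g)) (Dom Q (loc g))"
      "iso_arr Q (Ident Q (Dom C h)) (Dom Q (loc h)) (Dom Q (loc h))"
      using t Q.iso_arr_ident by auto
  qed (use t tri in \<open>auto simp: ShM_Q_ident\<close>)
  then have "triangle_iso ?V (loc f) (loc g) (loc h) (loc f) (loc g) (loc h)"
    by (simp add: triangle_iso_def is_triangle_def V iso)
  then show ?thesis using assms
    by (auto simp: verdier_quotient_def shift_cat.extend_def tri_cat.fields_def)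
qed

end

section \<open>Weight structures\<close>

locale weighted_category = triangulated_category C for C :: "('o, 'm, 'x) tri_cat_scheme" (structure) +
  fixes wle wge :: "'o set"
  assumes weight: "weight_structure C wle wge"
begin

lemma wle_obj: "wle \<subseteq> Obj C" and wge_obj: "wge \<subseteq> Obj C"
  using weight unfolding weight_structure_def by auto

lemma wle_shift: "X \<in> wle \<Longrightarrow> ShO C X \<in> wle"
proof -
  have "shift_obj C 1 ` wle \<subseteq> wle" using weight unfolding weight_structure_def by blast
  then show "X \<in> wle \<Longrightarrow> ShO C X \<in> wle" by auto
qed

lemma wge_unshift:
  assumes "ShO C X \<in> wge" "X \<in> Obj C"
  shows "X \<in> wge"
proof -
  have "wge \<subseteq> shift_obj C 1 ` wge" using weight unfolding weight_structure_def by blast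
  then obtain Y where "Y \<in> wge" "ShO C X = ShO C Y" using assms(1) by auto
  then show ?thesis using ShO_inj[of X Y] assms(2) wge_obj by auto
qed

lemma wge_retract: "retract C X Y \<Longrightarrow> Y \<in> wge \<Longrightarrow> X \<in> wge"
proof -
  have "karoubi_closed C wge" using weight unfolding weight_structure_def by blast
  then show "retract C X Y \<Longrightarrow> Y \<in> wge \<Longrightarrow> X \<in> wge" unfolding karoubi_closed_def karoubi_closure_def by blast
qed

lemma orthogonal_shift:
  assumes "f \<in> Arr C" "Dom C f \<in> wge" "Cod C f = ShO C Y" "Y \<in> wle"
  shows "f = ZeroArr C (Dom C f) (Cod C f)"
proof -
  have "orthogonal C wge (shift_obj C 1 ` wle)" using weight unfolding weight_structure_def by blast
  then have "Hom C (Dom C f) (ShO C Y) = {ZeroArr C (Dom C f) (ShO C Y)}"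
    using assms(2,4) unfolding orthogonal_def by auto
  then show ?thesis using assms(1,3) by (metis in_Hom_iff singletonD)
qed

text \<open>The orthogonality axiom shifted by one: it applies to \<open>ShM C f\<close>, and the
  shift is faithful. In this form it kills arrows out of the fibre of a weight decomposition into
  \<open>wle\<close>.\<close>

lemma orthogonal_unshift:
  assumes "f \<in> Arr C" "ShO C (Dom C f) \<in> wge" "Cod C f \<in> wle"
  shows "f = ZeroArr C (Dom C f) (Cod C f)"
proof -
  have "ShM C f = ZeroArr C (ShO C (Dom C f)) (ShO C (Cod C f))"
    using orthogonal_shift[of "ShM C f" "Cod C f"] assms by simp
  then have "ShM C f = ShM C (ZeroArr C (Dom C f) (Cod C f))" using assms(1) by simp
  then show ?thesis by (rule ShM_inj) (use assms(1) in auto)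
qed

lemma ex_weight_decomposition:
  "\<forall>X \<in> Obj C. \<exists>A \<in> wle. \<exists>B \<in> wge. \<exists>f \<in> Hom C (shift_obj C (- 1) B) X.
    \<exists>g \<in> Hom C X A. \<exists>h \<in> Hom C A B. DTri C f g h"
  using weight unfolding weight_structure_def by (elim conjE)

lemma weight_decomposition:
  assumes "X \<in> Obj C"
  obtains f g h where "DTri C f g h" "ShO C (Dom C f) \<in> wge" "Cod C f = X" "Cod C g \<in> wle"
proof -
  obtain A B f g h where h: "A \<in> wle" "B \<in> wge" "f \<in> Hom C (shift_obj C (- 1) B) X" "g \<in> Hom C X A"
    "h \<in> Hom C A B" "DTri C f g h"
    using bspec[OF ex_weight_decomposition assms] by blast
  have "B \<in> Obj C" using h(2) wge_obj by blast
  then have "ShO C (Dom C f) = B" using h(3) by simp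
  then show ?thesis using that[OF h(6)] h(1-4) by simp
qed

text \<open>This is a decomposition of \<open>X[-1]\<close>, shifted. Its third vertex lies in the
  shift of \<open>wle\<close>, so arrows from \<open>wge\<close> to that vertex vanish and arrows
  from \<open>wge\<close> to \<open>X\<close> lift to the first vertex.\<close>

lemma weight_decomposition_shift:
  assumes "X \<in> Obj C"
  obtains f g h A where "DTri C f g h" "Dom C f \<in> wge" "Cod C f = X" "A \<in> wle" "Cod C g = ShO C A"
proof -
  obtain X' where X': "X' \<in> Obj C" "ShO C X' = X" using assms by (rule unshift_obj)
  obtain f g h where h: "DTri C f g h" "ShO C (Dom C f) \<in> wge" "Cod C f = X'" "Cod C g \<in> wle"
    using X'(1) by (rule weight_decomposition)
  show ?thesis
    by (rule that[OF rotate3[OF h(1)], of "Cod C g"]) (use h X' dtri_arr[OF h(1)] in auto)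
qed

text \<open>\<open>wge\<close> is the left orthogonal of the shift of \<open>wle\<close>, hence closed under extensions.\<close>

lemma wge_extension:
  assumes "DTri C f g h" "Dom C f \<in> wge" "Cod C g \<in> wge"
  shows "Cod C f \<in> wge"
proof -
  note t = dtri_arr[OF assms(1)]
  have orth: "k = ZeroArr C (Cod C f) (Cod C k)"
    if k: "k \<in> Arr C" "Dom C k = Cod C f" "Cod C k = ShO C Y" "Y \<in> wle" for k Y
  proof -
    have "k \<cdot> f = ZeroArr C (Dom C f) (Cod C k)"
      using orthogonal_shift[of "k \<cdot> f" Y] k t assms by simp
    then obtain m where m: "m \<in> Arr C" "Dom C m = Cod C g" "Cod C m = Cod C k" "m \<cdot> g = k"
      using weak_cokernel[OF assms(1) k(1,2)] by blast
    have "m = ZeroArr C (Cod C g) (Cod C k)"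
      using orthogonal_shift[of m Y] m k assms by simp
    then have "k = ZeroArr C (Cod C g) (Cod C k) \<cdot> g" using m(4) by simp
    also have "\<dots> = ZeroArr C (Cod C f) (Cod C k)" using t zero_comp[of g "Cod C g" "Cod C k"] k(1) by simp
    finally show ?thesis .
  qed
  have "Cod C f \<in> Obj C" using t by simp
  then obtain b a c A where b: "DTri C b a c" "Dom C b \<in> wge" "Cod C b = Cod C f" "A \<in> wle" "Cod C a = ShO C A"
    by (rule weight_decomposition_shift)
  note bt = dtri_arr[OF b(1)]
  have "a = ZeroArr C (Cod C f) (Cod C a)" by (rule orth[OF _ _ b(5,4)]) (use bt b in auto)
  then have "a \<cdot> Ident C (Cod C f) = ZeroArr C (Dom C (Ident C (Cod C f))) (Cod C a)" using bt b t by simp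
  then obtain m where m: "m \<in> Arr C" "Dom C m = Cod C f" "Cod C m = Dom C b" "b \<cdot> m = Ident C (Cod C f)"
    using weak_kernel[OF b(1), of "Ident C (Cod C f)"] t b by auto
  then have "retract C (Cod C f) (Dom C b)" by (intro retractI[of m _ _ b]) (use m b bt in auto)
  then show ?thesis using wge_retract b(2) by blast
qed

end

locale weighted_localization = weighted_category C wle wge + verdier_localization C D
  for C :: "('o, 'm, 'x) tri_cat_scheme" (structure) and wle wge D :: "'o set" +
  assumes weight_D: "weight_structure (tri_sub C D) (D \<inter> wle) (D \<inter> wge)"
begin

section \<open>Arrows of the quotient from \<open>wge\<close> to \<open>wle\<close>\<close>

lemma decomposition_D:
  assumes "X \<in> D"
  obtains f g h where "DTri C f g h" "ShO C (Dom C f) \<in> D \<inter> wge" "Cod C f = X" "Cod C g \<in> D \<inter> wle"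
proof -
  let ?T = "tri_sub C D"
  have T: "Obj ?T = D" "\<And>X Y f. f \<in> Hom ?T X Y \<Longrightarrow> f \<in> Hom C X Y" "\<And>f g h. DTri ?T f g h \<Longrightarrow> DTri C f g h"
    by (auto simp: tri_sub_def full_sub_def)
  have "\<forall>X \<in> Obj ?T. \<exists>A \<in> D \<inter> wle. \<exists>B \<in> D \<inter> wge. \<exists>f \<in> Hom ?T (shift_obj ?T (- 1) B) X.
      \<exists>g \<in> Hom ?T X A. \<exists>h \<in> Hom ?T A B. DTri ?T f g h"
    using weight_D unfolding weight_structure_def by (elim conjE)
  from bspec[OF this, unfolded T(1), OF assms]
  obtain A B f g h where "A \<in> D \<inter> wle" "B \<in> D \<inter> wge"
    "f \<in> Hom ?T (shift_obj ?T (- 1) B) X" "g \<in> Hom ?T X A" "h \<in> Hom ?T A B" "DTri ?T f g h"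
    by blast
  then have h: "A \<in> D \<inter> wle" "B \<in> D \<inter> wge"
    "f \<in> Hom C (shift_obj ?T (- 1) B) X" "g \<in> Hom C X A" "h \<in> Hom C A B" "DTri C f g h"
    using T by blast+
  obtain B' where B': "B' \<in> Obj C" "ShO C B' = B" using unshift_obj[of B] D_obj h(2) by auto
  then have "B' \<in> D" using D_unshift h(2) by blast
  \<comment> \<open>The negative shift of \<open>tri_sub C D\<close> inverts \<open>ShO C\<close> on
    \<open>D\<close> instead of on all objects. It is a preimage of \<open>B\<close> because the
    preimage \<open>B'\<close> lies in \<open>D\<close>.\<close>
  then have "ShO C (shift_obj (tri_sub C D) (- 1) B) = B"
    using f_inv_into_f[of B "ShO C" D] B' by (force simp: shift_obj_def tri_sub_def full_sub_def)
  then show ?thesis using that[OF h(6)] h(1-4) by simp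
qed

lemma decomposition_D_shift:
  assumes "X \<in> D"
  obtains f g h A where "DTri C f g h" "Dom C f \<in> D \<inter> wge" "Cod C f = X" "A \<in> wle" "Cod C g = ShO C A"
proof -
  have "X \<in> Obj C" using assms D_obj by blast
  then obtain X' where X': "X' \<in> Obj C" "ShO C X' = X" by (rule unshift_obj)
  have "X' \<in> D" using D_unshift X' assms by blast
  then obtain f g h where h: "DTri C f g h" "ShO C (Dom C f) \<in> D \<inter> wge" "Cod C f = X'" "Cod C g \<in> D \<inter> wle"
    by (rule decomposition_D)
  show ?thesis
    by (rule that[OF rotate3[OF h(1)], of "Cod C g"]) (use h X' dtri_arr[OF h(1)] in auto)
qed

text \<open>
  Decompose the cone of \<open>s\<close> in \<open>D\<close>. By orthogonality the arrow from the target of \<open>s\<close> to the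
  cone lifts to the nonnegative part of the cone, and a fibre of that lift is the new denominator.
\<close>

lemma refine_denominator:
  assumes "den s" "Cod C s \<in> wge"
  obtains t x y where "den t" "Cod C t = Dom C s" "DTri C (s \<cdot> t) x y" "Cod C x \<in> D \<inter> wge"
proof -
  obtain g h where g: "DTri C s g h" "Cod C g \<in> D" using assms unfolding cone_in_def by blast
  note gt = dtri_arr[OF g(1)]
  obtain b a c A where b: "DTri C b a c" "Dom C b \<in> D \<inter> wge" "Cod C b = Cod C g" "A \<in> wle" "Cod C a = ShO C A"
    using g(2) by (rule decomposition_D_shift)
  note bt = dtri_arr[OF b(1)]
  have "a \<cdot> g = ZeroArr C (Dom C g) (Cod C a)"
    using orthogonal_shift[of "a \<cdot> g" A] gt bt b assms by simp
  then obtain m where m: "m \<in> Arr C" "Dom C m = Dom C g" "Cod C m = Dom C b" "b \<cdot> m = g"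
    using weak_kernel[OF b(1), of g] gt b by metis
  obtain r y where r: "DTri C r m y" using fibre m(1) by blast
  note rt = dtri_arr[OF r]
  have "den r" unfolding cone_in_def using r m b(2) by auto
  have "g \<cdot> r = b \<cdot> (m \<cdot> r)" unfolding m(4)[symmetric] by (rule assoc) (use m rt bt in auto)
  also have "\<dots> = ZeroArr C (Dom C r) (Cod C g)" unfolding dtri_comp_zero[OF r] using m rt bt b by simp
  finally obtain t where t: "t \<in> Arr C" "Dom C t = Dom C r" "Cod C t = Dom C s" "s \<cdot> t = r"
    using weak_kernel[OF g(1), of r] rt m(2) gt by metis
  have "den t" by (rule den_cancel[of s]) (use t assms \<open>den r\<close> in auto)
  then show ?thesis using that[of t m y] t r b(2) m(3) by simp
qed

text \<open>The obstruction to extending \<open>f\<close> is its composite with the arrow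
  \<open>w\<close> from the unshifted cone of \<open>s\<close>. That composite runs from
  \<open>wge[-1]\<close> to \<open>wle\<close> and vanishes by orthogonality.\<close>

lemma extend_along:
  assumes "DTri C s x y" "Cod C x \<in> wge" "f \<in> Arr C" "Dom C f = Dom C s" "Cod C f \<in> wle"
  obtains k where "k \<in> Arr C" "Dom C k = Cod C s" "Cod C k = Cod C f" "k \<cdot> s = f"
proof -
  obtain w where w: "DTri C w s x" "w \<in> Arr C" "ShO C (Dom C w) = Cod C x" "Cod C w = Dom C s"
    using unrotate[OF assms(1)] by blast
  have "f \<cdot> w = ZeroArr C (Dom C w) (Cod C f)"
    using orthogonal_unshift[of "f \<cdot> w"] w assms by simp
  then show ?thesis using weak_cokernel[OF w(1), of f] w(4) assms(3,4) that by metis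
qed

lemma loc_full:
  assumes "\<phi> \<in> Hom Q X Y" "X \<in> wge" "Y \<in> wle"
  obtains k where "k \<in> Hom C X Y" "\<phi> = loc k"
proof -
  obtain s f where f: "\<phi> = frac C D s f" "roof C D s f" "Cod C s = X" "Cod C f = Y"
    using assms(1) by (rule Q_hom_fracE)
  obtain t x y where t: "den t" "Cod C t = Dom C s" "DTri C (s \<cdot> t) x y" "Cod C x \<in> D \<inter> wge"
    using refine_denominator[of s] f assms by auto
  have "f \<cdot> t \<in> Arr C" "Dom C (f \<cdot> t) = Dom C (s \<cdot> t)" "Cod C (f \<cdot> t) \<in> wle" "Cod C x \<in> wge"
    using f t assms by auto
  then obtain k where k: "k \<in> Arr C" "Dom C k = Cod C (s \<cdot> t)" "Cod C k = Cod C (f \<cdot> t)" "k \<cdot> (s \<cdot> t) = f \<cdot> t"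
    using extend_along[OF t(3), of "f \<cdot> t"] by blast
  have "\<phi> = loc k" unfolding f(1) by (rule frac_eq_loc[OF f(2) t(1)]) (use k f(2) t in auto)
  then show ?thesis using that[of k] k f t(1,2) by simp
qed

text \<open>
  \<open>f\<close> factors through the cone of a denominator, which may be taken in \<open>D \<inter> wge\<close>; a weight
  decomposition of that cone in \<open>D\<close> moves the factorization to an object of the heart of \<open>D\<close>.
\<close>

lemma loc_zero_factors:
  assumes "f \<in> Hom C X Y" "X \<in> wge" "Y \<in> wle" "loc f = ZeroArr Q X Y"
  obtains Z a b where "Z \<in> D \<inter> wge \<inter> wle" "a \<in> Hom C X Z" "b \<in> Hom C Z Y" "f = b \<cdot> a"
proof -
  have f: "f \<in> Arr C" "Dom C f = X" "Cod C f = Y" using assms by auto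
  obtain w where w: "den w" "Cod C w = X" "f \<cdot> w = ZeroArr C (Dom C w) Y"
    using loc_eq_zeroE[of f] assms f by auto
  obtain t x y where t: "den t" "Cod C t = Dom C w" "DTri C (w \<cdot> t) x y" "Cod C x \<in> D \<inter> wge"
    using refine_denominator[of w] w assms by auto
  note xt = dtri_arr[OF t(3)]
  have "f \<cdot> (w \<cdot> t) = (f \<cdot> w) \<cdot> t" using f w(1,2) t(1,2) by simp
  also have "\<dots> = ZeroArr C (Dom C (w \<cdot> t)) Y" unfolding w(3) using f w(1) t(1,2) by auto
  finally have ft: "f \<cdot> (w \<cdot> t) = ZeroArr C (Dom C (w \<cdot> t)) Y" .
  have cwt: "Cod C (w \<cdot> t) = X" using w t by simp
  obtain m where m: "m \<in> Arr C" "Dom C m = Cod C x" "Cod C m = Y" "m \<cdot> x = f"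
    using weak_cokernel[OF t(3), of f] ft f cwt by metis
  have "Cod C x \<in> D" using t(4) by blast
  then obtain p q r where p: "DTri C p q r" "ShO C (Dom C p) \<in> D \<inter> wge" "Cod C p = Cod C x" "Cod C q \<in> D \<inter> wle"
    by (rule decomposition_D)
  note pt = dtri_arr[OF p(1)]
  have "m \<cdot> p = ZeroArr C (Dom C p) Y"
    using orthogonal_unshift[of "m \<cdot> p"] m p pt assms by auto
  then obtain n where n: "n \<in> Arr C" "Dom C n = Cod C q" "Cod C n = Y" "n \<cdot> q = m"
    using weak_cokernel[OF p(1), of m] m p by metis
  have "Cod C q \<in> wge"
    using wge_extension[OF rotate[OF p(1)]] p t(4) pt by auto
  moreover have "f = n \<cdot> (q \<cdot> x)" unfolding m(4)[symmetric] n(4)[symmetric] by (rule assoc) (use n pt p xt in auto)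
  moreover have "q \<cdot> x \<in> Hom C X (Cod C q)" using pt xt p cwt by simp
  moreover have "n \<in> Hom C (Cod C q) Y" using n by simp
  ultimately show ?thesis using that p(4) by blast
qed

text \<open>A fibre of \<open>a\<close> has \<open>Z\<close> as its cone, so it is a denominator,
  and \<open>b \<cdot> a\<close> vanishes after it.\<close>

lemma loc_zero_through:
  assumes "a \<in> Hom C X Z" "b \<in> Hom C Z Y" "Z \<in> D"
  shows "loc (b \<cdot> a) = ZeroArr Q X Y"
proof -
  obtain u y where u: "DTri C u a y" using fibre[of a] assms by auto
  note t = dtri_arr[OF u]
  have "den u" unfolding cone_in_def using u assms by auto
  moreover have "(b \<cdot> a) \<cdot> u = b \<cdot> (a \<cdot> u)" using t assms by auto
  then have "(b \<cdot> a) \<cdot> u = ZeroArr C (Dom C u) Y" unfolding dtri_comp_zero[OF u] using t assms by auto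
  ultimately show ?thesis using loc_eq_zero[of u "b \<cdot> a"] t assms by simp
qed

section \<open>The weight structure on the quotient\<close>

abbreviation "qle \<equiv> karoubi_closure Q wle"
abbreviation "qge \<equiv> karoubi_closure Q wge"

lemma wle_qle: "X \<in> wle \<Longrightarrow> X \<in> qle" and wge_qge: "X \<in> wge \<Longrightarrow> X \<in> qge"
  using Q.karoubi_closure_incl[of wle] Q.karoubi_closure_incl[of wge] wle_obj wge_obj by auto

lemma additive_closure:
  assumes S: "S \<subseteq> Obj C" and add: "additive_category (full_sub C S)"
  shows "additive_category (full_sub Q (karoubi_closure Q S))"
proof -
  interpret A: additive_category "full_sub C S" by (rule add)
  let ?K = "karoubi_closure Q S"
  have K: "?K \<subseteq> Obj Q" by (rule Q.karoubi_closure_obj)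
  have SK: "S \<subseteq> ?K" using S by (intro Q.karoubi_closure_incl) simp
  show ?thesis
  proof (intro additive_category.intro additive_category_axioms.intro Q.preadditive_full_sub K)
    obtain Z where "zero_object (full_sub C S) Z" using A.ex_zero_object by blast
    then have Z: "Z \<in> S" "Ident C Z = ZeroArr C Z Z" by (auto simp: zero_object_def)
    then have "Ident Q Z = ZeroArr Q Z Z" using loc_ident[of Z] loc_zero[of Z Z] S by auto
    then have "zero_object (full_sub Q ?K) Z" using Z SK by (auto simp: zero_object_def)
    then show "\<exists>Z. zero_object (full_sub Q ?K) Z" ..
  next
    fix X Y assume "X \<in> Obj (full_sub Q ?K)" "Y \<in> Obj (full_sub Q ?K)"
    then have XY: "X \<in> ?K" "Y \<in> ?K" by simp_all
    obtain X0 Y0 where X0: "X0 \<in> S" "retract Q X X0" and Y0: "Y0 \<in> S" "retract Q Y Y0"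
      using XY unfolding karoubi_closure_def by blast
    obtain P0 where "biproduct (full_sub C S) X0 Y0 P0" using A.ex_biproduct[of X0 Y0] X0 Y0 by auto
    then have P0: "P0 \<in> S" "biproduct C X0 Y0 P0" using biproduct_full_sub X0 Y0 S by blast+
    have "X \<in> Obj C" "Y \<in> Obj C" using XY K by auto
    \<comment> \<open>The biproduct of \<open>X\<close> and \<open>Y\<close> is taken in
      \<open>C\<close>, which has the same objects as the quotient; the localization preserves it.
      Only its membership in the closure depends on the biproduct \<open>P0\<close> in
      \<open>S\<close>.\<close>
    then obtain P where "biproduct C X Y P" using ex_biproduct by blast
    then have P: "biproduct Q X Y P" by (rule loc_biproduct)
    have "retract Q P P0" by (rule Q.retract_biproduct[OF X0(2) Y0(2) P loc_biproduct[OF P0(2)]])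
    then have "P \<in> ?K" using P0(1) unfolding karoubi_closure_def by blast
    then show "\<exists>Z. biproduct (full_sub Q ?K) X Y Z" using P Q.biproduct_full_sub XY K by blast
  qed
qed

text \<open>Composing \<open>\<phi>\<close> with the retraction onto \<open>X\<close> and the
  section out of \<open>ShO C Y\<close> gives an arrow from \<open>wge\<close> to the shift of
  \<open>wle\<close>. It comes from \<open>C\<close> by \<open>loc_full\<close> and is zero there;
  \<open>\<phi>\<close> is recovered from it because \<open>p \<cdot> i\<close> and
  \<open>q \<cdot> j\<close> are identities in the quotient.\<close>

lemma Q_orthogonal:
  assumes "\<phi> \<in> Hom Q X (ShO C Y)" "X \<in> qge" "Y \<in> qle"
  shows "\<phi> = ZeroArr Q X (ShO C Y)"
proof -
  obtain X0 where X0: "X0 \<in> wge" "retract Q X X0" using assms unfolding karoubi_closure_def by blast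
  obtain Y0 where Y0: "Y0 \<in> wle" "retract Q Y Y0" using assms unfolding karoubi_closure_def by blast
  have "retract Q (ShO C Y) (ShO C Y0)" using Y0(2) retract_Q_shift unfolding retract_def by simp
  then obtain j q where j: "j \<in> Hom Q (ShO C Y) (ShO C Y0)" "q \<in> Hom Q (ShO C Y0) (ShO C Y)"
    "q \<cdot>\<^bsub>Q\<^esub> j = Ident Q (ShO C Y)" unfolding retract_def by blast
  obtain i p where i: "i \<in> Hom Q X X0" "p \<in> Hom Q X0 X" "p \<cdot>\<^bsub>Q\<^esub> i = Ident Q X"
    using X0(2) unfolding retract_def by blast
  have "j \<cdot>\<^bsub>Q\<^esub> (\<phi> \<cdot>\<^bsub>Q\<^esub> p) \<in> Hom Q X0 (ShO C Y0)" using i j assms(1) by auto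
  then obtain k where k: "k \<in> Hom C X0 (ShO C Y0)" "j \<cdot>\<^bsub>Q\<^esub> (\<phi> \<cdot>\<^bsub>Q\<^esub> p) = loc k"
    using loc_full X0(1) Y0(1) wle_shift by metis
  have obj: "X0 \<in> Obj C" "ShO C Y0 \<in> Obj C" using X0(1) Y0(1) wge_obj wle_obj by auto
  have "k = ZeroArr C X0 (ShO C Y0)" using orthogonal_shift[of k Y0] k X0 Y0 by auto
  then have *: "j \<cdot>\<^bsub>Q\<^esub> (\<phi> \<cdot>\<^bsub>Q\<^esub> p) = ZeroArr Q X0 (ShO C Y0)" using k(2) obj loc_zero by simp
  have "\<phi> = ((q \<cdot>\<^bsub>Q\<^esub> j) \<cdot>\<^bsub>Q\<^esub> \<phi>) \<cdot>\<^bsub>Q\<^esub> (p \<cdot>\<^bsub>Q\<^esub> i)" unfolding i(3) j(3) using assms(1) by auto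
  also have "\<dots> = q \<cdot>\<^bsub>Q\<^esub> ((j \<cdot>\<^bsub>Q\<^esub> (\<phi> \<cdot>\<^bsub>Q\<^esub> p)) \<cdot>\<^bsub>Q\<^esub> i)"
    using i(1,2) j(1,2) assms(1) by simp
  also have "\<dots> = ZeroArr Q X (ShO C Y)" unfolding * using i j obj by auto
  finally show ?thesis .
qed

lemma weight_structure_Q: "weight_structure Q qle qge"
  unfolding weight_structure_def
proof (intro conjI)
  show "qle \<subseteq> Obj Q" "qge \<subseteq> Obj Q" by (rule Q.karoubi_closure_obj)+
  show "additive_category (full_sub Q qle)" "additive_category (full_sub Q qge)"
    using additive_closure wle_obj wge_obj weight unfolding weight_structure_def by blast+
  show "karoubi_closed Q qle" "karoubi_closed Q qge" by (rule Q.karoubi_closed_closure)+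
  show "qge \<subseteq> shift_obj Q 1 ` qge"
  proof
    fix X assume "X \<in> qge"
    then obtain X0 where X0: "X0 \<in> wge" "retract Q X X0" unfolding karoubi_closure_def by blast
    have "X \<in> Obj C" "X0 \<in> Obj C" using X0(2) unfolding retract_def by auto
    then obtain X' X0' where X': "X' \<in> Obj C" "ShO C X' = X" "X0' \<in> Obj C" "ShO C X0' = X0"
      using unshift_obj by metis
    have "X0' \<in> wge" using wge_unshift X' X0 by blast
    moreover have "retract Q X' X0'" using retract_Q_shift X' X0 by metis
    ultimately have "X' \<in> qge" unfolding karoubi_closure_def by blast
    then show "X \<in> shift_obj Q 1 ` qge" using X'(2) by (auto simp: shift_obj_Q)
  qed
  show "shift_obj Q 1 ` qle \<subseteq> qle"
  proof
    fix X assume "X \<in> shift_obj Q 1 ` qle"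
    then obtain Y Y0 where Y: "X = ShO C Y" "Y0 \<in> wle" "retract Q Y Y0"
      unfolding karoubi_closure_def by (auto simp: shift_obj_Q)
    then have "retract Q X (ShO C Y0)" using retract_Q_shift unfolding retract_def by simp
    then show "X \<in> qle" using Y(2) wle_shift unfolding karoubi_closure_def by blast
  qed
  show "orthogonal Q qge (shift_obj Q 1 ` qle)"
    unfolding orthogonal_def
  proof (intro ballI)
    fix X Y assume X: "X \<in> qge" and "Y \<in> shift_obj Q 1 ` qle"
    then obtain Y' where Y: "Y = ShO C Y'" "Y' \<in> qle" by (auto simp: shift_obj_Q)
    have "X \<in> Obj Q" "Y' \<in> Obj Q" using X Y Q.karoubi_closure_obj by blast+
    then show "Hom Q X Y = {ZeroArr Q X Y}" unfolding Y(1) using Q_orthogonal[OF _ X Y(2)] by auto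
  qed
  show "\<forall>X \<in> Obj Q. \<exists>A \<in> qle. \<exists>B \<in> qge.
      \<exists>f \<in> Hom Q (shift_obj Q (- 1) B) X. \<exists>g \<in> Hom Q X A. \<exists>h \<in> Hom Q A B. DTri Q f g h"
  proof
    fix X assume "X \<in> Obj Q"
    then have X: "X \<in> Obj C" by simp
    \<comment> \<open>Every object of the quotient is an object of \<open>C\<close>, so the image of
      its weight decomposition in \<open>C\<close> serves directly.\<close>
    obtain A B f g h where h: "A \<in> wle" "B \<in> wge" "f \<in> Hom C (shift_obj C (- 1) B) X"
      "g \<in> Hom C X A" "h \<in> Hom C A B" "DTri C f g h"
      using bspec[OF ex_weight_decomposition X] by blast
    have "loc f \<in> Hom Q (shift_obj Q (- 1) B) X" "loc g \<in> Hom Q X A" "loc h \<in> Hom Q A B"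
      using h(3-5) by (simp_all add: shift_obj_Q)
    with wle_qle[OF h(1)] wge_qge[OF h(2)] loc_dtri[OF h(6)]
    show "\<exists>A \<in> qle. \<exists>B \<in> qge. \<exists>f \<in> Hom Q (shift_obj Q (- 1) B) X.
        \<exists>g \<in> Hom Q X A. \<exists>h \<in> Hom Q A B. DTri Q f g h"
      by metis
  qed
qed

text \<open>
  If \<open>X\<close> is a retract of both \<open>Y \<in> wge\<close> and \<open>Y1 \<in> wle\<close>, the composite \<open>Y \<rightarrow> X \<rightarrow> Y1\<close> comes from
  \<open>C\<close>, where it factors through the negative part of a weight decomposition of \<open>Y\<close>; that part lies
  in the heart.
\<close>

lemma heart_Q: "qge \<inter> qle = karoubi_closure Q (wge \<inter> wle)"
proof
  show "karoubi_closure Q (wge \<inter> wle) \<subseteq> qge \<inter> qle" unfolding karoubi_closure_def by blast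
  show "qge \<inter> qle \<subseteq> karoubi_closure Q (wge \<inter> wle)"
  proof
    fix X assume "X \<in> qge \<inter> qle"
    then obtain Y Y1 where Y: "Y \<in> wge" "retract Q X Y" and Y1: "Y1 \<in> wle" "retract Q X Y1"
      unfolding karoubi_closure_def by blast
    obtain i p where i: "i \<in> Hom Q X Y" "p \<in> Hom Q Y X" "p \<cdot>\<^bsub>Q\<^esub> i = Ident Q X"
      using Y(2) unfolding retract_def by blast
    obtain j q where j: "j \<in> Hom Q X Y1" "q \<in> Hom Q Y1 X" "q \<cdot>\<^bsub>Q\<^esub> j = Ident Q X"
      using Y1(2) unfolding retract_def by blast
    have "Y \<in> Obj C" using Y(1) wge_obj by blast
    then obtain f g h where g: "DTri C f g h" "ShO C (Dom C f) \<in> wge" "Cod C f = Y" "Cod C g \<in> wle"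
      by (rule weight_decomposition)
    note t = dtri_arr[OF g(1)]
    have A: "Cod C g \<in> wge" using wge_extension[OF rotate[OF g(1)]] g t Y by auto
    obtain m where m: "m \<in> Hom C Y Y1" "j \<cdot>\<^bsub>Q\<^esub> p = loc m"
      using loc_full[of "j \<cdot>\<^bsub>Q\<^esub> p" Y Y1] i j Y Y1 by auto
    have "m \<cdot> f = ZeroArr C (Dom C f) Y1"
      using orthogonal_unshift[of "m \<cdot> f"] m g t Y1 by auto
    then obtain n where n: "n \<in> Arr C" "Dom C n = Cod C g" "Cod C n = Y1" "n \<cdot> g = m"
      using weak_cokernel[OF g(1), of m] m(1) g(3) unfolding in_Hom_iff by metis
    have lm: "loc m = loc n \<cdot>\<^bsub>Q\<^esub> loc g" unfolding n(4)[symmetric] by (rule loc_comp) (use n t in auto)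
    have "Ident Q X = (q \<cdot>\<^bsub>Q\<^esub> j) \<cdot>\<^bsub>Q\<^esub> (p \<cdot>\<^bsub>Q\<^esub> i)" unfolding i(3) j(3) using i j by auto
    also have "\<dots> = q \<cdot>\<^bsub>Q\<^esub> ((j \<cdot>\<^bsub>Q\<^esub> p) \<cdot>\<^bsub>Q\<^esub> i)" using i(1,2) j(1,2) by simp
    also have "\<dots> = (q \<cdot>\<^bsub>Q\<^esub> loc n) \<cdot>\<^bsub>Q\<^esub> (loc g \<cdot>\<^bsub>Q\<^esub> i)"
      unfolding m(2) lm using i(1,2) j(1,2) n(1-3) t g(3) by simp
    finally have "retract Q X (Cod C g)"
      by (intro Q.retractI[of "loc g \<cdot>\<^bsub>Q\<^esub> i" _ _ "q \<cdot>\<^bsub>Q\<^esub> loc n"])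
        (use i(1,2) j(1,2) n(1-3) t g(3) in auto)
    then show "X \<in> karoubi_closure Q (wge \<inter> wle)" using A g(4) unfolding karoubi_closure_def by blast
  qed
qed

section \<open>Boundedness\<close>

lemma shift_obj_closed:
  assumes "X \<in> Obj C"
  shows "shift_obj C n X \<in> Obj C"
proof -
  have 1: "(ShO C ^^ k) X \<in> Obj C" for k using assms by (induction k) auto
  have "inv_into (Obj C) (ShO C) Y \<in> Obj C" if "Y \<in> Obj C" for Y
    using shift_obj_minus1(1)[OF that] by (simp add: shift_obj_def)
  then have 2: "(inv_into (Obj C) (ShO C) ^^ k) X \<in> Obj C" for k using assms by (induction k) auto
  show ?thesis using 1 2 by (simp add: shift_obj_def)
qed

text \<open>Used for both bounds: the quotient has the same objects and the same shift on objects as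
  \<open>C\<close>, while passing to the closure only enlarges the class.\<close>

lemma shift_union_closure:
  assumes "S \<subseteq> Obj C" "(\<Union>l. shift_obj C (- l) ` S) = Obj C"
  shows "(\<Union>l. shift_obj Q (- l) ` karoubi_closure Q S) = Obj Q"
proof -
  have "S \<subseteq> karoubi_closure Q S" using assms by (intro Q.karoubi_closure_incl) simp
  then have "(\<Union>l. shift_obj C (- l) ` S) \<subseteq> (\<Union>l. shift_obj C (- l) ` karoubi_closure Q S)"
    by (intro UN_mono image_mono) auto
  moreover have "karoubi_closure Q S \<subseteq> Obj C" using Q.karoubi_closure_obj[of S] by simp
  then have "(\<Union>l. shift_obj C (- l) ` karoubi_closure Q S) \<subseteq> Obj C"
    using shift_obj_closed by (intro UN_least image_subsetI) auto
  ultimately show ?thesis unfolding shift_obj_Q Q_obj assms(2) by (intro antisym)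
qed

section \<open>The heart of the quotient\<close>

abbreviation "Hw \<equiv> heart C wle wge"
abbreviation "HD_obj \<equiv> (D \<inter> wge) \<inter> (D \<inter> wle)"
abbreviation "F \<equiv> factor_cat Hw HD_obj"
abbreviation "proj \<equiv> factor_arr Hw HD_obj"

lemma Hw_simps [simp]:
  "Obj Hw = wge \<inter> wle" "Dom Hw = Dom C" "Cod Hw = Cod C" "Ident Hw = Ident C" "Comp Hw = Comp C"
  "ZeroArr Hw = ZeroArr C" "AddArr Hw = AddArr C"
  "f \<in> Arr Hw \<longleftrightarrow> f \<in> Arr C \<and> Dom C f \<in> wge \<inter> wle \<and> Cod C f \<in> wge \<inter> wle"
  by (simp_all add: heart_def)

lemma loc_neg: "f \<in> Arr C \<Longrightarrow> loc (neg_arr C f) = neg_arr Q (loc f)"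
  by (rule Q.neg_unique) (simp_all add: loc_add[symmetric] loc_zero)

text \<open>The kernel of \<open>loc\<close> is a subgroup containing every arrow through the heart
  of \<open>D\<close>, hence the subgroup they generate. Conversely, \<open>loc_zero_factors\<close>
  writes each element of the kernel as a single such arrow, so no sums of generators are
  needed.\<close>

lemma through_eq_kernel:
  assumes "X \<in> wge \<inter> wle" "Y \<in> wge \<inter> wle"
  shows "through Hw HD_obj X Y = {f \<in> Hom C X Y. loc f = ZeroArr Q X Y}" (is "_ = ?K")
proof
  let ?G = "hom_group C X Y"
  let ?gens = "{g \<cdot>\<^bsub>Hw\<^esub> f | f g Z. Z \<in> HD_obj \<and> f \<in> Hom Hw X Z \<and> g \<in> Hom Hw Z Y}"
  have XY: "X \<in> Obj C" "Y \<in> Obj C" using assms wge_obj by auto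
  have G: "hom_group Hw X Y = ?G" using assms unfolding heart_def by (intro hom_group_full_sub) auto
  interpret G: comm_group ?G using hom_comm_group XY .
  have "subgroup ?K ?G"
  proof (rule G.subgroupI)
    show "?K \<subseteq> carrier ?G" by (auto simp: hom_group_def)
    have "ZeroArr C X Y \<in> ?K" using XY by (simp add: loc_zero)
    then show "?K \<noteq> {}" by blast
  next
    fix f assume "f \<in> ?K"
    moreover then have "inv\<^bsub>?G\<^esub> f = neg_arr C f" by (auto simp: neg_arr_def)
    ultimately show "inv\<^bsub>?G\<^esub> f \<in> ?K" using XY by (simp add: loc_neg)
  next
    fix f g assume "f \<in> ?K" "g \<in> ?K"
    then have "f \<boxplus> g \<in> ?K" using XY by (simp add: loc_add)
    then show "f \<otimes>\<^bsub>?G\<^esub> g \<in> ?K" by (simp add: hom_group_def)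
  qed
  moreover have "?gens \<subseteq> ?K"
  proof
    fix k assume "k \<in> ?gens"
    then obtain f g Z where k: "k = g \<cdot> f" "Z \<in> D" "f \<in> Hom C X Z" "g \<in> Hom C Z Y" by auto
    then show "k \<in> ?K" using loc_zero_through[OF k(3,4,2)] by simp
  qed
  ultimately show "through Hw HD_obj X Y \<subseteq> ?K"
    unfolding through_def G by (intro G.generate_subgroup_incl)
  show "?K \<subseteq> through Hw HD_obj X Y"
  proof
    fix f assume "f \<in> ?K"
    then have "f \<in> Hom C X Y" "loc f = ZeroArr Q X Y" by auto
    then obtain Z a b where f: "Z \<in> D \<inter> wge \<inter> wle" "a \<in> Hom C X Z" "b \<in> Hom C Z Y" "f = b \<cdot> a"
      using loc_zero_factors[of f X Y] assms by blast
    have "Z \<in> HD_obj" "a \<in> Hom Hw X Z" "b \<in> Hom Hw Z Y" using f(1-3) assms by auto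
    then have "f \<in> ?gens" using f(4) unfolding Hw_simps by blast
    then show "f \<in> through Hw HD_obj X Y" unfolding through_def by (rule generate.incl)
  qed
qed

text \<open>Since the subgroup divided out is the kernel of \<open>loc\<close>, its cosets are the
  fibres of \<open>loc\<close>.\<close>

lemma proj_eq:
  assumes "f \<in> Arr Hw"
  shows "proj f = (Dom C f, Cod C f, {g \<in> Hom C (Dom C f) (Cod C f). loc g = loc f})"
proof -
  define X Y where "X = Dom C f" and "Y = Cod C f"
  have f: "f \<in> Arr C" "X \<in> wge \<inter> wle" "Y \<in> wge \<inter> wle" "Dom C f = X" "Cod C f = Y"
    using assms by (simp_all add: X_def Y_def)
  have XY: "X \<in> Obj C" "Y \<in> Obj C" using f by auto
  have G: "hom_group Hw X Y = hom_group C X Y" using f unfolding heart_def by (intro hom_group_full_sub) auto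
  have "through Hw HD_obj X Y #>\<^bsub>hom_group Hw X Y\<^esub> f = {g \<in> Hom C X Y. loc g = loc f}" (is "?L = ?R")
  proof
    show "?L \<subseteq> ?R"
    proof
      fix g assume "g \<in> ?L"
      then obtain k where k: "k \<in> Hom C X Y" "loc k = ZeroArr Q X Y" "g = k \<boxplus> f"
        unfolding r_coset_def through_eq_kernel[OF f(2,3)] G by (auto simp: hom_group_def)
      then show "g \<in> ?R" using f by (simp add: loc_add)
    qed
    show "?R \<subseteq> ?L"
    proof
      fix g assume g: "g \<in> ?R"
      have "loc (g \<boxplus> neg_arr C f) = ZeroArr Q X Y"
        using g f XY by (simp add: loc_add loc_neg)
      then have k: "g \<boxplus> neg_arr C f \<in> through Hw HD_obj X Y"
        unfolding through_eq_kernel[OF f(2,3)] using g f by simp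
      have "g = (g \<boxplus> neg_arr C f) \<boxplus> f" using g f by (simp add: add_assoc)
      then show "g \<in> ?L" unfolding r_coset_def using k by (auto simp: hom_group_def)
    qed
  qed
  then show ?thesis using f by (simp add: factor_arr_def)
qed

lemma proj_eq_iff:
  assumes "f \<in> Arr Hw" "g \<in> Arr Hw"
  shows "proj f = proj g \<longleftrightarrow> loc f = loc g"
proof
  assume "proj f = proj g"
  then have "{h \<in> Hom C (Dom C f) (Cod C f). loc h = loc f} = {h \<in> Hom C (Dom C g) (Cod C g). loc h = loc g}"
    unfolding proj_eq[OF assms(1)] proj_eq[OF assms(2)] prod.inject by (elim conjE)
  moreover have "f \<in> {h \<in> Hom C (Dom C f) (Cod C f). loc h = loc f}" using assms by simp
  ultimately show "loc f = loc g" by blast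
next
  assume a: "loc f = loc g"
  \<comment> \<open>Arrows of the quotient are tagged with their ends, so equal images already force
    \<open>f\<close> and \<open>g\<close> to be parallel.\<close>
  have "Dom Q (loc f) = Dom Q (loc g)" "Cod Q (loc f) = Cod Q (loc g)" using a by simp_all
  then have "Dom C f = Dom C g" "Cod C f = Cod C g" using assms by simp_all
  then show "proj f = proj g" using a assms by (simp add: proj_eq)
qed

lemma F_fields:
  "Obj F = wge \<inter> wle" "Arr F = proj ` Arr Hw" "Dom F (proj f) = Dom C f" "Cod F (proj f) = Cod C f"
  "Ident F X = proj (Ident C X)"
  by (simp_all add: factor_cat_def factor_arr_def)

lemma F_homE:
  assumes "\<phi> \<in> Hom F X Y"
  obtains f where "f \<in> Arr Hw" "Dom C f = X" "Cod C f = Y" "\<phi> = proj f"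
  using assms F_fields(2-4) by fastforce

text \<open>Representatives with equal classes have equal images under \<open>loc\<close>, so
  functoriality of \<open>loc\<close> makes the class of their composite independent of the
  choice.\<close>

lemma F_comp:
  assumes "f \<in> Arr Hw" "g \<in> Arr Hw" "Cod C f = Dom C g"
  shows "proj g \<cdot>\<^bsub>F\<^esub> proj f = proj (g \<cdot> f)"
proof -
  have "proj g \<cdot>\<^bsub>F\<^esub> proj f = (THE \<chi>. \<exists>f' \<in> Arr Hw. \<exists>g' \<in> Arr Hw. Cod C f' = Dom C g' \<and>
       proj f = proj f' \<and> proj g = proj g' \<and> \<chi> = proj (g' \<cdot> f'))"
    by (simp add: factor_cat_def)
  also have "\<dots> = proj (g \<cdot> f)"
  proof (rule the_equality)
    show "\<exists>f' \<in> Arr Hw. \<exists>g' \<in> Arr Hw. Cod C f' = Dom C g' \<and>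
       proj f = proj f' \<and> proj g = proj g' \<and> proj (g \<cdot> f) = proj (g' \<cdot> f')" using assms by blast
  next
    fix \<chi> assume "\<exists>f' \<in> Arr Hw. \<exists>g' \<in> Arr Hw. Cod C f' = Dom C g' \<and>
       proj f = proj f' \<and> proj g = proj g' \<and> \<chi> = proj (g' \<cdot> f')"
    then obtain f' g' where h: "f' \<in> Arr Hw" "g' \<in> Arr Hw" "Cod C f' = Dom C g'"
       "proj f = proj f'" "proj g = proj g'" "\<chi> = proj (g' \<cdot> f')" by blast
    have "loc f = loc f'" "loc g = loc g'" using h assms proj_eq_iff by blast+
    then have "loc (g' \<cdot> f') = loc (g \<cdot> f)" using h(1-3) assms by (simp add: loc_comp)
    then show "\<chi> = proj (g \<cdot> f)" unfolding h(6) using h(1-3) assms by (subst proj_eq_iff) auto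
  qed
  finally show ?thesis .
qed

lemma F_add:
  assumes "f \<in> Arr Hw" "g \<in> Arr Hw" "Dom C f = Dom C g" "Cod C f = Cod C g"
  shows "proj f \<boxplus>\<^bsub>F\<^esub> proj g = proj (f \<boxplus> g)"
proof -
  have "proj f \<boxplus>\<^bsub>F\<^esub> proj g = (THE \<chi>. \<exists>f' \<in> Arr Hw. \<exists>g' \<in> Arr Hw. Dom C f' = Dom C g' \<and> Cod C f' = Cod C g' \<and>
       proj f = proj f' \<and> proj g = proj g' \<and> \<chi> = proj (f' \<boxplus> g'))"
    by (simp add: factor_cat_def)
  also have "\<dots> = proj (f \<boxplus> g)"
  proof (rule the_equality)
    show "\<exists>f' \<in> Arr Hw. \<exists>g' \<in> Arr Hw. Dom C f' = Dom C g' \<and> Cod C f' = Cod C g' \<and>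
       proj f = proj f' \<and> proj g = proj g' \<and> proj (f \<boxplus> g) = proj (f' \<boxplus> g')" using assms by blast
  next
    fix \<chi> assume "\<exists>f' \<in> Arr Hw. \<exists>g' \<in> Arr Hw. Dom C f' = Dom C g' \<and> Cod C f' = Cod C g' \<and>
       proj f = proj f' \<and> proj g = proj g' \<and> \<chi> = proj (f' \<boxplus> g')"
    then obtain f' g' where h: "f' \<in> Arr Hw" "g' \<in> Arr Hw" "Dom C f' = Dom C g'" "Cod C f' = Cod C g'"
       "proj f = proj f'" "proj g = proj g'" "\<chi> = proj (f' \<boxplus> g')" by blast
    have "loc f = loc f'" "loc g = loc g'" using h assms proj_eq_iff by blast+
    then have "loc (f' \<boxplus> g') = loc (f \<boxplus> g)" using h(1-4) assms by (simp add: loc_add)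
    then show "\<chi> = proj (f \<boxplus> g)" unfolding h(7) using h(1-4) assms by (subst proj_eq_iff) auto
  qed
  finally show ?thesis .
qed

section \<open>The comparison functor from the factor category to the quotient\<close>

text \<open>The choice of a representative is harmless, since \<open>loc\<close> is constant on
  classes.\<close>

definition factor_functor :: "'o \<times> 'o \<times> 'm set \<Rightarrow> 'o \<times> 'o \<times> ('m \<times> 'm) set" where
  "factor_functor \<phi> = loc (SOME f. f \<in> Arr Hw \<and> \<phi> = proj f)"

lemma factor_functor_proj:
  assumes "f \<in> Arr Hw"
  shows "factor_functor (proj f) = loc f"
proof -
  let ?g = "SOME g. g \<in> Arr Hw \<and> proj f = proj g"
  have "?g \<in> Arr Hw \<and> proj f = proj ?g" by (rule someI[of _ f]) (use assms in blast)
  then show ?thesis unfolding factor_functor_def using proj_eq_iff[of f ?g] assms by simp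
qed

lemma factor_functor_additive: "additive_functor F Q (\<lambda>X. X) factor_functor"
  unfolding additive_functor_def
proof (intro conjI ballI)
  fix X assume "X \<in> Obj F"
  then have X: "X \<in> wge \<inter> wle" "X \<in> Obj C" using wge_obj by (auto simp: F_fields)
  then show "X \<in> Obj Q" "factor_functor (Ident F X) = Ident Q X"
    using factor_functor_proj[of "Ident C X"] by (simp_all add: F_fields loc_ident)
next
  fix X Y \<phi> assume "\<phi> \<in> Hom F X Y"
  then obtain f where "f \<in> Arr Hw" "Dom C f = X" "Cod C f = Y" "\<phi> = proj f" by (rule F_homE)
  then show "factor_functor \<phi> \<in> Hom Q X Y" using factor_functor_proj[of f] by simp
next
  fix X Y \<phi> \<psi> assume "\<phi> \<in> Hom F X Y" "\<psi> \<in> Hom F X Y"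
  then obtain f g where f: "f \<in> Arr Hw" "Dom C f = X" "Cod C f = Y" "\<phi> = proj f"
    and g: "g \<in> Arr Hw" "Dom C g = X" "Cod C g = Y" "\<psi> = proj g" by (metis F_homE)
  have "\<phi> \<boxplus>\<^bsub>F\<^esub> \<psi> = proj (f \<boxplus> g)" unfolding f(4) g(4) by (rule F_add) (use f g in auto)
  moreover have "f \<boxplus> g \<in> Arr Hw" using f(1-3) g(1-3) by auto
  ultimately show "factor_functor (\<phi> \<boxplus>\<^bsub>F\<^esub> \<psi>) = factor_functor \<phi> \<boxplus>\<^bsub>Q\<^esub> factor_functor \<psi>"
    using factor_functor_proj f g by (simp add: loc_add)
next
  fix X Y Z \<phi> \<psi> assume "\<phi> \<in> Hom F X Y" "\<psi> \<in> Hom F Y Z"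
  then obtain f g where f: "f \<in> Arr Hw" "Dom C f = X" "Cod C f = Y" "\<phi> = proj f"
    and g: "g \<in> Arr Hw" "Dom C g = Y" "Cod C g = Z" "\<psi> = proj g" by (metis F_homE)
  have "\<psi> \<cdot>\<^bsub>F\<^esub> \<phi> = proj (g \<cdot> f)" unfolding f(4) g(4) by (rule F_comp) (use f g in auto)
  moreover have "g \<cdot> f \<in> Arr Hw" using f(1-3) g(1-3) by auto
  ultimately show "factor_functor (\<psi> \<cdot>\<^bsub>F\<^esub> \<phi>) = factor_functor \<psi> \<cdot>\<^bsub>Q\<^esub> factor_functor \<phi>"
    using factor_functor_proj f g by (simp add: loc_comp)
qed

text \<open>Injectivity is \<open>proj_eq_iff\<close>. Surjectivity is \<open>loc_full\<close>,
  applicable because the source lies in \<open>wge\<close> and the target in \<open>wle\<close>; the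
  lifted arrow has both ends in the heart and so is an arrow of \<open>Hw\<close>.\<close>

lemma factor_functor_fully_faithful: "fully_faithful F Q (\<lambda>X. X) factor_functor"
  unfolding fully_faithful_def
proof (intro ballI)
  fix X Y assume "X \<in> Obj F" "Y \<in> Obj F"
  then have XY: "X \<in> wge \<inter> wle" "Y \<in> wge \<inter> wle" by (auto simp: F_fields)
  show "bij_betw factor_functor (Hom F X Y) (Hom Q X Y)"
    unfolding bij_betw_def
  proof
    show "inj_on factor_functor (Hom F X Y)"
    proof (rule inj_onI)
      fix \<phi> \<psi> assume a: "\<phi> \<in> Hom F X Y" "\<psi> \<in> Hom F X Y" "factor_functor \<phi> = factor_functor \<psi>"
      obtain f g where f: "f \<in> Arr Hw" "\<phi> = proj f" and g: "g \<in> Arr Hw" "\<psi> = proj g"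
        using a(1,2) by (metis F_homE)
      then have "loc f = loc g" using a(3) factor_functor_proj by simp
      then show "\<phi> = \<psi>" using f g proj_eq_iff by blast
    qed
    show "factor_functor ` Hom F X Y = Hom Q X Y"
    proof
      show "factor_functor ` Hom F X Y \<subseteq> Hom Q X Y"
      proof (rule image_subsetI)
        fix \<phi> assume "\<phi> \<in> Hom F X Y"
        then obtain f where "f \<in> Arr Hw" "Dom C f = X" "Cod C f = Y" "\<phi> = proj f" by (rule F_homE)
        then show "factor_functor \<phi> \<in> Hom Q X Y" using factor_functor_proj[of f] by simp
      qed
      show "Hom Q X Y \<subseteq> factor_functor ` Hom F X Y"
      proof
        fix \<phi> assume "\<phi> \<in> Hom Q X Y"
        then obtain k where k: "k \<in> Hom C X Y" "\<phi> = loc k" using loc_full XY by blast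
        then have "k \<in> Arr Hw" using XY by simp
        moreover have "proj k \<in> Hom F X Y" using k calculation by (simp add: F_fields)
        ultimately show "\<phi> \<in> factor_functor ` Hom F X Y" using factor_functor_proj[of k] k(2) by (metis imageI)
      qed
    qed
  qed
qed

end

text \<open>Arrows of the factor and of the quotient have different types, so the factor becomes a
  full subcategory of the quotient only through a fully faithful functor that is the identity on
  objects. Compatibility with the projection and the localization determines this functor on all
  arrows of the factor.\<close>

theorem proposition8p1p1:
  fixes C :: "('o, 'm) tri_cat" and wle wge D :: "'o set"
  assumes "triangulated_category C"
    and "weight_structure C wle wge"
    and "triangulated_subcategory C D"
    and "weight_structure (tri_sub C D) (D \<inter> wle) (D \<inter> wge)"
  shows
    "let Q = verdier_quotient C D;
         qle = karoubi_closure Q wle;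
         qge = karoubi_closure Q wge;
         Hw = heart C wle wge;
         HD = heart (tri_sub C D) (D \<inter> wle) (D \<inter> wge);
         F = factor_cat Hw (Obj HD)
     in weight_structure Q qle qge \<and>
        ((\<exists>J. additive_functor F Q (\<lambda>X. X) J \<and> fully_faithful F Q (\<lambda>X. X) J \<and>
              (\<forall>f \<in> Arr Hw. J (factor_arr Hw (Obj HD) f) = loc_arr C D f)) \<and>
         heart Q qle qge = full_sub Q (karoubi_closure Q (Obj F))) \<and>
        (bounded_above C wle \<longrightarrow> bounded_above Q qle) \<and>
        (bounded_below C wge \<longrightarrow> bounded_below Q qge) \<and>
        (bounded_above C wle \<and> bounded_below C wge
          \<longrightarrow> bounded_above Q qle \<and> bounded_below Q qge)"
proof -
  interpret weighted_localization C wle wge D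
    using assms by (simp add: weighted_localization_def weighted_category_def weighted_category_axioms_def
        verdier_localization_def verdier_localization_axioms_def weighted_localization_axioms_def)
  have HD: "Obj (heart (tri_sub C D) (D \<inter> wle) (D \<inter> wge)) = HD_obj"
    by (simp add: heart_def full_sub_def)
  have "\<exists>J. additive_functor F Q (\<lambda>X. X) J \<and> fully_faithful F Q (\<lambda>X. X) J \<and>
      (\<forall>f \<in> Arr Hw. J (proj f) = loc f)"
    using factor_functor_additive factor_functor_fully_faithful factor_functor_proj by blast
  moreover have "heart Q qle qge = full_sub Q (karoubi_closure Q (Obj F))"
    unfolding heart_def[of Q] heart_Q F_fields(1) ..
  moreover have "bounded_above C wle \<longrightarrow> bounded_above Q qle"
    unfolding bounded_above_def using shift_union_closure[OF wle_obj] by blast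
  moreover have "bounded_below C wge \<longrightarrow> bounded_below Q qge"
    unfolding bounded_below_def using shift_union_closure[OF wge_obj] by blast
  ultimately show ?thesis unfolding Let_def HD using weight_structure_Q by blast
qed

end
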